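(* Let $k$ be a number field and let $P\in\mathbb{P}^n(k)$ be any rational point. Then there exists a sequence of best approximation to $P$ on $\mathbb{P}^n$ (with respect to the hyperplane class). Moreover, any such sequence is contained in a finite set of lines and has constant of approximation equal to $1$, and any line through $P$ (defined over $k$) is a curve of best approximation to $P$.
   Context: Heights are absolute and multiplicative; $H_D$ is a Weil height attached to the divisor $D$ (here $H_D=H$ is the standard height). Let $S$ be the set of archimedean places of $k$ (complex conjugate pairs count once). For a variety $X\subset\mathbb{P}^N_k$ put $\mathrm{dist}(P,Q)=\sum_{v\in S}\mathrm{dist}_v(P,Q)$, where $\mathrm{dist}_v$ is the distance on projective space induced by $v$ ($|\cdot|_v$ extending the usual absolute value on $\mathbb{Q}$); convergence $P_i\to P$ is with respect to $\mathrm{dist}$. For a divisor $D$ on $X$ such that $H_D$ is bounded below by a positive constant on some Zariski open neighbourhood of $P\in X(k)$, and a sequence $\{P_i\}\subset X(k)-\{P\}$ with $P_i\to P$, the approximation constant of $\{P_i\}$ with respect to $P$ and $D$ is the smallest non-negative real $\alpha$ such that $\limsup_{i\to\infty}\mathrm{dist}(P,P_i)^\alpha H_D(P_i)<\infty$; if there is no such smallest number, the sequence has no approximation constant. The approximation constant of $P$ on $X$ with respect to $D$ is the minimum (if achieved) of the approximation constants of all such sequences. A sequence of best approximation to $P$ is one whose approximation constant equals that of $P$. A curve of best approximation to $P$ is a curve on $X$ through $P$ that contains a sequence of best approximation to $P$. *)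

theory Defs
  imports
    "HOL-Analysis.Analysis"
    "HOL-Computational_Algebra.Polynomial"
    "HOL-Algebra.QuotRing"
    "HOL-Algebra.Ideal_Product"
begin

section \<open>Number fields and their places\<close>

text \<open>A number field is a type: a field of characteristic 0 that is finite-dimensional over the
  rationals.\<close>

class number_field = field_char_0 +
  assumes finite_over_rat: "\<exists>B. finite B \<and> (\<forall>x. \<exists>c. x = (\<Sum>b\<in>B. of_rat (c b) * b))"

instance rat :: number_field
proof
  have "x = (\<Sum>b\<in>{1}. of_rat ((\<lambda>_. x) b) * b)" for x :: rat
    by (simp add: of_rat_eq_id)
  then show "\<exists>B::rat set. finite B \<and> (\<forall>x. \<exists>c. x = (\<Sum>b\<in>B. of_rat (c b) * b))"
    by (intro exI[of _ "{1}"] conjI allI exI) auto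
qed

definition field_degree :: "'k::number_field itself \<Rightarrow> nat" where
  "field_degree _ = vector_space.dim (\<lambda>q (x::'k). of_rat q * x) UNIV"

definition embeddings :: "('k::number_field \<Rightarrow> complex) set" where
  "embeddings = {\<sigma>. \<sigma> 1 = 1 \<and> (\<forall>x y. \<sigma> (x + y) = \<sigma> x + \<sigma> y) \<and> (\<forall>x y. \<sigma> (x * y) = \<sigma> x * \<sigma> y)}"

text \<open>An archimedean place is represented by its absolute value extending the usual one on the
  rationals.  Complex conjugate embeddings have the same absolute value, so they contribute one
  element to this set.\<close>

definition arch_places :: "('k::number_field \<Rightarrow> real) set" where
  "arch_places = (\<lambda>\<sigma> x. cmod (\<sigma> x)) ` embeddings"

definition int_ring :: "'k::number_field ring" where
  "int_ring = \<lparr>carrier = {x. algebraic_int x}, mult = (*), one = 1, zero = 0, add = (+)\<rparr>"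

text \<open>A non-archimedean place is represented by its prime ideal in the ring of integers.\<close>

definition fin_places :: "'k::number_field set set" where
  "fin_places = {\<pp>. primeideal \<pp> int_ring \<and> \<pp> \<noteq> {0}}"

definition ideal_power :: "'k::number_field set \<Rightarrow> nat \<Rightarrow> 'k set" where
  "ideal_power I n = (ideal_prod int_ring I ^^ n) (carrier int_ring)"

definition ord_int :: "'k::number_field set \<Rightarrow> 'k \<Rightarrow> nat" where
  "ord_int \<pp> a = (GREATEST n. a \<in> ideal_power \<pp> n)"

definition ord_at :: "'k::number_field set \<Rightarrow> 'k \<Rightarrow> int" where
  "ord_at \<pp> x = (THE e. \<exists>a\<in>carrier int_ring - {0}. \<exists>b\<in>carrier int_ring - {0}.
      x = a / b \<and> e = int (ord_int \<pp> a) - int (ord_int \<pp> b))"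

text \<open>The normalised absolute value: the power of the absolute value extending the
  \<open>p\<close>-adic one whose exponent is the local degree.\<close>

definition fin_abs :: "'k::number_field set \<Rightarrow> 'k \<Rightarrow> real" where
  "fin_abs \<pp> x =
     (if x = 0 then 0 else real (card (carrier (int_ring Quot \<pp>))) powi (- ord_at \<pp> x))"

section \<open>Projective space\<close>

text \<open>If \<open>'n\<close> has \<open>n + 1\<close> elements, the rational points of projective \<open>n\<close>-space are the
  one-dimensional subspaces of \<open>'k ^ 'n\<close>, and the lines defined over \<open>'k\<close> are its two-dimensional
  subspaces.  Incidence is inclusion.\<close>

definition proj_points :: "('k::field ^ 'n) set set" where
  "proj_points = {Q. vec.subspace Q \<and> vec.dim Q = 1}"

definition proj_lines :: "('k::field ^ 'n) set set" where
  "proj_lines = {L. vec.subspace L \<and> vec.dim L = 2}"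

definition points_on :: "('k::field ^ 'n) set \<Rightarrow> ('k ^ 'n) set set" where
  "points_on L = {Q \<in> proj_points. Q \<subseteq> L}"

definition coords :: "('k::field ^ 'n) set \<Rightarrow> 'k ^ 'n" where
  "coords Q = (SOME x. x \<in> Q \<and> x \<noteq> 0)"

text \<open>Homogeneous polynomial functions.  Number fields being infinite, these are the same as
  homogeneous polynomials.\<close>

inductive homogeneous_poly :: "nat \<Rightarrow> ('k::field ^ 'n \<Rightarrow> 'k) \<Rightarrow> bool" where
  const: "homogeneous_poly 0 (\<lambda>x. c)"
| coord: "homogeneous_poly 1 (\<lambda>x. x $ i)"
| add: "homogeneous_poly d f \<Longrightarrow> homogeneous_poly d g \<Longrightarrow> homogeneous_poly d (\<lambda>x. f x + g x)"
| mult: "homogeneous_poly d f \<Longrightarrow> homogeneous_poly e g \<Longrightarrow> homogeneous_poly (d + e) (\<lambda>x. f x * g x)"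

definition zariski_closed :: "('k::field ^ 'n) set set \<Rightarrow> bool" where
  "zariski_closed Z \<longleftrightarrow> (\<exists>F. (\<forall>f\<in>F. \<exists>d. homogeneous_poly d f) \<and>
     Z = {Q \<in> proj_points. \<forall>f\<in>F. \<forall>x\<in>Q. f x = 0})"

definition zariski_irreducible :: "('k::field ^ 'n) set set \<Rightarrow> bool" where
  "zariski_irreducible Z \<longleftrightarrow> zariski_closed Z \<and> Z \<noteq> {} \<and>
     (\<forall>A B. zariski_closed A \<and> zariski_closed B \<and> Z = A \<union> B \<longrightarrow> Z = A \<or> Z = B)"

text \<open>A curve is represented by its set of rational points, an irreducible closed set of Krull
  dimension 1.  A curve with only finitely many rational points is not represented this way, but
  it contains no convergent sequence of the kind considered below.\<close>

definition curve :: "('k::field ^ 'n) set set \<Rightarrow> bool" where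
  "curve C \<longleftrightarrow> zariski_irreducible C \<and>
     (\<exists>Z. zariski_irreducible Z \<and> Z \<subset> C) \<and>
     \<not> (\<exists>Z0 Z1. zariski_irreducible Z0 \<and> zariski_irreducible Z1 \<and> Z0 \<subset> Z1 \<and> Z1 \<subset> C)"

section \<open>Height and distance\<close>

definition max_abs :: "('k \<Rightarrow> real) \<Rightarrow> 'k ^ 'n \<Rightarrow> real" where
  "max_abs f x = Max (range (\<lambda>i. f (x $ i)))"

text \<open>The absolute multiplicative height.  The archimedean part is a product over all embeddings,
  so that a complex place occurs with its local degree 2.  The product over the finite places is
  restricted to the (finitely many) factors different from 1, because a product over an infinite
  set has value 1 by convention.\<close>

definition height_vec :: "'k::number_field ^ 'n \<Rightarrow> real" where
  "height_vec x =
     ((\<Prod>\<sigma>\<in>embeddings. max_abs (\<lambda>t. cmod (\<sigma> t)) x) *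
      (\<Prod>\<pp>\<in>{\<pp>\<in>fin_places. max_abs (fin_abs \<pp>) x \<noteq> 1}. max_abs (fin_abs \<pp>) x))
     powr (1 / real (field_degree TYPE('k)))"

definition height :: "('k::number_field ^ 'n) set \<Rightarrow> real" where
  "height Q = height_vec (coords Q)"

text \<open>The distance induced by an archimedean absolute value is the projective (chordal) metric
  \<open>\<parallel>x \<and> y\<parallel> / (\<parallel>x\<parallel> \<parallel>y\<parallel>)\<close> with Euclidean norms, i.e. the sine of the angle between the two lines.
  The sum over all pairs \<open>(i, j)\<close> counts every coordinate of \<open>x \<and> y\<close> twice.\<close>

definition dist_vec :: "('k::field \<Rightarrow> real) \<Rightarrow> 'k ^ 'n \<Rightarrow> 'k ^ 'n \<Rightarrow> real" where
  "dist_vec v x y =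
     sqrt ((\<Sum>i\<in>UNIV. \<Sum>j\<in>UNIV. (v (x $ i * y $ j - x $ j * y $ i))\<^sup>2) / 2) /
     (sqrt (\<Sum>i\<in>UNIV. (v (x $ i))\<^sup>2) * sqrt (\<Sum>i\<in>UNIV. (v (y $ i))\<^sup>2))"

definition proj_dist :: "('k::number_field ^ 'n) set \<Rightarrow> ('k ^ 'n) set \<Rightarrow> real" where
  "proj_dist P Q = (\<Sum>v\<in>arch_places. dist_vec v (coords P) (coords Q))"

section \<open>Approximation constants\<close>

text \<open>Everything is with respect to the hyperplane class, whose height function is \<open>height\<close>.\<close>

definition approx_seq ::
  "('k::number_field ^ 'n) set \<Rightarrow> (nat \<Rightarrow> ('k ^ 'n) set) \<Rightarrow> bool" where
  "approx_seq P s \<longleftrightarrow> (\<forall>i. s i \<in> proj_points - {P}) \<and> (\<lambda>i. proj_dist P (s i)) \<longlonglongrightarrow> 0"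

definition approx_exponents ::
  "('k::number_field ^ 'n) set \<Rightarrow> (nat \<Rightarrow> ('k ^ 'n) set) \<Rightarrow> real set" where
  "approx_exponents P s =
     {\<alpha>. 0 \<le> \<alpha> \<and> limsup (\<lambda>i. ereal (proj_dist P (s i) powr \<alpha> * height (s i))) < \<infinity>}"

text \<open>Approximation constants need not exist, so both are given as relations.\<close>

definition seq_approx_const ::
  "('k::number_field ^ 'n) set \<Rightarrow> (nat \<Rightarrow> ('k ^ 'n) set) \<Rightarrow> real \<Rightarrow> bool" where
  "seq_approx_const P s \<alpha> \<longleftrightarrow> \<alpha> \<in> approx_exponents P s \<and> (\<forall>\<beta>\<in>approx_exponents P s. \<alpha> \<le> \<beta>)"

definition point_approx_const :: "('k::number_field ^ 'n) set \<Rightarrow> real \<Rightarrow> bool" where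
  "point_approx_const P \<alpha> \<longleftrightarrow>
     (\<exists>s. approx_seq P s \<and> seq_approx_const P s \<alpha>) \<and>
     (\<forall>s \<beta>. approx_seq P s \<and> seq_approx_const P s \<beta> \<longrightarrow> \<alpha> \<le> \<beta>)"

definition best_approx_seq ::
  "('k::number_field ^ 'n) set \<Rightarrow> (nat \<Rightarrow> ('k ^ 'n) set) \<Rightarrow> bool" where
  "best_approx_seq P s \<longleftrightarrow>
     approx_seq P s \<and> (\<exists>\<alpha>. seq_approx_const P s \<alpha> \<and> point_approx_const P \<alpha>)"

definition best_approx_curve ::
  "('k::number_field ^ 'n) set \<Rightarrow> ('k ^ 'n) set set \<Rightarrow> bool" where
  "best_approx_curve P C \<longleftrightarrow> curve C \<and> P \<in> C \<and> (\<exists>s. best_approx_seq P s \<and> range s \<subseteq> C)"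

end

theory Submission
  imports Defs "HOL-Computational_Algebra.Fundamental_Theorem_Algebra" "HOL-Library.Function_Algebras"
begin

text \<open>Write \<open>P = [x]\<close> and \<open>Q = [y]\<close>.  Each local distance from \<open>P\<close> to \<open>Q\<close> is, up to a constant, the
  largest coordinate of \<open>x \<and> y\<close> divided by the largest coordinate of \<open>y\<close>.  Multiplying over the
  archimedean places, and estimating the finite places by the ultrametric inequality, one finds that
  \<open>H(x \<and> y)\<close>, the height of the line \<open>PQ\<close>, is at most a constant times \<open>dist(P, Q) H(Q)\<close>.  Heights are at
  least 1, so no sequence has an approximation constant below 1.  If \<open>dist(P, Q) H(Q)\<close> stays bounded, then
  by Northcott's theorem only finitely many lines \<open>PQ\<close> occur.  On any line through \<open>P\<close> the points
  \<open>[m x + r]\<close> have height \<open>O(m)\<close> and distance \<open>O(1/m)\<close>, so the constant 1 is attained.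

  Independence of the height of the chosen coordinates is the product formula.  For an algebraic
  integer \<open>a\<close> the index of the ideal \<open>(a)\<close> is the product of the norms of its prime factors, and it
  equals the product of the absolute values of the conjugates of \<open>a\<close>: a pigeonhole argument on lattice points
  bounds their quotient on one side, multiplicativity turns the bound into an inequality, and
  multiplying \<open>a\<close> to a rational integer turns the inequality into an equality.\<close>

section \<open>Algebraic integers\<close>

text \<open>The exponent 1 comes from a balance of degrees. The distance is a sum over places, so it
  bounds each local distance; multiplying over the embeddings gives a power of it, while the height
  is the \<open>d\<close>-th root of a product over all places, \<open>d\<close> the degree. The
  powers match only because there are exactly \<open>d\<close> embeddings, so
  \<open>card_embeddings\<close> carries as much weight as the product formula. Both rest on one
  count, which uses an upper bound for integers in a box in place of discriminants and covolumes:
  coefficients below \<open>T\<close> give \<open>T ^ d\<close> lattice points, conjugates of size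
  \<open>T\<close> leave room for about \<open>T ^ n\<close>, and large \<open>T\<close> forces
  \<open>d \<le> n\<close>. The bound itself needs that a nonzero integer has a conjugate of
  absolute value at least 1, which is why homomorphisms into the complex numbers are extended first.
  The finite places are given by prime ideals and residue cardinalities, without reference to
  rational primes. Their values meet the conjugates only in the index of a principal ideal, and this
  is what calls for unique factorization and inverses of primes.\<close>

text \<open>Coefficients are indexed by \<open>A\<close> and not by the image, so \<open>f\<close>
  may identify indices; this matters for the powers of a root of unity.\<close>

lemma (in module) span_image_finite:
  assumes "finite A"
  shows "y \<in> span (f ` A) \<longleftrightarrow> (\<exists>c. y = (\<Sum>i\<in>A. c i *s f i))"
proof
  assume "y \<in> span (f ` A)"
  then show "\<exists>c. y = (\<Sum>i\<in>A. c i *s f i)"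
  proof (induction rule: span_induct_alt)
    case base
    show ?case by (rule exI[of _ "\<lambda>_. 0"]) simp
  next
    case (step a v w)
    then obtain i c where i: "i \<in> A" "v = f i" and c: "w = (\<Sum>i\<in>A. c i *s f i)" by blast
    have "(\<Sum>j\<in>A. (c j + (if j = i then a else 0)) *s f j)
        = (\<Sum>j\<in>A. c j *s f j) + (\<Sum>j\<in>A. (if j = i then a *s f j else 0))"
      by (subst sum.distrib[symmetric]) (auto intro!: sum.cong simp: scale_left_distrib)
    also have "\<dots> = a *s v + w" using assms i c by (simp add: sum.delta add.commute)
    finally show ?case by metis
  qed
next
  assume "\<exists>c. y = (\<Sum>i\<in>A. c i *s f i)"
  then show "y \<in> span (f ` A)" by (auto intro!: span_sum span_scale intro: span_base)
qed

section \<open>Rational and integral spans inside a field\<close>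

definition qscale :: "rat \<Rightarrow> 'a::field_char_0 \<Rightarrow> 'a" where "qscale q x = of_rat q * x"
definition zscale :: "int \<Rightarrow> 'a::field_char_0 \<Rightarrow> 'a" where "zscale n x = of_int n * x"

interpretation Q: vector_space qscale
  by standard (auto simp: qscale_def algebra_simps of_rat_add of_rat_mult)

interpretation Z: module zscale
  by standard (auto simp: zscale_def algebra_simps)

lemma Q_span_mult:
  assumes "y \<in> Q.span S"
  shows "c * y \<in> Q.span ((*) c ` S)"
  using assms
proof (induction rule: Q.span_induct_alt)
  case (step a v w)
  have "c * (qscale a v + w) = qscale a (c * v) + c * w"
    by (simp add: qscale_def algebra_simps)
  then show ?case using step by (auto intro!: Q.span_add Q.span_scale intro: Q.span_base)
qed (simp add: Q.span_zero)

lemma Z_span_mult: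
  assumes "y \<in> Z.span S"
  shows "c * y \<in> Z.span ((*) c ` S)"
  using assms
proof (induction rule: Z.span_induct_alt)
  case (step a v w)
  have "c * (zscale a v + w) = zscale a (c * v) + c * w"
    by (simp add: zscale_def algebra_simps)
  then show ?case using step by (auto intro!: Z.span_add Z.span_scale intro: Z.span_base)
qed (simp add: Z.span_zero)

lemma Z_span_subset_Q_span: "Z.span S \<subseteq> Q.span S"
proof
  fix y assume "y \<in> Z.span S"
  then show "y \<in> Q.span S"
  proof (induction rule: Z.span_induct_alt)
    case (step a v w)
    have "zscale a v + w = qscale (of_int a) v + w" by (simp add: qscale_def zscale_def)
    then show ?case using step by (metis Q.span_add Q.span_scale Q.span_base)
  qed (simp add: Q.span_zero)
qed

lemma common_denominator:
  assumes "finite (A :: rat set)"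
  obtains D :: int where "D > 0" "\<And>q. q \<in> A \<Longrightarrow> of_int D * q \<in> \<int>"
proof -
  have "\<exists>D::int. D > 0 \<and> (\<forall>q\<in>A. of_int D * q \<in> \<int>)"
    using assms
  proof (induction A rule: finite_induct)
    case empty
    show ?case by (intro exI[of _ 1]) auto
  next
    case (insert q A)
    then obtain D :: int where D: "D > 0" "\<And>q. q \<in> A \<Longrightarrow> of_int D * q \<in> \<int>" by blast
    obtain a b where q: "q = Fract a b" "b > 0" by (cases q) auto
    show ?case
    proof (intro exI[of _ "D * b"] conjI ballI)
      show "D * b > 0" using D q by simp
      fix r assume "r \<in> insert q A"
      then consider "r = q" | "r \<in> A" by blast
      then show "of_int (D * b) * r \<in> \<int>"
      proof cases
        case 1
        have "of_int (D * b) * q = of_int (D * a)" using q by (simp add: Fract_of_int_quotient)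
        then show ?thesis using 1 by (metis Ints_of_int)
      next
        case 2
        have "of_int (D * b) * r = of_int b * (of_int D * r)" by simp
        then show ?thesis using D(2)[OF 2] by (metis Ints_mult Ints_of_int)
      qed
    qed
  qed
  then show ?thesis using that by blast
qed

abbreviation powers :: "'a::monoid_mult \<Rightarrow> nat \<Rightarrow> 'a set" where
  "powers x n \<equiv> (\<lambda>i. x ^ i) ` {..<n}"

text \<open>A monic integral equation of degree \<open>m\<close> expresses the \<open>m\<close>-th
  power through the lower ones. In this form integrality is a statement about spans, and closure
  under ring operations needs no polynomials.\<close>

lemma algebraic_int_iff_power_in_span:
  fixes x :: "'a::field_char_0"
  shows "algebraic_int x \<longleftrightarrow> (\<exists>m. x ^ m \<in> Z.span (powers x m))"
proof
  assume "algebraic_int x"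
  then obtain p where p: "lead_coeff p = 1" "\<And>i. coeff p i \<in> \<int>" "poly p x = 0"
    by (auto elim: algebraic_int.cases)
  define m where "m = degree p"
  have "\<exists>c. coeff p i = of_int c" for i using p(2)[of i] by (auto elim: Ints_cases)
  then obtain c where c: "\<And>i. coeff p i = of_int (c i)" by metis
  have "0 = (\<Sum>i\<le>m. coeff p i * x ^ i)" using p(3) by (simp add: poly_altdef m_def)
  also have "\<dots> = x ^ m + (\<Sum>i<m. coeff p i * x ^ i)"
    using p(1) by (simp add: lessThan_Suc_atMost[symmetric] m_def)
  finally have "x ^ m = (\<Sum>i<m. zscale (- c i) (x ^ i))"
    by (simp add: c zscale_def sum_negf eq_neg_iff_add_eq_0)
  then show "\<exists>m. x ^ m \<in> Z.span (powers x m)"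
    by (subst Z.span_image_finite) (auto intro!: exI[of _ m] exI[of _ "\<lambda>i. - c i"])
next
  assume "\<exists>m. x ^ m \<in> Z.span (powers x m)"
  then obtain m c where c: "x ^ m = (\<Sum>i<m. zscale (c i) (x ^ i))"
    by (subst (asm) Z.span_image_finite) auto
  define q :: "'a poly" where "q = (\<Sum>i<m. monom (of_int (c i)) i)"
  define p where "p = monom 1 m - q"
  have qc: "coeff q i = (if i < m then of_int (c i) else 0)" for i
    by (auto simp: q_def coeff_sum)
  have "degree p = m"
  proof (rule antisym)
    show "degree p \<le> m" by (rule degree_le) (auto simp: p_def qc)
    show "m \<le> degree p" by (rule le_degree) (auto simp: p_def qc)
  qed
  then have "lead_coeff p = 1" by (simp add: p_def qc)
  moreover have "coeff p i \<in> \<int>" for i by (auto simp: p_def qc)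
  moreover have "poly p x = 0"
    by (simp add: p_def q_def poly_sum poly_monom c zscale_def)
  ultimately show "algebraic_int x" by (auto intro: algebraic_int.intros)
qed

lemma powers_in_Z_span:
  fixes x :: "'a::field_char_0"
  assumes "x ^ m \<in> Z.span (powers x m)"
  shows "x ^ n \<in> Z.span (powers x m)"
proof (induction n rule: less_induct)
  case (less n)
  show ?case
  proof (cases "n < m")
    case True
    then show ?thesis by (auto intro: Z.span_base)
  next
    case False
    have "x ^ n = x ^ (n - m) * x ^ m" using False by (simp flip: power_add)
    also have "\<dots> \<in> Z.span ((*) (x ^ (n - m)) ` powers x m)" by (rule Z_span_mult[OF assms])
    also have "\<dots> \<subseteq> Z.span (powers x m)"
    proof (rule Z.span_minimal)
      show "(*) (x ^ (n - m)) ` powers x m \<subseteq> Z.span (powers x m)"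
      proof clarify
        fix i assume "i < m"
        then have "x ^ (n - m + i) \<in> Z.span (powers x m)" using False by (intro less) auto
        then show "x ^ (n - m) * x ^ i \<in> Z.span (powers x m)" by (simp add: power_add)
      qed
    qed (rule Z.subspace_span)
    finally show ?thesis .
  qed
qed

lemma powers_in_Q_span:
  fixes x :: "'a::field_char_0"
  assumes "x ^ m \<in> Q.span (powers x m)"
  shows "x ^ n \<in> Q.span (powers x m)"
proof (induction n rule: less_induct)
  case (less n)
  show ?case
  proof (cases "n < m")
    case True
    then show ?thesis by (auto intro: Q.span_base)
  next
    case False
    have "x ^ n = x ^ (n - m) * x ^ m" using False by (simp flip: power_add)
    also have "\<dots> \<in> Q.span ((*) (x ^ (n - m)) ` powers x m)" by (rule Q_span_mult[OF assms])
    also have "\<dots> \<subseteq> Q.span (powers x m)"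
    proof (rule Q.span_minimal)
      show "(*) (x ^ (n - m)) ` powers x m \<subseteq> Q.span (powers x m)"
      proof clarify
        fix i assume "i < m"
        then have "x ^ (n - m + i) \<in> Q.span (powers x m)" using False by (intro less) auto
        then show "x ^ (n - m) * x ^ i \<in> Q.span (powers x m)" by (simp add: power_add)
      qed
    qed (rule Q.subspace_span)
    finally show ?thesis .
  qed
qed

lemma independent_powers:
  fixes x :: "'a::field_char_0"
  assumes "\<And>i. i < n \<Longrightarrow> x ^ i \<notin> Q.span (powers x i)"
  shows "Q.independent (powers x n) \<and> inj_on (\<lambda>i. x ^ i) {..<n}"
  using assms
proof (induction n)
  case (Suc n)
  then have IH: "Q.independent (powers x n)" "inj_on (\<lambda>i. x ^ i) {..<n}" by auto
  have ni: "x ^ n \<notin> Q.span (powers x n)" using Suc.prems by blast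
  then have "x ^ n \<notin> powers x n" by (metis Q.span_base)
  then have "inj_on (\<lambda>i. x ^ i) {..<Suc n}" using IH(2) by (simp add: lessThan_Suc)
  moreover have "Q.independent (insert (x ^ n) (powers x n))" by (rule Q.independent_insertI[OF ni IH(1)])
  ultimately show ?case by (simp add: lessThan_Suc)
qed (auto simp: Q.independent_empty)

text \<open>A finitely generated space cannot contain arbitrarily many independent powers. The least
  \<open>r\<close> at which a power depends on its predecessors gives the relation and the
  independence below it at once.\<close>

lemma minimal_power_relation:
  fixes x :: "'a::field_char_0"
  assumes "finite W" "\<And>n. x ^ n \<in> Q.span W"
  obtains r where "Q.independent (powers x r)" "inj_on (\<lambda>i. x ^ i) {..<r}"
    "x ^ r \<in> Q.span (powers x r)"
proof -
  have "\<exists>r. x ^ r \<in> Q.span (powers x r)"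
  proof (rule ccontr)
    assume "\<not> ?thesis"
    then have *: "Q.independent (powers x n) \<and> inj_on (\<lambda>i. x ^ i) {..<n}" for n
      by (intro independent_powers) auto
    have "card (powers x (Suc (card W))) \<le> card W"
      using * assms by (intro Q.independent_span_bound[THEN conjunct2]) auto
    moreover have "card (powers x (Suc (card W))) = Suc (card W)"
      using * by (subst card_image) auto
    ultimately show False by simp
  qed
  then obtain r where r: "x ^ r \<in> Q.span (powers x r)"
    "\<And>i. i < r \<Longrightarrow> x ^ i \<notin> Q.span (powers x i)"
    using exists_least_iff[of "\<lambda>r. x ^ r \<in> Q.span (powers x r)"] by blast
  show ?thesis using that[of r] independent_powers[of r x] r by blast
qed

text \<open>All powers of \<open>x\<close> have coordinates with one common denominator \<open>D\<close> with respect to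
  \<open>1, x, \<dots>, x ^ (r - 1)\<close>.  Two powers whose numerators agree modulo \<open>D\<close> then give a monic integral
  relation.\<close>

lemma algebraic_int_if_powers_in_span:
  fixes x :: "'a::field_char_0"
  assumes fin: "finite W" and pw: "\<And>n. x ^ n \<in> Z.span W"
  shows "algebraic_int x"
proof -
  obtain r where r: "Q.independent (powers x r)" "inj_on (\<lambda>i. x ^ i) {..<r}"
    "x ^ r \<in> Q.span (powers x r)"
    using minimal_power_relation[OF fin] pw Z_span_subset_Q_span by blast
  note sp = powers_in_Q_span[OF r(3)]
  \<comment> \<open>\<open>W\<close> need not lie in the span of the powers of \<open>x\<close>. A
    basis of the whole space that contains them gives coordinates to \<open>W\<close> too; only
    those along the powers are used.\<close>
  define B where "B = Q.extend_basis (powers x r)"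
  have B: "powers x r \<subseteq> B" "Q.independent B" "Q.span B = UNIV"
    unfolding B_def using r(1)
    by (auto simp: Q.extend_basis_superset Q.independent_extend_basis Q.span_extend_basis)
  define rep where "rep y = Q.representation B y" for y
  have finA: "finite ((\<lambda>(w, b). rep w b) ` (W \<times> powers x r))" using fin by simp
  obtain D :: int where D0: "D > 0"
    and DA: "\<And>q. q \<in> (\<lambda>(w, b). rep w b) ` (W \<times> powers x r) \<Longrightarrow> of_int D * q \<in> \<int>"
    using common_denominator[OF finA] by metis
  have "of_int D * rep w b \<in> \<int>" if "w \<in> W" "b \<in> powers x r" for w b
    by (rule DA) (use that in force)
  note D = D0 this
  have DZ: "of_int D * rep y b \<in> \<int>" if "y \<in> Z.span W" and b: "b \<in> powers x r" for y b
    using that(1)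
  proof (induction rule: Z.span_induct_alt)
    case base
    then show ?case by (simp add: rep_def Q.representation_zero)
  next
    case (step a v w)
    have "zscale a v = qscale (of_int a) v" by (simp add: qscale_def zscale_def)
    then have "rep (zscale a v + w) b = of_int a * rep v b + rep w b"
      unfolding rep_def using B by (simp add: Q.representation_add Q.representation_scale)
    moreover have "of_int a * (of_int D * rep v b) + of_int D * rep w b \<in> \<int>"
      using D(2)[OF step(1) b] step.IH by auto
    ultimately show ?case by (simp add: algebra_simps)
  qed
  define a where "a n i = \<lfloor>of_int D * rep (x ^ n) (x ^ i)\<rfloor>" for n i
  have a: "rep (x ^ n) (x ^ i) = of_int (a n i) / of_int D" if "i < r" for n i
    using DZ[OF pw, of "x ^ i" n] that D(1) by (auto simp: a_def field_simps elim!: Ints_cases)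
  have xn: "x ^ n = (\<Sum>i<r. qscale (of_int (a n i) / of_int D) (x ^ i))" for n
  proof -
    have "x ^ n = (\<Sum>b\<in>powers x r. qscale (Q.representation (powers x r) (x ^ n) b) b)"
      using Q.sum_representation_eq[OF r(1) sp] by auto
    also have "Q.representation (powers x r) (x ^ n) = rep (x ^ n)"
      unfolding rep_def using Q.representation_extend[OF B(2) sp B(1)] by simp
    also have "(\<Sum>b\<in>powers x r. qscale (rep (x ^ n) b) b) = (\<Sum>i<r. qscale (rep (x ^ n) (x ^ i)) (x ^ i))"
      using r(2) by (subst sum.reindex) auto
    also have "\<dots> = (\<Sum>i<r. qscale (of_int (a n i) / of_int D) (x ^ i))" by (auto simp: a)
    finally show ?thesis .
  qed
  define res where "res n = restrict (\<lambda>i. a n i mod D) {..<r}" for n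
  have "res ` {r..} \<subseteq> (\<Pi>\<^sub>E i\<in>{..<r}. {0..<D})"
    using D0 by (simp add: image_subset_iff PiE_iff res_def)
  then have "finite (res ` {r..})"
    by (rule finite_subset) (auto intro!: finite_PiE)
  \<comment> \<open>Exponents start at \<open>r\<close> so that the powers below \<open>r\<close>,
    which occur in the relation, lie below its leading power \<open>x ^ m\<close>.\<close>
  then obtain n where n: "n \<ge> r" "infinite {m \<in> {r..}. res m = res n}"
    using pigeonhole_infinite[of "{r..}" res] by (auto simp: infinite_Ici)
  have "\<exists>m \<in> {m \<in> {r..}. res m = res n}. m > n"
    using n(2) unfolding infinite_nat_iff_unbounded by blast
  then obtain m where m: "m > n" "res m = res n" by blast
  have "\<exists>c. a m i - a n i = D * c" if "i < r" for i
  proof -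
    have "a m i mod D = a n i mod D" using fun_cong[OF m(2), of i] that by (auto simp: res_def)
    then have "D dvd a m i - a n i" by (simp add: mod_eq_dvd_iff)
    then show ?thesis by (auto elim: dvdE)
  qed
  then obtain c where c: "\<And>i. i < r \<Longrightarrow> a m i - a n i = D * c i" by metis
  have "x ^ m - x ^ n = (\<Sum>i<r. zscale (c i) (x ^ i))"
  proof -
    have "x ^ m - x ^ n = (\<Sum>i<r. qscale (of_int (a m i) / of_int D) (x ^ i) -
        qscale (of_int (a n i) / of_int D) (x ^ i))"
      by (simp only: sum_subtractf xn[symmetric])
    also have "\<dots> = (\<Sum>i<r. qscale (of_int (a m i - a n i) / of_int D) (x ^ i))"
      by (simp add: Q.scale_left_diff_distrib[symmetric] diff_divide_distrib)
    also have "\<dots> = (\<Sum>i<r. zscale (c i) (x ^ i))"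
      using D(1) by (intro sum.cong) (auto simp: c qscale_def zscale_def)
    finally show ?thesis .
  qed
  then have "x ^ m - x ^ n \<in> Z.span (powers x r)"
    by (subst Z.span_image_finite) blast+
  moreover have "powers x r \<subseteq> powers x m" using n(1) m(1) by auto
  ultimately have "x ^ m - x ^ n \<in> Z.span (powers x m)"
    using Z.span_mono by (meson subsetD)
  then have "(x ^ m - x ^ n) + x ^ n \<in> Z.span (powers x m)"
    using m(1) by (intro Z.span_add) (auto intro: Z.span_base)
  then show ?thesis using algebraic_int_iff_power_in_span by auto
qed

text \<open>The products \<open>x ^ i * y ^ j\<close> with \<open>i < m\<close> and
  \<open>j < n\<close> generate a group that contains all powers of \<open>x + y\<close> and of
  \<open>x * y\<close>.\<close>

lemma algebraic_int_add_mult: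
  fixes x y :: "'a::field_char_0"
  assumes "algebraic_int x" "algebraic_int y"
  shows "algebraic_int (x + y)" "algebraic_int (x * y)"
proof -
  obtain m n where m: "x ^ m \<in> Z.span (powers x m)" and n: "y ^ n \<in> Z.span (powers y n)"
    using assms algebraic_int_iff_power_in_span by blast
  define W where "W = (\<lambda>(u, v). u * v) ` (powers x m \<times> powers y n)"
  have W: "u * v \<in> Z.span W" if u: "u \<in> Z.span (powers x m)" and v: "v \<in> Z.span (powers y n)" for u v
  proof -
    have "v * u \<in> Z.span ((*) v ` powers x m)" using u by (rule Z_span_mult)
    also have "\<dots> \<subseteq> Z.span W"
    proof (rule Z.span_minimal[OF _ Z.subspace_span], clarify)
      fix i assume i: "i < m"
      have "x ^ i * v \<in> Z.span ((*) (x ^ i) ` powers y n)" using v by (rule Z_span_mult)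
      also have "\<dots> \<subseteq> Z.span W" using i by (intro Z.span_mono) (auto simp: W_def)
      finally show "v * x ^ i \<in> Z.span W" by (simp add: mult.commute)
    qed
    finally show ?thesis by (simp add: mult.commute)
  qed
  have xy: "x ^ i * y ^ j \<in> Z.span W" for i j
    by (rule W[OF powers_in_Z_span[OF m] powers_in_Z_span[OF n]])
  have fin: "finite W" by (simp add: W_def)
  show "algebraic_int (x * y)"
    using fin by (rule algebraic_int_if_powers_in_span) (simp add: power_mult_distrib xy)
  show "algebraic_int (x + y)"
  proof (rule algebraic_int_if_powers_in_span[OF fin])
    fix k
    have "(x + y) ^ k = (\<Sum>i\<le>k. zscale (int (k choose i)) (x ^ i * y ^ (k - i)))"
      by (simp add: binomial_ring zscale_def mult.assoc)
    also have "\<dots> \<in> Z.span W" by (intro Z.span_sum Z.span_scale xy)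
    finally show "(x + y) ^ k \<in> Z.span W" .
  qed
qed

lemma algebraic_int_diff:
  fixes x y :: "'a::field_char_0"
  assumes "algebraic_int x" "algebraic_int y"
  shows "algebraic_int (x - y)"
  using algebraic_int_add_mult(1)[of x "- y"] assms by simp

lemma algebraic_int_prod_mset:
  fixes A :: "'a::field_char_0 multiset"
  assumes "\<And>x. x \<in># A \<Longrightarrow> algebraic_int x"
  shows "algebraic_int (prod_mset A)"
  using assms by (induction A) (auto intro: algebraic_int_add_mult)

section \<open>Extension of homomorphisms to embeddings\<close>

lemma finite_Q_basis:
  obtains B :: "'k::number_field set"
  where "finite B" "Q.independent B" "Q.span B = UNIV" "card B = field_degree TYPE('k)"
proof -
  obtain S :: "'k set" where S: "finite S" "\<And>x. \<exists>c. x = (\<Sum>b\<in>S. of_rat (c b) * b)"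
    using finite_over_rat by blast
  have "Q.span S = UNIV"
  proof -
    have "x \<in> Q.span S" for x
    proof -
      obtain c where "x = (\<Sum>b\<in>S. of_rat (c b) * b)" using S(2) by blast
      then have "x = (\<Sum>b\<in>S. qscale (c b) b)" by (simp add: qscale_def)
      then show ?thesis by (auto intro!: Q.span_sum Q.span_scale intro: Q.span_base)
    qed
    then show ?thesis by blast
  qed
  then obtain B where B: "B \<subseteq> S" "Q.independent B" "S \<subseteq> Q.span B"
    using Q.maximal_independent_subset[of S] by metis
  then have "Q.span B = UNIV" using \<open>Q.span S = UNIV\<close>
    by (metis Q.span_minimal Q.subspace_span top.extremum_uniqueI)
  moreover have "finite B" using B S finite_subset by blast
  moreover have "card B = field_degree TYPE('k)"
  proof -
    have "qscale = (\<lambda>q (x::'k). of_rat q * x)" by (intro ext) (simp add: qscale_def)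
    then have "field_degree TYPE('k) = Q.dim (UNIV :: 'k set)" by (simp add: field_degree_def)
    then show ?thesis
      using Q.basis_card_eq_dim[of B UNIV] B(2) calculation(1) by simp
  qed
  ultimately show ?thesis using that B by blast
qed

lemma number_field_power_relation:
  fixes x :: "'k::number_field"
  obtains r c where "x ^ r = (\<Sum>i<r. of_rat (c i) * x ^ i)"
proof -
  obtain B :: "'k set" where "finite B" "Q.span B = UNIV" using finite_Q_basis by metis
  then obtain r where "x ^ r \<in> Q.span (powers x r)"
    using minimal_power_relation[of B x] by auto
  then show ?thesis
    using that by (subst (asm) Q.span_image_finite) (auto simp: qscale_def)
qed

text \<open>Multiplying the relation for \<open>x\<close> by \<open>D ^ r\<close> makes it monic and
  integral in \<open>D x\<close>: of the \<open>r\<close> factors, \<open>i\<close> go to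
  \<open>x ^ i\<close>, one clears the coefficient, and \<open>r - i - 1\<close> remain.\<close>

lemma integral_multiple:
  fixes x :: "'k::number_field"
  obtains n :: int where "n > 0" "algebraic_int (of_int n * x)"
proof -
  obtain r c where c: "x ^ r = (\<Sum>i<r. of_rat (c i) * x ^ i)" by (rule number_field_power_relation)
  have finA: "finite (c ` {..<r})" by simp
  obtain D :: int where D: "D > 0" "\<And>i. i < r \<Longrightarrow> of_int D * c i \<in> \<int>"
    using common_denominator[OF finA] by (metis imageI lessThan_iff)
  then have "\<exists>a. of_int D * c i = of_int a" if "i < r" for i
    using that by (auto elim: Ints_cases)
  then obtain a where a: "\<And>i. i < r \<Longrightarrow> of_int D * c i = of_int (a i)" by metis
  have a': "of_int D * of_rat (c i) = (of_int (a i) :: 'k)" if "i < r" for i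
    using arg_cong[OF a[OF that], of "of_rat :: rat \<Rightarrow> 'k"] by (simp add: of_rat_mult)
  have "(of_int D * x) ^ r = (\<Sum>i<r. zscale (D ^ (r - i - 1) * a i) ((of_int D * x) ^ i))"
  proof -
    have "(of_int D * x) ^ r = (\<Sum>i<r. of_int D ^ r * (of_rat (c i) * x ^ i))"
      by (simp add: power_mult_distrib c sum_distrib_left)
    also have "\<dots> = (\<Sum>i<r. zscale (D ^ (r - i - 1) * a i) ((of_int D * x) ^ i))"
    proof (rule sum.cong[OF refl])
      fix i assume i: "i \<in> {..<r}"
      then have "r = (r - i - 1) + 1 + i" by auto
      then have "(of_int D ^ r :: 'k) = of_int D ^ (r - i - 1) * of_int D * of_int D ^ i"
        by (metis power_add power_one_right)
      then show "of_int D ^ r * (of_rat (c i) * x ^ i)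
          = zscale (D ^ (r - i - 1) * a i) ((of_int D * x) ^ i)"
        using a'[of i] i by (simp add: zscale_def power_mult_distrib mult_ac)
    qed
    finally show ?thesis .
  qed
  then have "(of_int D * x) ^ r \<in> Z.span (powers (of_int D * x) r)"
    by (subst Z.span_image_finite) (auto intro!: exI[of _ "\<lambda>i. D ^ (r - i - 1) * a i"])
  then show ?thesis using that D(1) algebraic_int_iff_power_in_span by blast
qed

text \<open>Closure under inverses need not be demanded: since the field is finite-dimensional over
  the rationals, such a ring is a subfield, see \<open>qsubring_inverse\<close>.\<close>

definition qsubring :: "'k::number_field set \<Rightarrow> bool" where
  "qsubring R \<longleftrightarrow> range of_rat \<subseteq> R \<and> (\<forall>x\<in>R. \<forall>y\<in>R. x + y \<in> R \<and> x * y \<in> R)"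

text \<open>A partial homomorphism as a total function; its values outside \<open>R\<close> are
  arbitrary.\<close>

definition hom_on :: "'k::number_field set \<Rightarrow> ('k \<Rightarrow> complex) \<Rightarrow> bool" where
  "hom_on R \<tau> \<longleftrightarrow> \<tau> 1 = 1 \<and> (\<forall>x\<in>R. \<forall>y\<in>R. \<tau> (x + y) = \<tau> x + \<tau> y \<and> \<tau> (x * y) = \<tau> x * \<tau> y)"

definition polys_over :: "'k::number_field set \<Rightarrow> 'k poly set" where
  "polys_over R = {p. \<forall>i. coeff p i \<in> R}"

lemma qsubring_of_rat: "qsubring R \<Longrightarrow> of_rat q \<in> R"
  and qsubring_add: "qsubring R \<Longrightarrow> x \<in> R \<Longrightarrow> y \<in> R \<Longrightarrow> x + y \<in> R"
  and qsubring_mult: "qsubring R \<Longrightarrow> x \<in> R \<Longrightarrow> y \<in> R \<Longrightarrow> x * y \<in> R"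
  by (auto simp: qsubring_def)

lemma qsubring_0: "qsubring R \<Longrightarrow> 0 \<in> R" and qsubring_1: "qsubring R \<Longrightarrow> 1 \<in> R"
  using qsubring_of_rat[of R 0] qsubring_of_rat[of R 1] by auto

lemma qsubring_uminus: "qsubring R \<Longrightarrow> x \<in> R \<Longrightarrow> - x \<in> R"
  using qsubring_mult[OF _ qsubring_of_rat[of R "-1"], of x] by (simp add: of_rat_minus)

lemma qsubring_diff: "qsubring R \<Longrightarrow> x \<in> R \<Longrightarrow> y \<in> R \<Longrightarrow> x - y \<in> R"
  using qsubring_add[of R x "- y"] qsubring_uminus by auto

lemma qsubring_sum: "qsubring R \<Longrightarrow> (\<And>i. i \<in> A \<Longrightarrow> f i \<in> R) \<Longrightarrow> sum f A \<in> R"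
  by (induction A rule: infinite_finite_induct) (auto simp: qsubring_0 qsubring_add)

lemma qsubring_power: "qsubring R \<Longrightarrow> x \<in> R \<Longrightarrow> x ^ n \<in> R"
  by (induction n) (auto simp: qsubring_1 qsubring_mult)

text \<open>The inverse \<open>y\<close> satisfies a relation of some degree \<open>r\<close> with
  rational coefficients. Multiplied by \<open>x ^ (r - 1)\<close>, it exhibits \<open>y\<close> as a
  polynomial in \<open>x\<close>.\<close>

lemma qsubring_inverse:
  fixes x :: "'k::number_field"
  assumes R: "qsubring R" and x: "x \<in> R"
  shows "inverse x \<in> R"
proof (cases "x = 0")
  case True
  then show ?thesis using qsubring_0[OF R] by simp
next
  case False
  define y where "y = inverse x"
  have yx: "x * y = 1" using False by (simp add: y_def)
  obtain r c where c: "y ^ r = (\<Sum>i<r. of_rat (c i) * y ^ i)" by (rule number_field_power_relation)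
  have "r \<noteq> 0" using c by (cases r) auto
  then obtain s where s: "r = Suc s" by (cases r) auto
  have xy: "x ^ s * y ^ i = x ^ (s - i)" if "i \<le> s" for i
  proof -
    have "x ^ s = x ^ (s - i) * x ^ i" using that by (simp flip: power_add)
    then have "x ^ s * y ^ i = x ^ (s - i) * (x * y) ^ i" by (simp add: power_mult_distrib)
    then show ?thesis by (simp add: yx)
  qed
  have "y = x ^ s * y ^ s * y" using xy[of s] by simp
  also have "\<dots> = x ^ s * y ^ r" by (simp add: s mult_ac)
  also have "\<dots> = (\<Sum>i<r. of_rat (c i) * (x ^ s * y ^ i))"
    by (simp add: c sum_distrib_left mult_ac)
  also have "\<dots> = (\<Sum>i<r. of_rat (c i) * x ^ (s - i))" by (intro sum.cong) (auto simp: xy s)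
  also have "\<dots> \<in> R"
    by (intro qsubring_sum qsubring_mult qsubring_power qsubring_of_rat R x)
  finally show ?thesis by (simp add: y_def)
qed

lemma hom_on_0: "qsubring R \<Longrightarrow> hom_on R \<tau> \<Longrightarrow> \<tau> 0 = 0"
  using qsubring_0[of R] unfolding hom_on_def by (metis add_cancel_right_right)

lemma hom_on_uminus: "qsubring R \<Longrightarrow> hom_on R \<tau> \<Longrightarrow> x \<in> R \<Longrightarrow> \<tau> (- x) = - \<tau> x"
  using qsubring_uminus[of R x] hom_on_0[of R \<tau>] unfolding hom_on_def
  by (metis add.right_inverse minus_unique)

lemma hom_on_sum:
  "qsubring R \<Longrightarrow> hom_on R \<tau> \<Longrightarrow> (\<And>i. i \<in> A \<Longrightarrow> f i \<in> R) \<Longrightarrow> \<tau> (sum f A) = (\<Sum>i\<in>A. \<tau> (f i))"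
proof (induction A rule: infinite_finite_induct)
  case (insert a A)
  then have "sum f A \<in> R" "f a \<in> R" by (auto intro: qsubring_sum)
  then show ?case using insert by (simp add: hom_on_def)
qed (auto simp: hom_on_0)

lemma polys_over_add: "qsubring R \<Longrightarrow> p \<in> polys_over R \<Longrightarrow> q \<in> polys_over R \<Longrightarrow> p + q \<in> polys_over R"
  by (auto simp: polys_over_def qsubring_add)

lemma polys_over_uminus: "qsubring R \<Longrightarrow> p \<in> polys_over R \<Longrightarrow> - p \<in> polys_over R"
  by (auto simp: polys_over_def qsubring_uminus)

lemma polys_over_diff: "qsubring R \<Longrightarrow> p \<in> polys_over R \<Longrightarrow> q \<in> polys_over R \<Longrightarrow> p - q \<in> polys_over R"
  by (auto simp: polys_over_def qsubring_diff)

lemma polys_over_mult: "qsubring R \<Longrightarrow> p \<in> polys_over R \<Longrightarrow> q \<in> polys_over R \<Longrightarrow> p * q \<in> polys_over R"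
  by (auto simp: polys_over_def coeff_mult intro!: qsubring_sum qsubring_mult)

lemma polys_over_monom: "qsubring R \<Longrightarrow> c \<in> R \<Longrightarrow> monom c n \<in> polys_over R"
  by (auto simp: polys_over_def qsubring_0)

lemma map_poly_hom_add:
  assumes "qsubring R" "hom_on R \<tau>" "p \<in> polys_over R" "q \<in> polys_over R"
  shows "map_poly \<tau> (p + q) = map_poly \<tau> p + map_poly \<tau> q"
  using assms by (intro poly_eqI) (auto simp: coeff_map_poly hom_on_0 polys_over_def hom_on_def)

lemma map_poly_hom_uminus:
  assumes "qsubring R" "hom_on R \<tau>" "p \<in> polys_over R"
  shows "map_poly \<tau> (- p) = - map_poly \<tau> p"
  using assms
  by (intro poly_eqI) (auto simp: coeff_map_poly hom_on_0 polys_over_def hom_on_uminus)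

lemma map_poly_hom_mult:
  assumes R: "qsubring R" "hom_on R \<tau>" "p \<in> polys_over R" "q \<in> polys_over R"
  shows "map_poly \<tau> (p * q) = map_poly \<tau> p * map_poly \<tau> q"
proof (rule poly_eqI)
  fix n
  have "\<tau> (\<Sum>i\<le>n. coeff p i * coeff q (n - i)) = (\<Sum>i\<le>n. \<tau> (coeff p i * coeff q (n - i)))"
    using R by (intro hom_on_sum) (auto simp: polys_over_def qsubring_mult)
  then show "coeff (map_poly \<tau> (p * q)) n = coeff (map_poly \<tau> p * map_poly \<tau> q) n"
    using R by (auto simp: coeff_map_poly hom_on_0 coeff_mult polys_over_def hom_on_def)
qed

lemma map_poly_hom_monom:
  assumes "qsubring R" "hom_on R \<tau>"
  shows "map_poly \<tau> (monom c n) = monom (\<tau> c) n"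
  using assms by (intro poly_eqI) (auto simp: coeff_map_poly hom_on_0)

section \<open>Minimal polynomials over a subfield and one-step extensions\<close>

definition min_poly_over :: "'k::number_field set \<Rightarrow> 'k \<Rightarrow> 'k poly \<Rightarrow> bool" where
  "min_poly_over R c p \<longleftrightarrow> p \<in> polys_over R \<and> lead_coeff p = 1 \<and> poly p c = 0 \<and>
     (\<forall>q\<in>polys_over R. q \<noteq> 0 \<and> poly q c = 0 \<longrightarrow> degree p \<le> degree q)"

lemma min_poly_over_exists:
  fixes c :: "'k::number_field"
  assumes R: "qsubring R"
  obtains p where "min_poly_over R c p"
proof -
  obtain r a where a: "c ^ r = (\<Sum>i<r. of_rat (a i) * c ^ i)" by (rule number_field_power_relation)
  define q :: "'k poly" where "q = monom 1 r - (\<Sum>i<r. monom (of_rat (a i)) i)"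
  have cq: "coeff q i = (if i = r then 1 else if i < r then - of_rat (a i) else 0)" for i
    by (auto simp: q_def coeff_sum)
  have "q \<in> polys_over R"
    using R by (auto simp: polys_over_def cq qsubring_0 qsubring_1 qsubring_of_rat qsubring_uminus)
  moreover have "q \<noteq> 0" using cq[of r] by auto
  moreover have "poly q c = 0" by (simp add: q_def poly_sum poly_monom a)
  ultimately have ex: "\<exists>n. \<exists>q. q \<in> polys_over R \<and> q \<noteq> 0 \<and> poly q c = 0 \<and> degree q = n" by blast
  define n where "n = (LEAST n. \<exists>q::'k poly. q \<in> polys_over R \<and> q \<noteq> 0 \<and> poly q c = 0 \<and> degree q = n)"
  obtain p where p: "p \<in> polys_over R" "p \<noteq> 0" "poly p c = 0" "degree p = n"
    using LeastI_ex[OF ex] unfolding n_def by blast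
  have le: "n \<le> degree q" if "q \<in> polys_over R" "q \<noteq> 0" "poly q c = 0" for q
    unfolding n_def by (rule Least_le) (use that in blast)
  have "smult (inverse (lead_coeff p)) p \<in> polys_over R"
    using p(1) R by (auto simp: polys_over_def qsubring_mult qsubring_inverse)
  then have "min_poly_over R c (smult (inverse (lead_coeff p)) p)"
    using p le by (auto simp: min_poly_over_def)
  then show ?thesis using that by blast
qed

text \<open>Long division by a monic polynomial keeps all coefficients in \<open>R\<close>. Each
  intermediate remainder still vanishes at \<open>c\<close>, so by minimality it is zero or can be
  divided further.\<close>

lemma min_poly_over_dvd:
  assumes R: "qsubring R" and p: "min_poly_over R c p"
    and q: "q \<in> polys_over R" "poly q c = 0"
  obtains s where "s \<in> polys_over R" "q = p * s"
proof -
  note p' = p[unfolded min_poly_over_def]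
  have "\<exists>s\<in>polys_over R. q = p * s" if "\<forall>i\<ge>n. coeff q i = 0" "q \<in> polys_over R" "poly q c = 0" for n q
    using that
  proof (induction n arbitrary: q)
    case 0
    then have "q = 0" by (intro poly_eqI) auto
    then show ?case using 0 by (intro bexI[of _ 0]) auto
  next
    case (Suc n)
    show ?case
    proof (cases "coeff q n = 0")
      case True
      then have "\<forall>i\<ge>n. coeff q i = 0" using Suc.prems(1) by (metis le_eq_less_or_eq Suc_leI)
      then show ?thesis using Suc by blast
    next
      case False
      have dq: "degree q = n"
        using False Suc.prems(1) by (intro antisym degree_le le_degree) auto
      moreover have "q \<noteq> 0" using False by auto
      ultimately have dn: "degree p \<le> n" using p' Suc.prems by auto
      define m where "m = monom (coeff q n) (n - degree p)"
      have m: "m \<in> polys_over R"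
        using Suc.prems(2) R unfolding m_def by (intro polys_over_monom) (auto simp: polys_over_def)
      define q' where "q' = q - p * m"
      have "q' \<in> polys_over R" "poly q' c = 0"
        using Suc.prems m p' R by (auto simp: q'_def intro!: polys_over_diff polys_over_mult)
      moreover have "coeff q' i = 0" if "i \<ge> n" for i
      proof (cases "i = n")
        case True
        then show ?thesis using dn p'
          by (simp add: q'_def m_def coeff_monom_mult mult.commute[of p])
      next
        case False
        then have "degree (p * m) < i"
          using degree_mult_le[of p m] degree_monom_le[of "coeff q n" "n - degree p"] dn that
          unfolding m_def by linarith
        then show ?thesis using Suc.prems(1) False that by (simp add: q'_def coeff_eq_0)
      qed
      ultimately obtain s where s: "s \<in> polys_over R" "q' = p * s" using Suc.IH[of q'] by blast
      then have "q = p * (s + m)" by (simp add: q'_def algebra_simps)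
      then show ?thesis using s m R polys_over_add by blast
    qed
  qed
  from this[of "Suc (degree q)" q] show ?thesis
    using q that by (auto simp: coeff_eq_0)
qed

text \<open>The new domain is \<open>R[c]\<close>, and \<open>q(c)\<close> is sent to the value at
  \<open>\<beta>\<close> of the image of \<open>q\<close>. This is well defined because two
  polynomials that agree at \<open>c\<close> differ by a multiple of \<open>p\<close>, whose image
  vanishes at \<open>\<beta>\<close>.\<close>

lemma extend_hom:
  assumes R: "qsubring R" and h: "hom_on R \<tau>"
    and p: "min_poly_over R c p" and \<beta>: "poly (map_poly \<tau> p) \<beta> = 0"
  obtains R' \<tau>' where "qsubring R'" "hom_on R' \<tau>'" "insert c R \<subseteq> R'" "\<tau>' c = \<beta>"
    "\<And>x. x \<in> R \<Longrightarrow> \<tau>' x = \<tau> x"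
proof -
  define ev where "ev q = poly (map_poly \<tau> q) \<beta>" for q
  have ev_eq: "ev q = ev q'"
    if "q \<in> polys_over R" "q' \<in> polys_over R" "poly q c = poly q' c" for q q'
  proof -
    have "q + - q' \<in> polys_over R" using that R by (intro polys_over_add polys_over_uminus)
    moreover have "poly (q + - q') c = 0" using that by simp
    ultimately obtain s where s: "s \<in> polys_over R" "q + - q' = p * s"
      using min_poly_over_dvd[OF R p] by metis
    have pR: "p \<in> polys_over R" using p by (simp add: min_poly_over_def)
    have "map_poly \<tau> (q + - q') = map_poly \<tau> p * map_poly \<tau> s"
      unfolding s(2) by (rule map_poly_hom_mult[OF R h pR s(1)])
    moreover have "map_poly \<tau> (q + - q') = map_poly \<tau> q - map_poly \<tau> q'"
      using map_poly_hom_add[OF R h that(1) polys_over_uminus[OF R that(2)]]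
        map_poly_hom_uminus[OF R h that(2)] by simp
    ultimately have "map_poly \<tau> q - map_poly \<tau> q' = map_poly \<tau> p * map_poly \<tau> s" by simp
    then have "ev q - ev q' = 0" using \<beta> unfolding ev_def by (metis mult_zero_left poly_diff poly_mult)
    then show ?thesis by simp
  qed
  define R' where "R' = (\<lambda>q. poly q c) ` polys_over R"
  define pre where "pre x = (SOME q. q \<in> polys_over R \<and> poly q c = x)" for x
  define \<tau>' where "\<tau>' x = ev (pre x)" for x
  have \<tau>': "\<tau>' (poly q c) = ev q" if "q \<in> polys_over R" for q
  proof -
    have "pre (poly q c) \<in> polys_over R \<and> poly (pre (poly q c)) c = poly q c"
      unfolding pre_def by (rule someI[of _ q]) (use that in simp)
    then show ?thesis unfolding \<tau>'_def using that by (intro ev_eq) auto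
  qed
  have const: "monom a 0 \<in> polys_over R" "ev (monom a 0) = \<tau> a" "poly (monom a 0) c = a" if "a \<in> R" for a
    using that R h by (auto simp: polys_over_monom ev_def map_poly_hom_monom poly_monom)
  have X: "monom 1 1 \<in> polys_over R" "ev (monom 1 1) = \<beta>" "poly (monom 1 1) c = c"
    using R h by (auto simp: polys_over_monom qsubring_1 ev_def map_poly_hom_monom poly_monom hom_on_def)
  have sub: "insert c R \<subseteq> R'"
    using const X unfolding R'_def by (metis (no_types, lifting) image_eqI insert_subset subsetI)
  show ?thesis
  proof (rule that[of R' \<tau>'])
    show "qsubring R'"
      unfolding qsubring_def
    proof (intro conjI ballI)
      show "range of_rat \<subseteq> R'" using sub R by (auto simp: qsubring_def)
      fix x y assume "x \<in> R'" "y \<in> R'"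
      then obtain q q' where q: "q \<in> polys_over R" "x = poly q c" "q' \<in> polys_over R" "y = poly q' c"
        by (auto simp: R'_def)
      show "x + y \<in> R'" using q polys_over_add[OF R q(1,3)]
        unfolding R'_def by (metis image_eqI poly_add)
      show "x * y \<in> R'" using q polys_over_mult[OF R q(1,3)]
        unfolding R'_def by (metis image_eqI poly_mult)
    qed
    show "hom_on R' \<tau>'"
      unfolding hom_on_def
    proof (intro conjI ballI)
      show "\<tau>' 1 = 1"
        using \<tau>'[OF const(1)[OF qsubring_1[OF R]]] const(2,3)[OF qsubring_1[OF R]] h
        unfolding hom_on_def by metis
      fix x y assume "x \<in> R'" "y \<in> R'"
      then obtain q q' where q: "q \<in> polys_over R" "x = poly q c" "q' \<in> polys_over R" "y = poly q' c"
        by (auto simp: R'_def)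
      show "\<tau>' (x + y) = \<tau>' x + \<tau>' y"
        using \<tau>'[OF q(1)] \<tau>'[OF q(3)] \<tau>'[OF polys_over_add[OF R q(1,3)]]
        by (simp add: q ev_def map_poly_hom_add[OF R h q(1,3)])
      show "\<tau>' (x * y) = \<tau>' x * \<tau>' y"
        using \<tau>'[OF q(1)] \<tau>'[OF q(3)] \<tau>'[OF polys_over_mult[OF R q(1,3)]]
        by (simp add: q ev_def map_poly_hom_mult[OF R h q(1,3)])
    qed
    show "insert c R \<subseteq> R'" by (rule sub)
    show "\<tau>' c = \<beta>" using \<tau>'[OF X(1)] X by simp
    show "\<tau>' x = \<tau> x" if "x \<in> R" for x using \<tau>'[OF const(1)] const that by simp
  qed
qed

text \<open>The image of the minimal polynomial of \<open>c\<close> is monic of positive degree, so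
  it has a complex root, and \<open>c\<close> can be sent there.\<close>

lemma extend_hom_exists:
  assumes R: "qsubring R" and h: "hom_on R \<tau>"
  obtains R' \<tau>' where "qsubring R'" "hom_on R' \<tau>'" "insert c R \<subseteq> R'"
    "\<And>x. x \<in> R \<Longrightarrow> \<tau>' x = \<tau> x"
proof -
  obtain p where p: "min_poly_over R c p" using min_poly_over_exists[OF R] by blast
  have lc: "coeff (map_poly \<tau> p) (degree p) = 1"
    using p h hom_on_0[OF R h] by (simp add: coeff_map_poly min_poly_over_def hom_on_def)
  have "degree p \<noteq> 0"
  proof
    assume "degree p = 0"
    then have "p = 1" using p by (auto simp: min_poly_over_def elim!: degree_eq_zeroE)
    then show False using p by (simp add: min_poly_over_def)
  qed
  moreover have "degree p \<le> degree (map_poly \<tau> p)" using lc by (intro le_degree) simp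
  ultimately have "\<not> constant (poly (map_poly \<tau> p))" by (simp add: constant_degree)
  then obtain \<beta> where "poly (map_poly \<tau> p) \<beta> = 0" using fundamental_theorem_of_algebra by blast
  from extend_hom[OF R h p this] show ?thesis using that by metis
qed

text \<open>The elements of a finite spanning set are adjoined one after the other.\<close>

lemma extend_to_embedding:
  fixes \<tau> :: "'k::number_field \<Rightarrow> complex"
  assumes R: "qsubring R" and h: "hom_on R \<tau>"
  obtains \<sigma> where "\<sigma> \<in> embeddings" "\<And>x. x \<in> R \<Longrightarrow> \<sigma> x = \<tau> x"
proof -
  obtain B :: "'k set" where B: "finite B" "Q.span B = UNIV" using finite_Q_basis by metis
  have "\<exists>R' \<tau>'. qsubring R' \<and> hom_on R' \<tau>' \<and> A \<union> R \<subseteq> R' \<and> (\<forall>x\<in>R. \<tau>' x = \<tau> x)"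
    if "finite A" for A
    using that
  proof (induction A rule: finite_induct)
    case empty
    then show ?case using R h by auto
  next
    case (insert a A)
    then obtain R1 \<tau>1 where 1: "qsubring R1" "hom_on R1 \<tau>1" "A \<union> R \<subseteq> R1" "\<forall>x\<in>R. \<tau>1 x = \<tau> x"
      by blast
    obtain R2 \<tau>2 where 2: "qsubring R2" "hom_on R2 \<tau>2" "insert a R1 \<subseteq> R2" "\<And>x. x \<in> R1 \<Longrightarrow> \<tau>2 x = \<tau>1 x"
      using extend_hom_exists[OF 1(1,2)] by metis
    show ?case using 1 2 by (intro exI[of _ R2] exI[of _ \<tau>2]) auto
  qed
  from this[OF B(1)] obtain R' \<sigma> where R': "qsubring R'" "hom_on R' \<sigma>" "B \<union> R \<subseteq> R'" "\<forall>x\<in>R. \<sigma> x = \<tau> x"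
    by blast
  have "x \<in> R'" for x
  proof -
    have "x \<in> Q.span B" using B by simp
    then show ?thesis
    proof (induction rule: Q.span_induct_alt)
      case base
      then show ?case using R' by (simp add: qsubring_0)
    next
      case (step a v w)
      then show ?case using R'
        by (auto simp: qscale_def intro!: qsubring_add qsubring_mult qsubring_of_rat)
    qed
  qed
  then have "\<sigma> \<in> embeddings" using R'(2) by (simp add: embeddings_def hom_on_def)
  then show ?thesis using that R'(4) by blast
qed

lemma qsubring_Rats: "qsubring (range of_rat)"
  by (auto simp: qsubring_def simp flip: of_rat_add of_rat_mult)

text \<open>The constant coefficient of the minimal polynomial is, up to sign, the product of its complex
  roots, so it is an algebraic integer and rational, hence a nonzero integer.  Therefore some
  root has absolute value at least 1, and that root is a conjugate.\<close>

lemma embedding_ge_1: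
  fixes e :: "'k::number_field"
  assumes e: "algebraic_int e" "e \<noteq> 0"
  obtains \<sigma> where "\<sigma> \<in> embeddings" "cmod (\<sigma> e) \<ge> 1"
proof -
  define R where "R = range (of_rat :: rat \<Rightarrow> 'k)"
  define \<tau> :: "'k \<Rightarrow> complex" where "\<tau> x = of_rat (inv_into UNIV of_rat x)" for x
  have R: "qsubring R" unfolding R_def by (rule qsubring_Rats)
  have \<tau>q: "\<tau> (of_rat q) = of_rat q" for q by (simp add: \<tau>_def inv_f_f inj_def)
  have h: "hom_on R \<tau>"
    using \<tau>q[of 1] by (auto simp: hom_on_def R_def \<tau>q simp flip: of_rat_add of_rat_mult)
  obtain p where p: "min_poly_over R e p" using min_poly_over_exists[OF R] by blast
  note p' = p[unfolded min_poly_over_def]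
  define P where "P = map_poly \<tau> p"
  have \<tau>0: "\<tau> 0 = 0" by (rule hom_on_0[OF R h])
  have cP: "coeff P i = \<tau> (coeff p i)" for i by (simp add: P_def coeff_map_poly \<tau>0)
  obtain f :: "'k poly" where f: "lead_coeff f = 1" "\<And>i. coeff f i \<in> \<int>" "poly f e = 0"
    using e(1) by (auto elim: algebraic_int.cases)
  have "\<int> \<subseteq> R" unfolding R_def by (metis Ints_cases of_rat_of_int_eq rangeI subsetI)
  then have fR: "f \<in> polys_over R" using f(2) by (auto simp: polys_over_def)
  then obtain s where s: "s \<in> polys_over R" "f = p * s" using min_poly_over_dvd[OF R p _ f(3)] by metis
  \<comment> \<open>\<open>P\<close> divides the image of the monic integral polynomial
    \<open>f\<close>, so every root of \<open>P\<close> is integral.\<close>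
  have roots: "algebraic_int \<beta>" if "poly P \<beta> = 0" for \<beta>
  proof -
    have "poly (map_poly \<tau> f) \<beta> = 0"
      using that map_poly_hom_mult[OF R h _ s(1)] p' by (simp add: s(2) P_def)
    moreover have cf: "coeff (map_poly \<tau> f) i = \<tau> (coeff f i)" for i by (simp add: coeff_map_poly \<tau>0)
    moreover have "\<tau> (coeff f i) \<in> \<int>" for i
    proof -
      obtain z where "coeff f i = of_int z" using f(2) by (metis Ints_cases)
      then have "\<tau> (coeff f i) = of_int z" using \<tau>q[of "of_int z"] by simp
      then show ?thesis by simp
    qed
    moreover have "lead_coeff (map_poly \<tau> f) = 1"
    proof -
      have "degree (map_poly \<tau> f) = degree f"
        using f(1) h
        by (intro antisym degree_le le_degree) (auto simp: cf hom_on_def coeff_eq_0 \<tau>0)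
      then show ?thesis using f(1) h by (simp add: cf hom_on_def)
    qed
    ultimately show ?thesis by (intro algebraic_int.intros) auto
  qed
  have dP: "degree P = degree p" unfolding P_def
    using p' h by (intro antisym degree_le le_degree)
      (auto simp: cP[unfolded P_def] hom_on_def coeff_eq_0 \<tau>0)
  have lP: "lead_coeff P = 1" using dP p' h by (simp add: cP hom_on_def)
  have dec: "P = (\<Prod>x\<in>#proots P. [:- x, 1:])"
    using complex_poly_decompose_multiset[of P] lP by simp
  have P0: "coeff P 0 = (\<Prod>x\<in>#proots P. - x)"
    by (subst dec) (simp add: poly_0_coeff_0[symmetric] poly_prod_mset image_mset.compositionality o_def)
  have Pne: "P \<noteq> 0" using lP by auto
  have "algebraic_int (coeff P 0)" unfolding P0
    using roots Pne by (intro algebraic_int_prod_mset) auto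
  moreover have "coeff P 0 \<in> \<rat>" by (simp add: cP \<tau>_def)
  ultimately have "coeff P 0 \<in> \<int>" by (rule rational_algebraic_int_is_int)
  \<comment> \<open>Otherwise a factor \<open>X\<close> could be split off; as \<open>e\<close> is
    nonzero, the cofactor would still vanish at \<open>e\<close>, against minimality.\<close>
  moreover have "coeff P 0 \<noteq> 0"
  proof
    assume "coeff P 0 = 0"
    moreover obtain q where q: "coeff p 0 = of_rat q" using p' by (auto simp: polys_over_def R_def)
    ultimately have "coeff p 0 = 0" by (simp add: cP \<tau>q)
    then obtain t where t: "p = pCons 0 t" by (cases p) auto
    have "coeff t i \<in> R" for i
    proof -
      have "coeff p (Suc i) \<in> R" using p' by (simp add: polys_over_def)
      then show ?thesis by (simp add: t)
    qed
    then have "t \<in> polys_over R" by (simp add: polys_over_def)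
    moreover have "t \<noteq> 0"
    proof
      assume "t = 0"
      then show False using Pne dP t cP[of 0] lP by (simp add: \<tau>0)
    qed
    moreover have "poly t e = 0"
    proof -
      have "poly p e = 0" using p' by blast
      then show ?thesis using e(2) by (simp add: t)
    qed
    ultimately have "degree p \<le> degree t" using p' by blast
    then show False using t \<open>t \<noteq> 0\<close> by simp
  qed
  ultimately have ge: "cmod (coeff P 0) \<ge> 1" by (auto elim!: Ints_cases)
  have "\<exists>\<beta>. poly P \<beta> = 0 \<and> cmod \<beta> \<ge> 1"
  proof (rule ccontr)
    assume "\<not> ?thesis"
    then have small: "cmod x < 1" if "x \<in># proots P" for x using that Pne by force
    have "degree P \<noteq> 0"
    proof
      assume "degree P = 0"
      then have "p = 1" using p' dP by (auto elim!: degree_eq_zeroE)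
      then show False using p' by simp
    qed
    then have "proots P \<noteq> {#}" using size_proots_complex[of P] by auto
    then obtain x A where xA: "proots P = add_mset x A" by (metis multiset_cases)
    have "(\<Prod>x\<in>#A. cmod x) \<le> 1 \<and> (\<Prod>x\<in>#A. cmod x) \<ge> 0" if "\<forall>x\<in>#A. cmod x < 1" for A
      using that by (induction A) (auto intro!: mult_le_one)
    then have "(\<Prod>x\<in>#A. cmod x) \<le> 1" "(\<Prod>x\<in>#A. cmod x) \<ge> 0" using small xA by auto
    moreover have "cmod x < 1" using small xA by auto
    moreover have "cmod (\<Prod>x\<in>#M. - x) = (\<Prod>x\<in>#M. cmod x)" for M :: "complex multiset"
      by (induction M) (auto simp: norm_mult)
    then have "cmod (coeff P 0) = cmod x * (\<Prod>x\<in>#A. cmod x)"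
      by (simp add: P0 xA norm_mult)
    ultimately have "cmod (coeff P 0) < 1"
      using mult_left_le[of "\<Prod>x\<in>#A. cmod x" "cmod x"] by simp
    then show False using ge by simp
  qed
  then obtain \<beta> where \<beta>: "poly P \<beta> = 0" "cmod \<beta> \<ge> 1" by blast
  obtain R1 \<tau>1 where 1: "qsubring R1" "hom_on R1 \<tau>1" "insert e R \<subseteq> R1" "\<tau>1 e = \<beta>"
    using extend_hom[OF R h p \<beta>(1)[unfolded P_def]] by metis
  obtain \<sigma> where "\<sigma> \<in> embeddings" "\<And>x. x \<in> R1 \<Longrightarrow> \<sigma> x = \<tau>1 x"
    using extend_to_embedding[OF 1(1,2)] by metis
  then show ?thesis using that[of \<sigma>] 1 \<beta> by auto
qed

section \<open>Embeddings\<close>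

abbreviation integers :: "'k::number_field set" where "integers \<equiv> Collect algebraic_int"

lemma embeddings_simps:
  assumes "\<sigma> \<in> embeddings"
  shows embedding_add: "\<sigma> (x + y) = \<sigma> x + \<sigma> y"
    and embedding_mult: "\<sigma> (x * y) = \<sigma> x * \<sigma> y"
    and embedding_1: "\<sigma> 1 = 1"
    and embedding_0: "\<sigma> 0 = 0"
    and embedding_uminus: "\<sigma> (- x) = - \<sigma> x"
    and embedding_diff: "\<sigma> (x - y) = \<sigma> x - \<sigma> y"
proof -
  show a: "\<sigma> (x + y) = \<sigma> x + \<sigma> y" for x y using assms by (simp add: embeddings_def)
  show "\<sigma> (x * y) = \<sigma> x * \<sigma> y" "\<sigma> 1 = 1" using assms by (auto simp: embeddings_def)
  show 0: "\<sigma> 0 = 0" using a[of 0 0] by simp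
  show m: "\<sigma> (- x) = - \<sigma> x" for x using a[of x "- x"] 0 by (simp add: eq_neg_iff_add_eq_0 add.commute)
  show "\<sigma> (x - y) = \<sigma> x - \<sigma> y" using a[of x "- y"] m by simp
qed

lemma embedding_sum: "\<sigma> \<in> embeddings \<Longrightarrow> \<sigma> (sum f A) = (\<Sum>i\<in>A. \<sigma> (f i))"
  by (induction A rule: infinite_finite_induct) (auto simp: embeddings_simps)

lemma embedding_eq_0_iff: "\<sigma> \<in> embeddings \<Longrightarrow> \<sigma> x = 0 \<longleftrightarrow> x = 0"
proof
  assume s: "\<sigma> \<in> embeddings" and 0: "\<sigma> x = 0"
  show "x = 0"
  proof (rule ccontr)
    assume "x \<noteq> 0"
    then have "\<sigma> x * \<sigma> (inverse x) = 1" using s by (simp flip: embedding_mult add: embedding_1)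
    then show False using 0 by simp
  qed
qed (auto simp: embedding_0)

lemma embedding_inverse: "\<sigma> \<in> embeddings \<Longrightarrow> \<sigma> (inverse x) = inverse (\<sigma> x)"
proof (cases "x = 0")
  case False
  assume s: "\<sigma> \<in> embeddings"
  then have "\<sigma> x * \<sigma> (inverse x) = 1" using False by (simp flip: embedding_mult add: embedding_1)
  then show ?thesis by (simp add: inverse_unique)
qed (simp add: embedding_0)

lemma embedding_divide: "\<sigma> \<in> embeddings \<Longrightarrow> \<sigma> (x / y) = \<sigma> x / \<sigma> y"
  by (simp add: divide_inverse embedding_mult embedding_inverse)

lemma embedding_of_nat: "\<sigma> \<in> embeddings \<Longrightarrow> \<sigma> (of_nat n) = of_nat n"
  by (induction n) (auto simp: embeddings_simps)

lemma embedding_of_int: "\<sigma> \<in> embeddings \<Longrightarrow> \<sigma> (of_int n) = of_int n"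
  by (cases n) (auto simp: embedding_of_nat embeddings_simps)

lemma embedding_of_rat: "\<sigma> \<in> embeddings \<Longrightarrow> \<sigma> (of_rat q) = of_rat q"
  by (cases q) (simp add: of_rat_rat embedding_divide embedding_of_int)

lemma embedding_cnj: "\<sigma> \<in> embeddings \<Longrightarrow> (\<lambda>x. cnj (\<sigma> x)) \<in> embeddings"
  by (simp add: embeddings_def)

text \<open>Dedekind's argument: replace \<open>x\<close> by \<open>y * x\<close> and subtract
  \<open>\<tau> y\<close> times the relation. The term of \<open>\<tau>\<close> cancels, and each
  other coefficient is multiplied by \<open>\<sigma> y - \<tau> y\<close>, which is nonzero for a
  suitable \<open>y\<close>.\<close>

lemma embeddings_linearly_independent:
  assumes "finite E" "E \<subseteq> embeddings" "\<And>x. (\<Sum>\<sigma>\<in>E. c \<sigma> * \<sigma> x) = 0" "\<sigma> \<in> E"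
  shows "c \<sigma> = 0"
  using assms
proof (induction E arbitrary: c \<sigma> rule: finite_induct)
  case (insert \<tau> E)
  have \<tau>: "\<tau> \<in> embeddings" and E: "E \<subseteq> embeddings" using insert by auto
  have 0: "c \<tau> * \<tau> x + (\<Sum>\<sigma>\<in>E. c \<sigma> * \<sigma> x) = 0" for x
    using insert.prems(2)[of x] insert.hyps by simp
  have cE: "c \<rho> = 0" if "\<rho> \<in> E" for \<rho>
  proof -
    have "\<rho> \<noteq> \<tau>" using that insert.hyps by blast
    then obtain y where y: "\<rho> y \<noteq> \<tau> y" by blast
    have "(\<Sum>\<sigma>\<in>E. (c \<sigma> * (\<sigma> y - \<tau> y)) * \<sigma> x) = 0" for x
    proof -
      have "(\<Sum>\<sigma>\<in>E. (c \<sigma> * (\<sigma> y - \<tau> y)) * \<sigma> x)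
          = (\<Sum>\<sigma>\<in>E. c \<sigma> * (\<sigma> y * \<sigma> x)) - \<tau> y * (\<Sum>\<sigma>\<in>E. c \<sigma> * \<sigma> x)"
        by (simp add: sum_subtractf[symmetric] sum_distrib_left algebra_simps)
      also have "(\<Sum>\<sigma>\<in>E. c \<sigma> * (\<sigma> y * \<sigma> x)) = (\<Sum>\<sigma>\<in>E. c \<sigma> * \<sigma> (y * x))"
        using E by (intro sum.cong) (auto simp: embedding_mult)
      also have "\<dots> = - (c \<tau> * \<tau> (y * x))" using 0[of "y * x"] by (simp add: eq_neg_iff_add_eq_0 add.commute)
      also have "(\<Sum>\<sigma>\<in>E. c \<sigma> * \<sigma> x) = - (c \<tau> * \<tau> x)" using 0[of x] by (simp add: eq_neg_iff_add_eq_0 add.commute)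
      finally show ?thesis using \<tau> by (simp add: embedding_mult)
    qed
    then have "c \<rho> * (\<rho> y - \<tau> y) = 0" by (rule insert.IH[OF E _ that])
    then show ?thesis using y by simp
  qed
  have "c \<tau> = 0" using 0[of 1] cE \<tau> by (simp add: embedding_1)
  then show ?case using cE insert.prems by auto
qed simp

interpretation F: vector_space "\<lambda>c (f :: 'a \<Rightarrow> complex) x. c * f x"
  by standard (auto simp: fun_eq_iff algebra_simps)

lemma sum_fun_apply: "(\<Sum>i\<in>A. g i) x = (\<Sum>i\<in>A. g i x)"
  for g :: "'b \<Rightarrow> 'a \<Rightarrow> complex"
  by (induction A rule: infinite_finite_induct) auto

text \<open>Embeddings are linear over the rationals, so they lie in the complex span of the
  coordinate functions of a basis; independence then bounds their number by its size.\<close>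

lemma embeddings_finite_le_degree:
  "finite (embeddings :: ('k::number_field \<Rightarrow> complex) set) \<and>
   card (embeddings :: ('k \<Rightarrow> complex) set) \<le> field_degree TYPE('k)"
proof -
  obtain B :: "'k set" where B: "finite B" "Q.independent B" "Q.span B = UNIV"
    "card B = field_degree TYPE('k)" by (rule finite_Q_basis)
  define f where "f b = (\<lambda>x. of_rat (Q.representation B x b) :: complex)" for b
  have sub: "embeddings \<subseteq> F.span (f ` B)"
  proof
    fix \<sigma> :: "'k \<Rightarrow> complex" assume s: "\<sigma> \<in> embeddings"
    have "\<sigma> = (\<Sum>b\<in>B. (\<lambda>x. \<sigma> b * f b x))"
    proof
      fix x
      have "x = (\<Sum>b\<in>B. qscale (Q.representation B x b) b)"
        using Q.sum_representation_eq[OF B(2) _ B(1)] B(3) by auto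
      then have "\<sigma> x = \<sigma> (\<Sum>b\<in>B. qscale (Q.representation B x b) b)" by simp
      also have "\<dots> = (\<Sum>b\<in>B. \<sigma> b * f b x)"
        using s by (auto simp: embedding_sum qscale_def embedding_mult embedding_of_rat f_def mult.commute)
      finally show "\<sigma> x = (\<Sum>b\<in>B. (\<lambda>x. \<sigma> b * f b x)) x" by (simp add: sum_fun_apply)
    qed
    also have "\<dots> \<in> F.span (f ` B)"
    proof (rule F.span_sum)
      fix b assume "b \<in> B"
      then have "f b \<in> F.span (f ` B)" by (intro F.span_base) simp
      then show "(\<lambda>x. \<sigma> b * f b x) \<in> F.span (f ` B)" by (rule F.span_scale)
    qed
    finally show "\<sigma> \<in> F.span (f ` B)" .
  qed
  \<comment> \<open>The set of embeddings is not yet known to be finite; a uniform bound on its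
    finite subsets yields both claims.\<close>
  have "finite E \<and> card E \<le> field_degree TYPE('k)" if E: "finite E" "E \<subseteq> embeddings" for E :: "('k \<Rightarrow> complex) set"
  proof -
    have "F.independent E"
    proof (rule F.independent_if_scalars_zero[OF E(1)])
      fix c and \<sigma> :: "'k \<Rightarrow> complex" assume 0: "(\<Sum>\<sigma>\<in>E. (\<lambda>x. c \<sigma> * \<sigma> x)) = 0" and s: "\<sigma> \<in> E"
      have "(\<Sum>\<sigma>\<in>E. c \<sigma> * \<sigma> x) = 0" for x
        using fun_cong[OF 0, of x] by (simp add: sum_fun_apply)
      then show "c \<sigma> = 0" using embeddings_linearly_independent[OF E _ s] by blast
    qed
    moreover have "E \<subseteq> F.span (f ` B)" using sub E by blast
    ultimately have "card E \<le> card (f ` B)" using F.independent_span_bound[of "f ` B" E] B(1) by blast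
    also have "\<dots> \<le> card B" using B(1) by (rule card_image_le)
    finally show ?thesis using E B(4) by simp
  qed
  then show ?thesis
    by (intro finite_if_finite_subsets_card_bdd) blast
qed

lemmas finite_embeddings = embeddings_finite_le_degree[THEN conjunct1]

text \<open>The functions \<open>Re \<sigma> + Im \<sigma>\<close> are real coordinates: for a conjugate pair they are
  \<open>Re \<sigma> \<plusminus> Im \<sigma>\<close>.\<close>

lemma inj_on_floor_embeddings:
  "inj_on (\<lambda>e. restrict (\<lambda>\<sigma>. \<lfloor>Re (\<sigma> e) + Im (\<sigma> e)\<rfloor>) embeddings) (integers :: 'k::number_field set)"
proof (rule inj_onI, rule ccontr)
  fix e e' :: 'k
  assume e: "e \<in> integers" "e' \<in> integers" and ne: "e \<noteq> e'"
    and eq: "restrict (\<lambda>\<sigma>. \<lfloor>Re (\<sigma> e) + Im (\<sigma> e)\<rfloor>) embeddings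
      = restrict (\<lambda>\<sigma>. \<lfloor>Re (\<sigma> e') + Im (\<sigma> e')\<rfloor>) embeddings"
  define z where "z = e - e'"
  have lt: "\<bar>Re (\<sigma> z) + Im (\<sigma> z)\<bar> < 1" if "\<sigma> \<in> embeddings" for \<sigma>
  proof -
    have "\<lfloor>Re (\<sigma> e) + Im (\<sigma> e)\<rfloor> = \<lfloor>Re (\<sigma> e') + Im (\<sigma> e')\<rfloor>" using fun_cong[OF eq, of \<sigma>] that by simp
    then have "\<bar>(Re (\<sigma> e) + Im (\<sigma> e)) - (Re (\<sigma> e') + Im (\<sigma> e'))\<bar> < 1" by linarith
    then show ?thesis using that by (simp add: z_def embedding_diff algebra_simps)
  qed
  have "algebraic_int z" using e by (simp add: z_def algebraic_int_diff)
  \<comment> \<open>A nonzero integer is not small at every embedding; this discreteness lets the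
    floors separate integers.\<close>
  then obtain \<sigma> where s: "\<sigma> \<in> embeddings" "cmod (\<sigma> z) \<ge> 1"
    using embedding_ge_1[of z] ne by (auto simp: z_def)
  have a: "(Re (\<sigma> z) + Im (\<sigma> z))\<^sup>2 < 1" using lt[OF s(1)] by (simp add: abs_square_less_1)
  have b: "(Re (\<sigma> z) - Im (\<sigma> z))\<^sup>2 < 1" using lt[OF embedding_cnj[OF s(1)]] by (simp add: abs_square_less_1)
  have "(cmod (\<sigma> z))\<^sup>2 = ((Re (\<sigma> z) + Im (\<sigma> z))\<^sup>2 + (Re (\<sigma> z) - Im (\<sigma> z))\<^sup>2) / 2"
    unfolding cmod_power2 by (simp add: power2_eq_square algebra_simps)
  also have "\<dots> < 1" using add_strict_mono[OF a b] by (simp only: divide_less_eq) simp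
  finally have "(cmod (\<sigma> z))\<^sup>2 < 1" .
  then show False using s(2) by (simp add: abs_square_less_1)
qed

text \<open>Each unit cell of the coordinates \<open>Re + Im\<close> holds at most one integer.
  These coordinates have absolute value at most \<open>2 R\<close>, which leaves at most
  \<open>4 R + 2\<close> cells per embedding, and \<open>4 R + 2 \<le> 6 R\<close> since
  \<open>R \<ge> 1\<close>.\<close>

lemma integers_in_box:
  fixes R :: "('k::number_field \<Rightarrow> complex) \<Rightarrow> real"
  assumes R: "\<And>\<sigma>. \<sigma> \<in> embeddings \<Longrightarrow> R \<sigma> \<ge> 1"
  defines "S \<equiv> {e \<in> integers. \<forall>\<sigma>\<in>embeddings. cmod (\<sigma> e) \<le> R \<sigma>}"
  shows "finite S" "real (card S) \<le> (\<Prod>\<sigma>\<in>embeddings. 6 * R \<sigma>)"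
proof -
  define g where "g e = restrict (\<lambda>\<sigma>. \<lfloor>Re (\<sigma> e) + Im (\<sigma> e)\<rfloor>) embeddings" for e :: 'k
  define J where "J \<sigma> = {- \<lceil>2 * R \<sigma>\<rceil> .. \<lfloor>2 * R \<sigma>\<rfloor>}" for \<sigma>
  have sub: "g ` S \<subseteq> PiE embeddings J"
  proof (rule image_subsetI)
    fix e assume e: "e \<in> S"
    have "\<lfloor>Re (\<sigma> e) + Im (\<sigma> e)\<rfloor> \<in> J \<sigma>" if "\<sigma> \<in> embeddings" for \<sigma>
    proof -
      have "cmod (\<sigma> e) \<le> R \<sigma>" using e that by (simp add: S_def)
      then have "\<bar>Re (\<sigma> e)\<bar> \<le> R \<sigma>" "\<bar>Im (\<sigma> e)\<bar> \<le> R \<sigma>"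
        using abs_Re_le_cmod[of "\<sigma> e"] abs_Im_le_cmod[of "\<sigma> e"] by linarith+
      then have "Re (\<sigma> e) + Im (\<sigma> e) \<le> 2 * R \<sigma>" "- (2 * R \<sigma>) \<le> Re (\<sigma> e) + Im (\<sigma> e)" by linarith+
      then have "\<lfloor>Re (\<sigma> e) + Im (\<sigma> e)\<rfloor> \<le> \<lfloor>2 * R \<sigma>\<rfloor>" "\<lfloor>- (2 * R \<sigma>)\<rfloor> \<le> \<lfloor>Re (\<sigma> e) + Im (\<sigma> e)\<rfloor>"
        by (auto intro: floor_mono)
      then show ?thesis by (simp add: J_def ceiling_def)
    qed
    then show "g e \<in> PiE embeddings J" by (simp add: g_def PiE_iff)
  qed
  have fin: "finite (PiE embeddings J)" by (intro finite_PiE finite_embeddings) (simp add: J_def)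
  have inj: "inj_on g S"
    using inj_on_floor_embeddings unfolding g_def by (rule inj_on_subset) (auto simp: S_def)
  show "finite S" using inj sub fin finite_imageD finite_subset by blast
  have "real (card S) \<le> real (card (PiE embeddings J))"
    using card_inj_on_le[OF inj sub fin] by simp
  also have "\<dots> = (\<Prod>\<sigma>\<in>embeddings. real (card (J \<sigma>)))" by (simp add: card_PiE finite_embeddings)
  also have "\<dots> \<le> (\<Prod>\<sigma>\<in>embeddings. 6 * R \<sigma>)"
  proof (rule prod_mono)
    fix \<sigma> :: "'k \<Rightarrow> complex" assume "\<sigma> \<in> embeddings"
    then have 1: "R \<sigma> \<ge> 1" by (rule R)
    have "real (card (J \<sigma>)) = real_of_int (\<lfloor>2 * R \<sigma>\<rfloor> + \<lceil>2 * R \<sigma>\<rceil> + 1)"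
      using 1 by (simp add: J_def)
    also have "\<dots> \<le> 6 * R \<sigma>" using 1 by linarith
    finally show "0 \<le> real (card (J \<sigma>)) \<and> real (card (J \<sigma>)) \<le> 6 * R \<sigma>" by simp
  qed
  finally show "real (card S) \<le> (\<Prod>\<sigma>\<in>embeddings. 6 * R \<sigma>)" .
qed

lemma finite_bounded_integers:
  fixes C :: real
  shows "finite {e \<in> (integers :: 'k::number_field set). \<forall>\<sigma>\<in>embeddings. cmod (\<sigma> e) \<le> C}"
proof (rule finite_subset)
  show "finite {e \<in> (integers :: 'k set). \<forall>\<sigma>\<in>embeddings. cmod (\<sigma> e) \<le> max 1 C}"
    by (rule integers_in_box(1)) simp
  show "{e \<in> (integers :: 'k set). \<forall>\<sigma>\<in>embeddings. cmod (\<sigma> e) \<le> C}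
      \<subseteq> {e \<in> integers. \<forall>\<sigma>\<in>embeddings. cmod (\<sigma> e) \<le> max 1 C}"
    by (auto intro: max.coboundedI2)
qed

section \<open>Indices of additive subgroups\<close>

definition addsub :: "'a::ring_1 set \<Rightarrow> bool" where
  "addsub A \<longleftrightarrow> 0 \<in> A \<and> (\<forall>x\<in>A. \<forall>y\<in>A. x - y \<in> A)"

text \<open>\<open>B\<close> need not lie in \<open>A\<close>; the cosets are those of
  \<open>B\<close> that have a representative in \<open>A\<close>.\<close>

definition quot :: "'a::ring_1 set \<Rightarrow> 'a set \<Rightarrow> 'a set set" where
  "quot A B = (\<lambda>x. (+) x ` B) ` A"

text \<open>The value for an infinite quotient is 0, so finiteness has to be carried along with each
  index.\<close>

definition idx :: "'a::ring_1 set \<Rightarrow> 'a set \<Rightarrow> nat" where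
  "idx A B = card (quot A B)"

lemma addsub_0: "addsub A \<Longrightarrow> 0 \<in> A"
  and addsub_diff: "addsub A \<Longrightarrow> x \<in> A \<Longrightarrow> y \<in> A \<Longrightarrow> x - y \<in> A"
  by (auto simp: addsub_def)

lemma addsub_uminus: "addsub A \<Longrightarrow> x \<in> A \<Longrightarrow> - x \<in> A"
  using addsub_diff[of A 0 x] addsub_0 by auto

lemma addsub_add: "addsub A \<Longrightarrow> x \<in> A \<Longrightarrow> y \<in> A \<Longrightarrow> x + y \<in> A"
  using addsub_diff[of A x "- y"] addsub_uminus by auto

lemma addsub_sum: "addsub A \<Longrightarrow> (\<And>i. i \<in> I \<Longrightarrow> f i \<in> A) \<Longrightarrow> sum f I \<in> A"
  by (induction I rule: infinite_finite_induct) (auto simp: addsub_0 addsub_add)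

lemma coset_eq_iff:
  assumes "addsub B"
  shows "(+) x ` B = (+) y ` B \<longleftrightarrow> x - y \<in> B"
proof
  assume "(+) x ` B = (+) y ` B"
  moreover have "x \<in> (+) x ` B" using addsub_0[OF assms] by force
  ultimately obtain b where "b \<in> B" "x = y + b" by auto
  then show "x - y \<in> B" by simp
next
  assume xy: "x - y \<in> B"
  have "(+) u ` B \<subseteq> (+) v ` B" if "u - v \<in> B" for u v
  proof
    fix z assume "z \<in> (+) u ` B"
    then obtain b where "b \<in> B" "z = v + ((u - v) + b)" by auto
    then show "z \<in> (+) v ` B" using addsub_add[OF assms that] by blast
  qed
  from this[OF xy] this[of y x] show "(+) x ` B = (+) y ` B"
    using addsub_uminus[OF assms xy] by auto
qed

lemma quot_finite_cover:
  assumes "addsub B" "finite S" "\<And>x. x \<in> A \<Longrightarrow> \<exists>s\<in>S. x - s \<in> B"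
  shows "finite (quot A B)" "idx A B \<le> card S"
proof -
  have sub: "quot A B \<subseteq> (\<lambda>x. (+) x ` B) ` S"
    using assms(3) coset_eq_iff[OF assms(1)] unfolding quot_def by blast
  show "finite (quot A B)" by (rule finite_subset[OF sub]) (use assms in simp)
  have "idx A B \<le> card ((\<lambda>x. (+) x ` B) ` S)" unfolding idx_def
    by (rule card_mono[OF _ sub]) (use assms in simp)
  also have "\<dots> \<le> card S" using assms by (intro card_image_le) simp
  finally show "idx A B \<le> card S" .
qed

lemma quot_finite_mono:
  assumes "addsub B" "addsub C" "C \<subseteq> B" "finite (quot A C)"
  shows "finite (quot A B)"
proof -
  obtain S where S: "finite S" "quot A C = (\<lambda>x. (+) x ` C) ` S" "S \<subseteq> A"
    using finite_subset_image[of "quot A C" "\<lambda>x. (+) x ` C" A] assms(4) by (auto simp: quot_def)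
  show ?thesis
  proof (rule quot_finite_cover(1)[OF assms(1) S(1)])
    fix x assume "x \<in> A"
    then have "(+) x ` C \<in> (\<lambda>x. (+) x ` C) ` S" using S(2) by (auto simp: quot_def)
    then obtain s where "s \<in> S" "(+) x ` C = (+) s ` C" by blast
    then show "\<exists>s\<in>S. x - s \<in> B" using coset_eq_iff[OF assms(2)] assms(3) by blast
  qed
qed

lemma quot_finite_subset: "A' \<subseteq> A \<Longrightarrow> finite (quot A B) \<Longrightarrow> finite (quot A' B)"
  unfolding quot_def by (rule finite_subset[OF image_mono])

lemma quot_reps:
  assumes "addsub B"
  obtains S where "S \<subseteq> A" "bij_betw (\<lambda>x. (+) x ` B) S (quot A B)"
    "\<And>x. x \<in> A \<Longrightarrow> \<exists>s\<in>S. x - s \<in> B"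
proof -
  obtain S where S: "S \<subseteq> A" "bij_betw (\<lambda>x. (+) x ` B) S (quot A B)"
    using subset_image_inj[of "quot A B" "\<lambda>x. (+) x ` B" A] by (auto simp: bij_betw_def quot_def)
  have "\<exists>s\<in>S. x - s \<in> B" if "x \<in> A" for x
  proof -
    have "(+) x ` B \<in> (\<lambda>x. (+) x ` B) ` S" using S(2) that by (auto simp: bij_betw_def quot_def)
    then show ?thesis using coset_eq_iff[OF assms] by blast
  qed
  then show ?thesis using that S by blast
qed

text \<open>Sums of representatives of the two steps represent \<open>A\<close> modulo
  \<open>C\<close>, each class once.\<close>

lemma quot_tower:
  assumes A: "addsub A" and B: "addsub B" and C: "addsub C" and sub: "C \<subseteq> B" "B \<subseteq> A"
    and fin: "finite (quot A B)" "finite (quot B C)"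
  shows "finite (quot A C)" "idx A C = idx A B * idx B C"
proof -
  obtain S where S: "S \<subseteq> A" "bij_betw (\<lambda>x. (+) x ` B) S (quot A B)"
    "\<And>x. x \<in> A \<Longrightarrow> \<exists>s\<in>S. x - s \<in> B" using quot_reps[OF B] by metis
  obtain T where T: "T \<subseteq> B" "bij_betw (\<lambda>x. (+) x ` C) T (quot B C)"
    "\<And>x. x \<in> B \<Longrightarrow> \<exists>t\<in>T. x - t \<in> C" using quot_reps[OF C] by metis
  define h where "h = (\<lambda>(s, t). (+) (s + t) ` C)"
  have "bij_betw h (S \<times> T) (quot A C)"
    unfolding bij_betw_def
  proof
    show "inj_on h (S \<times> T)"
    proof (rule inj_onI, clarify)
      fix s t s' t' assume st: "s \<in> S" "t \<in> T" "s' \<in> S" "t' \<in> T" and eq: "h (s, t) = h (s', t')"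
      have c: "(s + t) - (s' + t') \<in> C" using eq coset_eq_iff[OF C] by (simp add: h_def)
      have "s - s' = ((s + t) - (s' + t')) + (t' - t)" by simp
      also have "\<dots> \<in> B"
        using c sub(1) st T(1) by (intro addsub_add[OF B] addsub_diff[OF B, of t' t]) auto
      finally have "s = s'" using S(2) st coset_eq_iff[OF B] by (auto simp: bij_betw_def inj_on_def)
      then have "t - t' \<in> C" using c by simp
      then have "t = t'" using T(2) st coset_eq_iff[OF C] by (auto simp: bij_betw_def inj_on_def)
      then show "s = s' \<and> t = t'" using \<open>s = s'\<close> by simp
    qed
    show "h ` (S \<times> T) = quot A C"
    proof
      have "s + t \<in> A" if "s \<in> S" "t \<in> T" for s t
        using that S(1) T(1) sub A by (intro addsub_add) auto
      then show "h ` (S \<times> T) \<subseteq> quot A C" by (auto simp: h_def quot_def)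
      show "quot A C \<subseteq> h ` (S \<times> T)"
      proof
        fix X assume "X \<in> quot A C"
        then obtain x where x: "x \<in> A" "X = (+) x ` C" by (auto simp: quot_def)
        obtain s where s: "s \<in> S" "x - s \<in> B" using S(3)[OF x(1)] by blast
        obtain t where t: "t \<in> T" "(x - s) - t \<in> C" using T(3)[OF s(2)] by blast
        have "X = h (s, t)" unfolding h_def x(2) using t coset_eq_iff[OF C, of x "s + t"]
          by (simp add: algebra_simps)
        then show "X \<in> h ` (S \<times> T)" using s t by blast
      qed
    qed
  qed
  moreover have "finite S" "finite T" using S(2) T(2) fin bij_betw_finite by blast+
  moreover have "card S = idx A B" "card T = idx B C"
    using S(2) T(2) bij_betw_same_card unfolding idx_def by blast+
  ultimately show "finite (quot A C)" "idx A C = idx A B * idx B C"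
    using bij_betw_finite bij_betw_same_card[of h "S \<times> T" "quot A C"]
    by (auto simp: card_cartesian_product idx_def)
qed

lemma quot_scale:
  fixes c :: "'a::field"
  assumes "c \<noteq> 0"
  shows "finite (quot ((*) c ` A) ((*) c ` B)) \<longleftrightarrow> finite (quot A B)"
    and "idx ((*) c ` A) ((*) c ` B) = idx A B"
proof -
  have "quot ((*) c ` A) ((*) c ` B) = (`) ((*) c) ` quot A B"
    unfolding quot_def image_image by (simp add: distrib_left)
  moreover have "inj ((*) c)" using assms by (auto simp: inj_def)
  then have "inj_on ((`) ((*) c)) (quot A B)" by (meson inj_on_def inj_image_eq_iff)
  ultimately show "finite (quot ((*) c ` A) ((*) c ` B)) \<longleftrightarrow> finite (quot A B)"
    and "idx ((*) c ` A) ((*) c ` B) = idx A B"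
    by (auto simp: idx_def finite_image_iff card_image)
qed

lemma addsub_scale: "addsub A \<Longrightarrow> addsub ((*) (c :: 'a::comm_ring_1) ` A)"
  unfolding addsub_def by (auto simp flip: right_diff_distrib intro: image_eqI[of 0 _ 0])

section \<open>The norm of an algebraic integer\<close>

lemma addsub_integers: "addsub (integers :: 'k::number_field set)"
  by (auto simp: addsub_def algebraic_int_diff)

lemma addsub_Z_span: "addsub (Z.span B)"
  by (auto simp: addsub_def Z.span_zero Z.span_diff)

lemma algebraic_int_zscale: "algebraic_int x \<Longrightarrow> algebraic_int (zscale n (x :: 'a::field_char_0))"
  by (simp add: zscale_def algebraic_int_add_mult)

lemma Z_span_integers: "B \<subseteq> integers \<Longrightarrow> Z.span B \<subseteq> integers"
proof
  fix x assume B: "B \<subseteq> integers"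
  assume "x \<in> Z.span B"
  then show "x \<in> integers"
    using B by (induction rule: Z.span_induct_alt) (auto intro: algebraic_int_add_mult algebraic_int_zscale)
qed

text \<open>A rational basis made of integers. It need not generate the ring of integers as a group;
  the lattice it spans only has finite index there, by \<open>finite_quot_Z_span\<close>.\<close>

lemma integral_basis:
  obtains B :: "'k::number_field set" where "finite B" "B \<subseteq> integers" "Q.independent B"
    "Q.span B = UNIV" "card B = field_degree TYPE('k)"
proof -
  obtain B0 :: "'k set" where B0: "finite B0" "Q.span B0 = UNIV" "Q.independent B0"
    "card B0 = field_degree TYPE('k)" by (rule finite_Q_basis)
  obtain B :: "'k set" where B: "B \<subseteq> integers" "Q.independent B" "integers \<subseteq> Q.span B"
    using Q.maximal_independent_subset[of integers] by metis
  have "x \<in> Q.span B" for x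
  proof -
    obtain n :: int where n: "n > 0" "algebraic_int (of_int n * x)" by (rule integral_multiple)
    have "qscale (1 / of_int n) (of_int n * x) \<in> Q.span B"
      using B(3) n(2) by (intro Q.span_scale) auto
    then show ?thesis using n(1) by (simp add: qscale_def of_rat_divide)
  qed
  then have sp: "Q.span B = UNIV" by blast
  have fin: "finite B" using Q.independent_span_bound[OF B0(1) B(2)] B0(2) by auto
  have "card B \<le> card B0" "card B0 \<le> card B"
    using Q.independent_span_bound[OF B0(1) B(2)] Q.independent_span_bound[OF fin B0(3)] B0(2) sp by auto
  then show ?thesis using that[OF fin B(1,2) sp] B0(4) by simp
qed

lemma Q_coordinates:
  assumes "finite B" "Q.span B = UNIV"
  obtains c where "x = (\<Sum>b\<in>B. qscale (c b) b)"
proof -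
  have "x \<in> Q.span ((\<lambda>b. b) ` B)" using assms by simp
  then show ?thesis using that by (subst (asm) Q.span_image_finite[OF assms(1)]) blast
qed

text \<open>Subtracting the integer parts of the coordinates moves an integer into a bounded region,
  which contains finitely many integers.\<close>

lemma finite_quot_Z_span:
  fixes B :: "'k::number_field set"
  assumes B: "finite B" "B \<subseteq> integers" "Q.span B = UNIV"
  shows "finite (quot integers (Z.span B))"
proof (rule quot_finite_cover(1)[OF addsub_Z_span])
  define C where "C = (\<Sum>\<sigma>\<in>embeddings. \<Sum>b\<in>B. cmod (\<sigma> b))"
  show "finite {e \<in> (integers :: 'k set). \<forall>\<sigma>\<in>embeddings. cmod (\<sigma> e) \<le> C}"
    by (rule finite_bounded_integers)
  fix x :: 'k assume x: "x \<in> integers"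
  obtain c where c: "x = (\<Sum>b\<in>B. qscale (c b) b)" using Q_coordinates[OF B(1,3)] by metis
  define y where "y = (\<Sum>b\<in>B. zscale \<lfloor>c b\<rfloor> b)"
  have y: "y \<in> Z.span B" unfolding y_def by (intro Z.span_sum Z.span_scale Z.span_base)
  have "x - y = (\<Sum>b\<in>B. qscale (c b - of_int \<lfloor>c b\<rfloor>) b)"
    by (simp add: c y_def sum_subtractf[symmetric] qscale_def zscale_def of_rat_diff left_diff_distrib)
  moreover have "cmod (\<sigma> (\<Sum>b\<in>B. qscale (c b - of_int \<lfloor>c b\<rfloor>) b)) \<le> C" if s: "\<sigma> \<in> embeddings" for \<sigma>
  proof -
    have "\<sigma> (\<Sum>b\<in>B. qscale (c b - of_int \<lfloor>c b\<rfloor>) b) = (\<Sum>b\<in>B. of_rat (c b - of_int \<lfloor>c b\<rfloor>) * \<sigma> b)"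
      using s by (simp add: embedding_sum qscale_def embedding_mult embedding_of_rat)
    also have "cmod \<dots> \<le> (\<Sum>b\<in>B. cmod (of_rat (c b - of_int \<lfloor>c b\<rfloor>) * \<sigma> b))" by (rule norm_sum)
    also have "\<dots> \<le> (\<Sum>b\<in>B. cmod (\<sigma> b))"
    proof (rule sum_mono)
      fix b
      define q where "q = c b - of_int \<lfloor>c b\<rfloor>"
      have q: "0 \<le> q" "q \<le> 1" unfolding q_def by linarith+
      have "cmod (of_rat q) = real_of_rat \<bar>q\<bar>"
        by (cases q) (simp add: of_rat_rat norm_divide abs_of_rat[symmetric])
      also have "\<dots> \<le> 1" using q by simp
      finally have "cmod (of_rat q) \<le> 1" .
      then show "cmod (of_rat (c b - of_int \<lfloor>c b\<rfloor>) * \<sigma> b) \<le> cmod (\<sigma> b)"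
        unfolding q_def[symmetric] norm_mult by (rule mult_left_le_one_le[OF norm_ge_zero norm_ge_zero])
    qed
    also have "\<dots> \<le> C" unfolding C_def using s
      by (intro member_le_sum finite_embeddings) (auto intro: sum_nonneg)
    finally show ?thesis .
  qed
  moreover have "algebraic_int (x - y)" using x y Z_span_integers[OF B(2)] algebraic_int_diff by blast
  ultimately have "x - y \<in> {e \<in> integers. \<forall>\<sigma>\<in>embeddings. cmod (\<sigma> e) \<le> C}" by simp
  then show "\<exists>s\<in>{e \<in> integers. \<forall>\<sigma>\<in>embeddings. cmod (\<sigma> e) \<le> C}. x - s \<in> Z.span B"
    using y by (intro bexI[of _ "x - y"]) auto
qed

lemma Z_span_coordinates:
  assumes "finite B" "x \<in> Z.span B"
  obtains c where "x = (\<Sum>b\<in>B. zscale (c b) b)"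
proof -
  have "x \<in> Z.span ((\<lambda>b. b) ` B)" using assms by simp
  then show ?thesis using that by (subst (asm) Z.span_image_finite[OF assms(1)]) blast
qed

lemma quot_Z_span_multiple:
  fixes B :: "'k::number_field set"
  assumes B: "finite B" and m: "m > 0"
  shows "finite (quot (Z.span B) ((*) (of_int m) ` Z.span B))"
    and "idx (Z.span B) ((*) (of_int m) ` Z.span B) \<le> nat m ^ card B"
proof -
  define S where "S = (\<lambda>r. \<Sum>b\<in>B. zscale (r b) b) ` (PiE B (\<lambda>_. {0..<m}))"
  have fin: "finite S" unfolding S_def by (intro finite_imageI finite_PiE B) simp
  have cover: "\<exists>s\<in>S. x - s \<in> (*) (of_int m) ` Z.span B" if "x \<in> Z.span B" for x
  proof -
    obtain c where c: "x = (\<Sum>b\<in>B. zscale (c b) b)" using Z_span_coordinates[OF B \<open>x \<in> _\<close>] by metis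
    define s where "s = (\<Sum>b\<in>B. zscale (restrict (\<lambda>b. c b mod m) B b) b)"
    have "s \<in> S" unfolding s_def S_def using m by (intro imageI) auto
    moreover have "x - s = of_int m * (\<Sum>b\<in>B. zscale (c b div m) b)"
    proof -
      have "x - s = (\<Sum>b\<in>B. zscale (c b - c b mod m) b)"
        by (simp add: c s_def sum_subtractf[symmetric] Z.scale_left_diff_distrib)
      also have "\<dots> = of_int m * (\<Sum>b\<in>B. zscale (c b div m) b)"
        by (simp add: sum_distrib_left zscale_def minus_mod_eq_mult_div mult.assoc)
      finally show ?thesis .
    qed
    moreover have "(\<Sum>b\<in>B. zscale (c b div m) b) \<in> Z.span B"
      by (intro Z.span_sum Z.span_scale Z.span_base)
    ultimately show ?thesis by blast
  qed
  note q = quot_finite_cover[OF addsub_scale[OF addsub_Z_span] fin cover]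
  show "finite (quot (Z.span B) ((*) (of_int m) ` Z.span B))" by (rule q(1))
  have "idx (Z.span B) ((*) (of_int m) ` Z.span B) \<le> card S" by (rule q(2))
  also have "\<dots> \<le> card (PiE B (\<lambda>_. {0..<m}))" unfolding S_def
    by (intro card_image_le finite_PiE B) simp
  also have "\<dots> = nat m ^ card B" using B m by (simp add: card_PiE)
  finally show "idx (Z.span B) ((*) (of_int m) ` Z.span B) \<le> nat m ^ card B" .
qed

lemma idx_pos: "finite (quot A B) \<Longrightarrow> A \<noteq> {} \<Longrightarrow> idx A B > 0"
  by (auto simp: idx_def quot_def card_gt_0_iff)

section \<open>The two norms: index of a principal ideal and product of conjugates\<close>

definition norm_idx :: "'k::number_field \<Rightarrow> nat" where
  "norm_idx a = idx integers ((*) a ` integers)"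

definition norm_emb :: "'k::number_field \<Rightarrow> real" where
  "norm_emb a = (\<Prod>\<sigma>\<in>embeddings. cmod (\<sigma> a))"

lemma mult_integers_subset: "algebraic_int a \<Longrightarrow> (*) a ` integers \<subseteq> integers"
  by (auto intro: algebraic_int_add_mult)

text \<open>For a lattice \<open>L\<close> of finite index in the integers \<open>O\<close>, the
  index of \<open>m L\<close> in \<open>O\<close> is computed through \<open>m O\<close> and through
  \<open>L\<close>. The index of \<open>m L\<close> in \<open>m O\<close> equals that of
  \<open>L\<close> in \<open>O\<close> and cancels, so the index of \<open>m O\<close> in
  \<open>O\<close> is that of \<open>m L\<close> in \<open>L\<close>.\<close>

lemma quot_integers_of_int:
  assumes m: "m > 0"
  shows "finite (quot (integers :: 'k::number_field set) ((*) (of_int m) ` integers))"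
    and "norm_idx (of_int m :: 'k) \<le> nat m ^ field_degree TYPE('k)"
proof -
  obtain B :: "'k set" where B: "finite B" "B \<subseteq> integers" "Q.independent B"
    "Q.span B = UNIV" "card B = field_degree TYPE('k)" by (rule integral_basis)
  let ?L = "Z.span B" and ?m = "(*) (of_int m :: 'k)"
  have L: "?L \<subseteq> integers" by (rule Z_span_integers[OF B(2)])
  have mL: "?m ` ?L \<subseteq> ?L"
    using Z.span_scale[of _ B m] by (auto simp: zscale_def)
  have f1: "finite (quot integers ?L)" by (rule finite_quot_Z_span[OF B(1,2,4)])
  note f2 = quot_Z_span_multiple[OF B(1) m]
  note t1 = quot_tower[OF addsub_integers addsub_Z_span addsub_scale[OF addsub_Z_span] mL L f1 f2(1)]
  have sub: "?m ` ?L \<subseteq> ?m ` integers" "?m ` integers \<subseteq> integers"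
    using L mult_integers_subset[of "of_int m :: 'k"] by auto
  show fin: "finite (quot (integers :: 'k set) (?m ` integers))"
    by (rule quot_finite_mono[OF addsub_scale addsub_scale sub(1) t1(1)])
      (auto simp: addsub_integers addsub_Z_span)
  have m0: "(of_int m :: 'k) \<noteq> 0" using m by simp
  have "finite (quot (?m ` integers) (?m ` ?L))" using f1 quot_scale(1)[OF m0] by blast
  from quot_tower(2)[OF addsub_integers addsub_scale[OF addsub_integers] addsub_scale[OF addsub_Z_span] sub fin this]
  have "idx integers (?m ` ?L) = norm_idx (of_int m :: 'k) * idx integers ?L"
    by (simp add: norm_idx_def quot_scale(2)[OF m0])
  then have "norm_idx (of_int m :: 'k) * idx integers ?L = idx integers ?L * idx ?L (?m ` ?L)"
    using t1(2) by metis
  moreover have "idx integers ?L > 0" using f1 by (rule idx_pos) auto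
  ultimately show "norm_idx (of_int m :: 'k) \<le> nat m ^ field_degree TYPE('k)"
    using f2(2) B(5) by (auto simp: mult.commute)
qed

lemma integral_cofactor:
  fixes a :: "'k::number_field"
  assumes "algebraic_int a" "a \<noteq> 0"
  obtains a' m where "algebraic_int a'" "a' \<noteq> 0" "m > 0" "a * a' = of_int m"
proof -
  obtain m :: int where m: "m > 0" "algebraic_int (of_int m * inverse a)" by (rule integral_multiple)
  show ?thesis by (rule that[of "of_int m * inverse a" m]) (use m assms in auto)
qed

lemma finite_quot_integers:
  fixes a :: "'k::number_field"
  assumes "algebraic_int a" "a \<noteq> 0"
  shows "finite (quot integers ((*) a ` integers))"
proof -
  obtain a' m where a': "algebraic_int a'" "a' \<noteq> 0" "m > 0" "a * a' = of_int m"
    by (rule integral_cofactor[OF assms])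
  have "(*) (of_int m) ` integers = (*) a ` ((*) a' ` integers)"
    by (simp add: image_image a'(4)[symmetric] mult.assoc)
  then have "(*) (of_int m) ` integers \<subseteq> (*) a ` integers"
    using mult_integers_subset[OF a'(1)] by auto
  then show ?thesis
    using quot_finite_mono[OF addsub_scale[OF addsub_integers] addsub_scale[OF addsub_integers] _
        quot_integers_of_int(1)[OF a'(3)]] by blast
qed

text \<open>Between the integers and \<open>(a * b)\<close> lies \<open>(a)\<close>; multiplication
  by \<open>a\<close> identifies the lower step with the quotient by \<open>(b)\<close>.\<close>

lemma norm_idx_mult:
  fixes a b :: "'k::number_field"
  assumes a: "algebraic_int a" "a \<noteq> 0" and b: "algebraic_int b" "b \<noteq> 0"
  shows "norm_idx (a * b) = norm_idx a * norm_idx b"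
proof -
  have ab: "(*) (a * b) ` integers = (*) a ` ((*) b ` integers)" by (simp add: image_image mult.assoc)
  have sub: "(*) a ` ((*) b ` integers) \<subseteq> (*) a ` integers" "(*) a ` integers \<subseteq> integers"
    using mult_integers_subset a b by (auto simp del: image_subset_iff intro!: image_mono)
  have "finite (quot ((*) a ` integers) ((*) a ` ((*) b ` integers)))"
    using quot_scale(1)[OF a(2)] finite_quot_integers[OF b] by blast
  from quot_tower(2)[OF addsub_integers addsub_scale[OF addsub_integers]
      addsub_scale[OF addsub_scale[OF addsub_integers]] sub finite_quot_integers[OF a] this]
  show ?thesis by (simp add: norm_idx_def ab quot_scale(2)[OF a(2)])
qed

lemma norm_idx_pos: "algebraic_int a \<Longrightarrow> a \<noteq> 0 \<Longrightarrow> norm_idx a > 0"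
  unfolding norm_idx_def by (intro idx_pos finite_quot_integers) auto

lemma norm_emb_mult: "norm_emb (a * b) = norm_emb a * norm_emb b"
  by (simp add: norm_emb_def embedding_mult norm_mult prod.distrib)

lemma norm_emb_pos: "a \<noteq> 0 \<Longrightarrow> norm_emb a > 0"
  unfolding norm_emb_def by (intro prod_pos) (simp add: embedding_eq_0_iff)

lemma large_fibre:
  assumes "finite S" "finite (f ` S)" "S \<noteq> {}"
  shows "\<exists>x0\<in>S. card S \<le> card (f ` S) * card {x \<in> S. f x = f x0}"
proof (rule ccontr)
  assume "\<not> ?thesis"
  then have *: "card (f ` S) * card {x \<in> S. f x = f x0} < card S" if "x0 \<in> S" for x0
    using that by auto
  have "card S = (\<Sum>y\<in>f ` S. card {x \<in> S. f x = y})"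
    using sum.image_gen[OF assms(1), of "\<lambda>_. 1" f] by (simp only: card_eq_sum)
  then have "card (f ` S) * card S = (\<Sum>y\<in>f ` S. card (f ` S) * card {x \<in> S. f x = y})"
    by (simp add: sum_distrib_left)
  also have "\<dots> < (\<Sum>y\<in>f ` S. card S)"
    using * assms by (intro sum_strict_mono) auto
  finally show False by simp
qed

text \<open>Of the \<open>T\<^sup>d\<close> combinations of the basis with coefficients in \<open>{0..<T}\<close>, at least
  \<open>T\<^sup>d / norm_idx a\<close> agree modulo \<open>a\<close>; dividing their differences by \<open>a\<close> gives that many
  algebraic integers in a box of volume about \<open>T\<^sup>n / norm_emb a\<close>, with \<open>n\<close> the number of
  embeddings.\<close>

lemma norm_counting:
  obtains C :: real where "C > 0"
    "\<And>a :: 'k::number_field. algebraic_int a \<Longrightarrow> a \<noteq> 0 \<Longrightarrow>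
      \<exists>T0. \<forall>T\<ge>T0. real T ^ field_degree TYPE('k) * norm_emb a
        \<le> C * norm_idx a * real T ^ card (embeddings :: ('k \<Rightarrow> complex) set)"
proof -
  obtain B :: "'k set" where B: "finite B" "B \<subseteq> integers" "Q.independent B"
    "Q.span B = UNIV" "card B = field_degree TYPE('k)" by (rule integral_basis)
  \<comment> \<open>\<open>T * M\<close> bounds the conjugates of all differences of combinations
    with coefficients below \<open>T\<close>; the added 1 secures \<open>M \<ge> 1\<close>.\<close>
  define M where "M = 1 + (\<Sum>\<sigma>\<in>embeddings. \<Sum>b\<in>B. cmod (\<sigma> b))"
  have M: "M \<ge> 1" unfolding M_def by (simp add: sum_nonneg)
  have Ms: "(\<Sum>b\<in>B. cmod (\<sigma> b)) \<le> M" if "\<sigma> \<in> embeddings" for \<sigma>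
  proof -
    have "(\<Sum>b\<in>B. cmod (\<sigma> b)) \<le> (\<Sum>\<sigma>\<in>embeddings. \<Sum>b\<in>B. cmod (\<sigma> b))"
      using that by (intro member_le_sum finite_embeddings) (auto intro: sum_nonneg)
    then show ?thesis by (simp add: M_def)
  qed
  let ?n = "card (embeddings :: ('k \<Rightarrow> complex) set)"
  define C where "C = (6 * M) ^ ?n"
  have "\<exists>T0. \<forall>T\<ge>T0. real T ^ field_degree TYPE('k) * norm_emb a \<le> C * norm_idx a * real T ^ ?n"
    if a: "algebraic_int a" "a \<noteq> 0" for a :: 'k
  proof -
    \<comment> \<open>Beyond \<open>T0\<close> every conjugate of \<open>a\<close> is at most
      \<open>T\<close>, so each side \<open>T * M / cmod (\<sigma> a)\<close> of the box is at least
      1, as \<open>integers_in_box\<close> demands.\<close>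
    define T0 where "T0 = Suc (nat \<lceil>\<Sum>\<sigma>\<in>embeddings. cmod (\<sigma> a)\<rceil>)"
    have "real T ^ field_degree TYPE('k) * norm_emb a \<le> C * norm_idx a * real T ^ ?n"
      if T: "T \<ge> T0" for T
    proof -
      have T1: "T > 0" using T by (simp add: T0_def)
      have Ta: "cmod (\<sigma> a) \<le> real T" if "\<sigma> \<in> embeddings" for \<sigma>
      proof -
        have "cmod (\<sigma> a) \<le> (\<Sum>\<sigma>\<in>embeddings. cmod (\<sigma> a))"
          using that by (intro member_le_sum finite_embeddings) auto
        also have "\<dots> \<le> real T0" unfolding T0_def by linarith
        finally show ?thesis using T by simp
      qed
      define comb where "comb r = (\<Sum>b\<in>B. zscale (r b) b)" for r
      define S where "S = comb ` (PiE B (\<lambda>_. {0..<int T}))"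
      have inj: "inj_on comb (PiE B (\<lambda>_. {0..<int T}))"
      proof (rule inj_onI)
        fix r s assume r: "r \<in> PiE B (\<lambda>_. {0..<int T})" and s: "s \<in> PiE B (\<lambda>_. {0..<int T})"
          and eq: "comb r = comb s"
        have "(\<Sum>b\<in>B. qscale (of_int (r b - s b)) b) = comb r - comb s"
          by (simp add: comb_def sum_subtractf[symmetric] qscale_def zscale_def of_rat_diff left_diff_distrib)
        then have 0: "(\<Sum>b\<in>B. qscale (of_int (r b - s b)) b) = 0" using eq by simp
        have "r b = s b" if "b \<in> B" for b
          using Q.independentD[OF B(3) B(1) order_refl 0 that] by simp
        then show "r = s" using r s by (intro PiE_ext) auto
      qed
      have cS: "card S = T ^ field_degree TYPE('k)"
        unfolding S_def card_image[OF inj] using B by (simp add: card_PiE)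
      have finS: "finite S" unfolding S_def by (intro finite_imageI finite_PiE B) simp
      have "S \<noteq> {}" using cS T1 by (metis card.empty less_numeral_extra(3) zero_less_power)
      have SO: "S \<subseteq> integers"
      proof -
        have "comb r \<in> Z.span B" for r
          unfolding comb_def by (intro Z.span_sum Z.span_scale Z.span_base)
        then show ?thesis using Z_span_integers[OF B(2)] by (auto simp: S_def)
      qed
      have bound: "cmod (\<sigma> x - \<sigma> y) \<le> real T * M" if "x \<in> S" "y \<in> S" "\<sigma> \<in> embeddings" for x y \<sigma>
      proof -
        obtain r s where r: "x = comb r" "r \<in> PiE B (\<lambda>_. {0..<int T})"
          and s: "y = comb s" "s \<in> PiE B (\<lambda>_. {0..<int T})" using \<open>x \<in> S\<close> \<open>y \<in> S\<close> by (auto simp: S_def)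
        have "\<sigma> x - \<sigma> y = (\<Sum>b\<in>B. of_int (r b - s b) * \<sigma> b)"
          using that(3) by (simp add: r(1) s(1) comb_def embedding_sum zscale_def embedding_mult
              embedding_of_int sum_subtractf[symmetric] left_diff_distrib)
        also have "cmod \<dots> \<le> (\<Sum>b\<in>B. cmod (of_int (r b - s b) * \<sigma> b))" by (rule norm_sum)
        also have "\<dots> \<le> (\<Sum>b\<in>B. real T * cmod (\<sigma> b))"
        proof (rule sum_mono)
          fix b assume "b \<in> B"
          then have "r b \<in> {0..<int T}" "s b \<in> {0..<int T}" using r(2) s(2) by (auto simp: PiE_iff)
          then have "\<bar>r b - s b\<bar> \<le> int T" by auto
          then have "real_of_int \<bar>r b - s b\<bar> \<le> real_of_int (int T)" by (simp only: of_int_le_iff)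
          then have "cmod (of_int (r b - s b)) \<le> real T" by (simp only: norm_of_int of_int_abs of_int_of_nat_eq)
          then show "cmod (of_int (r b - s b) * \<sigma> b) \<le> real T * cmod (\<sigma> b)"
            unfolding norm_mult by (rule mult_right_mono) simp
        qed
        also have "\<dots> \<le> real T * M" using Ms[OF that(3)] by (simp flip: sum_distrib_left add: mult_left_mono)
        finally show ?thesis .
      qed
      define cl where "cl x = (+) x ` ((*) a ` integers)" for x
      have clsub: "cl ` S \<subseteq> quot integers ((*) a ` integers)"
        using SO by (auto simp: cl_def quot_def)
      then have finc: "finite (cl ` S)" using finite_quot_integers[OF a] finite_subset by blast
      obtain x0 where x0: "x0 \<in> S" "card S \<le> card (cl ` S) * card {x \<in> S. cl x = cl x0}"
        using large_fibre[OF finS finc \<open>S \<noteq> {}\<close>] by blast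
      define D where "D = {e \<in> integers. \<forall>\<sigma>\<in>embeddings. cmod (\<sigma> e) \<le> real T * M / cmod (\<sigma> a)}"
      have R1: "real T * M / cmod (\<sigma> a) \<ge> 1" if "\<sigma> \<in> embeddings" for \<sigma>
      proof -
        have "cmod (\<sigma> a) > 0" using a that by (simp add: embedding_eq_0_iff)
        moreover have "cmod (\<sigma> a) * 1 \<le> real T * M" using Ta[OF that] M T1 by (intro mult_mono) auto
        ultimately show ?thesis by simp
      qed
      have "(\<lambda>x. (x - x0) / a) ` {x \<in> S. cl x = cl x0} \<subseteq> D"
      proof (rule image_subsetI)
        fix x assume x: "x \<in> {x \<in> S. cl x = cl x0}"
        then have "x - x0 \<in> (*) a ` integers"
          using coset_eq_iff[OF addsub_scale[OF addsub_integers]] by (auto simp: cl_def)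
        then have "(x - x0) / a \<in> integers" using a by auto
        moreover have "cmod (\<sigma> ((x - x0) / a)) \<le> real T * M / cmod (\<sigma> a)" if "\<sigma> \<in> embeddings" for \<sigma>
          using bound[of x x0 \<sigma>] that x x0 by (simp add: embedding_divide embedding_diff norm_divide divide_right_mono)
        ultimately show "(x - x0) / a \<in> D" by (simp add: D_def)
      qed
      moreover have "inj_on (\<lambda>x. (x - x0) / a) {x \<in> S. cl x = cl x0}" using a by (auto simp: inj_on_def)
      moreover have finD: "finite D" and cD: "real (card D) \<le> (\<Prod>\<sigma>\<in>embeddings. 6 * (real T * M / cmod (\<sigma> a)))"
        unfolding D_def by (rule integers_in_box, erule R1)+
      ultimately have "card {x \<in> S. cl x = cl x0} \<le> card D" by (intro card_inj_on_le)
      moreover have "card (cl ` S) \<le> norm_idx a"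
        unfolding norm_idx_def idx_def by (intro card_mono clsub finite_quot_integers a)
      ultimately have "card S \<le> norm_idx a * card D" using x0(2) by (meson mult_le_mono order_trans)
      then have "real T ^ field_degree TYPE('k) \<le> real (norm_idx a) * real (card D)"
        unfolding cS by (metis of_nat_le_iff of_nat_mult of_nat_power)
      also have "\<dots> \<le> real (norm_idx a) * (\<Prod>\<sigma>\<in>embeddings. 6 * (real T * M / cmod (\<sigma> a)))"
        using cD by (intro mult_left_mono) auto
      also have "(\<Prod>\<sigma>\<in>embeddings. 6 * (real T * M / cmod (\<sigma> a))) = (\<Prod>\<sigma>\<in>embeddings. (6 * M * real T) / cmod (\<sigma> a))"
        by (intro prod.cong) (auto simp: mult_ac)
      also have "\<dots> = C * real T ^ ?n / norm_emb a"
        by (simp add: prod_dividef norm_emb_def C_def power_mult_distrib)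
      finally show ?thesis using norm_emb_pos[OF a(2)] by (simp add: field_simps)
    qed
    then show ?thesis by blast
  qed
  moreover have "C > 0" using M by (simp add: C_def)
  ultimately show ?thesis using that by blast
qed

text \<open>The count for \<open>a = 1\<close> bounds \<open>T ^ d\<close> by a constant times
  \<open>T ^ n\<close> for all large \<open>T\<close>, so \<open>d\<close> cannot exceed
  \<open>n\<close>.\<close>

lemma card_embeddings:
  "card (embeddings :: ('k::number_field \<Rightarrow> complex) set) = field_degree TYPE('k)"
proof (rule antisym)
  let ?n = "card (embeddings :: ('k \<Rightarrow> complex) set)" and ?d = "field_degree TYPE('k)"
  show "?n \<le> ?d" using embeddings_finite_le_degree by blast
  obtain C :: real where C: "C > 0"
    "\<And>a :: 'k. algebraic_int a \<Longrightarrow> a \<noteq> 0 \<Longrightarrow>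
      \<exists>T0. \<forall>T\<ge>T0. real T ^ ?d * norm_emb a \<le> C * norm_idx a * real T ^ ?n"
    using norm_counting by blast
  obtain T0 where T0: "\<And>T. T \<ge> T0 \<Longrightarrow> real T ^ ?d * norm_emb (1::'k) \<le> C * norm_idx (1::'k) * real T ^ ?n"
    using C(2)[of 1] by auto
  have e1: "norm_emb (1::'k) = 1" by (simp add: norm_emb_def embedding_1)
  define K where "K = C * norm_idx (1::'k)"
  show "?d \<le> ?n"
  proof (rule ccontr)
    assume "\<not> ?d \<le> ?n"
    then obtain j where j: "?d = ?n + Suc j" using less_imp_Suc_add by (metis not_le add_Suc_right)
    define T where "T = max T0 (Suc (nat \<lceil>K\<rceil>))"
    have TK: "real T > K" "T \<ge> 1" unfolding T_def by linarith+
    have "real T ^ ?n * (real T * real T ^ j) \<le> K * real T ^ ?n"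
    proof -
      have "real T ^ ?d * norm_emb (1::'k) \<le> K * real T ^ ?n"
        unfolding K_def by (rule T0) (simp add: T_def)
      then show ?thesis unfolding e1 j by (simp add: power_add mult_ac)
    qed
    then have "real T * real T ^ j \<le> K" using TK by (simp add: mult.commute[of K])
    moreover have "real T * 1 \<le> real T * real T ^ j" using TK by (intro mult_left_mono) auto
    ultimately show False using TK by simp
  qed
qed

theorem norm_idx_eq_norm_emb:
  fixes a :: "'k::number_field"
  assumes a: "algebraic_int a" "a \<noteq> 0"
  shows "real (norm_idx a) = norm_emb a"
proof -
  let ?d = "field_degree TYPE('k)"
  obtain C :: real where C: "C > 0"
    "\<And>a :: 'k. algebraic_int a \<Longrightarrow> a \<noteq> 0 \<Longrightarrow>
      \<exists>T0. \<forall>T\<ge>T0. real T ^ ?d * norm_emb a \<le> C * norm_idx a * real T ^ ?d"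
    using norm_counting[where 'k = 'k] unfolding card_embeddings by blast
  \<comment> \<open>Now that the two exponents are equal, the powers of \<open>T\<close>
    cancel.\<close>
  have leC: "norm_emb a \<le> C * norm_idx a" if "algebraic_int a" "a \<noteq> 0" for a :: 'k
  proof -
    obtain T0 where T0: "\<And>T. T \<ge> T0 \<Longrightarrow> real T ^ ?d * norm_emb a \<le> C * norm_idx a * real T ^ ?d"
      using C(2)[OF \<open>algebraic_int a\<close> \<open>a \<noteq> 0\<close>] by auto
    have "real (Suc T0) ^ ?d > 0" by simp
    moreover have "real (Suc T0) ^ ?d * norm_emb a \<le> real (Suc T0) ^ ?d * (C * norm_idx a)"
      using T0[of "Suc T0"] by (simp only: mult_ac le_SucI order_refl)
    ultimately show ?thesis using mult_le_cancel_left_pos by blast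
  qed
  \<comment> \<open>\<open>C\<close> does not depend on \<open>a\<close>. Applied to
    \<open>a ^ n\<close>, the bound says that the \<open>n\<close>-th power of the quotient of the
    two norms stays below \<open>C\<close>, so the quotient is at most 1.\<close>
  have le: "norm_emb a \<le> norm_idx a" if a: "algebraic_int a" "a \<noteq> 0" for a :: 'k
  proof (rule ccontr)
    assume gt: "\<not> ?thesis"
    define r where "r = norm_emb a / norm_idx a"
    have pos: "real (norm_idx a) > 0" using norm_idx_pos[OF a] by simp
    have r: "r > 1" using gt pos by (simp add: r_def)
    then obtain n where n: "C < r ^ n" using real_arch_pow by blast
    have one: "norm_idx (1 :: 'k) = 1"
      using norm_idx_mult[of "1::'k" 1] norm_idx_pos[of "1::'k"] by simp
    have an: "algebraic_int (a ^ n)" "norm_idx (a ^ n) = norm_idx a ^ n" "norm_emb (a ^ n) = norm_emb a ^ n"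
    proof -
      have "algebraic_int (a ^ n) \<and> norm_idx (a ^ n) = norm_idx a ^ n
          \<and> norm_emb (a ^ n) = norm_emb a ^ n"
      proof (induction n)
        case 0
        then show ?case by (simp add: norm_emb_def embedding_1 one)
      next
        case (Suc n)
        then show ?case using a by (simp add: algebraic_int_add_mult norm_idx_mult norm_emb_mult)
      qed
      then show "algebraic_int (a ^ n)" "norm_idx (a ^ n) = norm_idx a ^ n" "norm_emb (a ^ n) = norm_emb a ^ n"
        by auto
    qed
    have "norm_emb a ^ n \<le> C * norm_idx a ^ n" using leC[OF an(1)] a an by simp
    then have "r ^ n \<le> C" using pos by (simp add: r_def power_divide divide_le_eq)
    then show False using n by simp
  qed
  \<comment> \<open>For the rational integer \<open>m = a * a'\<close> the opposite inequality is
    known from the index bound \<open>m ^ d\<close>. As both norms are multiplicative and the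
    inequality for \<open>a'\<close> is already available, it passes to \<open>a\<close>.\<close>
  obtain a' m where a': "algebraic_int a'" "a' \<noteq> 0" "m > 0" "a * a' = of_int m"
    by (rule integral_cofactor[OF a])
  have "real (norm_idx a) * real (norm_idx a') = real (norm_idx (of_int m :: 'k))"
    using norm_idx_mult[OF a a'(1,2)] a'(4) by simp
  also have "\<dots> \<le> real (nat m ^ ?d)" using quot_integers_of_int(2)[OF a'(3), where 'k = 'k] by linarith
  also have "\<dots> = norm_emb (of_int m :: 'k)"
    using a'(3) by (simp add: norm_emb_def embedding_of_int card_embeddings)
  also have "\<dots> = norm_emb a * norm_emb a'" using a'(4) norm_emb_mult[of a a'] by simp
  also have "\<dots> \<le> norm_emb a * real (norm_idx a')"
    using le[OF a'(1,2)] norm_emb_pos[OF a(2)] by (intro mult_left_mono) auto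
  finally have "real (norm_idx a) \<le> norm_emb a"
    using norm_idx_pos[OF a'(1,2)] by simp
  then show ?thesis using le[OF a] by simp
qed

section \<open>Ideals of the ring of integers\<close>

lemma int_ring_simps [simp]:
  "carrier int_ring = integers" "x \<otimes>\<^bsub>int_ring\<^esub> y = x * y" "x \<oplus>\<^bsub>int_ring\<^esub> y = x + y"
  "\<one>\<^bsub>int_ring\<^esub> = 1" "\<zero>\<^bsub>int_ring\<^esub> = 0"
  by (auto simp: int_ring_def)

lemma cring_int_ring: "cring (int_ring :: 'k::number_field ring)"
proof (rule cringI)
  show "abelian_group (int_ring :: 'k ring)"
  proof (rule abelian_groupI)
    fix x :: 'k assume "x \<in> carrier int_ring"
    then show "\<exists>y\<in>carrier int_ring. y \<oplus>\<^bsub>int_ring\<^esub> x = \<zero>\<^bsub>int_ring\<^esub>"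
      by (intro bexI[of _ "- x"]) auto
  qed (auto simp: algebraic_int_add_mult algebra_simps)
  show "comm_monoid (int_ring :: 'k ring)"
    by (rule comm_monoidI) (auto simp: algebraic_int_add_mult algebra_simps)
qed (auto simp: algebra_simps)

text \<open>Submodules of the field rather than of the ring of integers, so that inverses of ideals
  are included; ideals are those contained in \<open>integers\<close>.\<close>

definition omod :: "'k::number_field set \<Rightarrow> bool" where
  "omod M \<longleftrightarrow> addsub M \<and> (\<forall>a\<in>integers. \<forall>x\<in>M. a * x \<in> M)"

text \<open>\<open>ideal_prod\<close> is generated by products and sums without reference to the
  carrier, so it also multiplies modules that leave the ring.\<close>

definition ip :: "'k::number_field set \<Rightarrow> 'k set \<Rightarrow> 'k set" where
  "ip M N = ideal_prod int_ring M N"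

lemma omod_addsub: "omod M \<Longrightarrow> addsub M"
  and omod_mult: "omod M \<Longrightarrow> algebraic_int a \<Longrightarrow> x \<in> M \<Longrightarrow> a * x \<in> M"
  by (auto simp: omod_def)

lemma omod_0: "omod M \<Longrightarrow> 0 \<in> M"
  and omod_add: "omod M \<Longrightarrow> x \<in> M \<Longrightarrow> y \<in> M \<Longrightarrow> x + y \<in> M"
  and omod_diff: "omod M \<Longrightarrow> x \<in> M \<Longrightarrow> y \<in> M \<Longrightarrow> x - y \<in> M"
  using omod_addsub[of M] addsub_0[of M] addsub_add[of M x y] addsub_diff[of M x y] by blast+

lemma omodI:
  assumes "0 \<in> M" "\<And>x y. x \<in> M \<Longrightarrow> y \<in> M \<Longrightarrow> x + y \<in> M"
    "\<And>a x. algebraic_int a \<Longrightarrow> x \<in> M \<Longrightarrow> a * x \<in> M"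
  shows "omod M"
proof -
  have "x - y \<in> M" if "x \<in> M" "y \<in> M" for x y
    using assms(2)[OF that(1) assms(3)[OF _ that(2), of "-1"]] by simp
  then show ?thesis using assms by (auto simp: omod_def addsub_def)
qed

lemma omod_integers: "omod integers"
  by (rule omodI) (auto intro: algebraic_int_add_mult)

lemma omod_scale:
  assumes "omod M"
  shows "omod ((*) c ` M)"
proof (rule omodI)
  show "0 \<in> (*) c ` M" using omod_0[OF assms] by force
  show "x + y \<in> (*) c ` M" if "x \<in> (*) c ` M" "y \<in> (*) c ` M" for x y
    using that omod_add[OF assms] by (auto simp flip: distrib_left)
  show "a * x \<in> (*) c ` M" if "algebraic_int a" "x \<in> (*) c ` M" for a x
    using that omod_mult[OF assms] by (auto simp: mult.left_commute[of a])
qed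

lemma omod_plus:
  fixes M N :: "'k::number_field set"
  assumes "omod M" "omod N"
  shows "omod {x + y |x y. x \<in> M \<and> y \<in> N}"
proof (rule omodI)
  show "0 \<in> {x + y |x y. x \<in> M \<and> y \<in> N}" using omod_0 assms by force
next
  fix u v assume "u \<in> {x + y |x y. x \<in> M \<and> y \<in> N}" "v \<in> {x + y |x y. x \<in> M \<and> y \<in> N}"
  then obtain x y x' y' where "u = x + y" "v = x' + y'" "x \<in> M" "y \<in> N" "x' \<in> M" "y' \<in> N" by blast
  then have "u + v = (x + x') + (y + y')" "x + x' \<in> M" "y + y' \<in> N"
    using omod_add assms by (auto simp: algebra_simps)
  then show "u + v \<in> {x + y |x y. x \<in> M \<and> y \<in> N}" by blast
next
  fix a u :: 'k assume a: "algebraic_int a" and "u \<in> {x + y |x y. x \<in> M \<and> y \<in> N}"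
  then obtain x y where "u = x + y" "x \<in> M" "y \<in> N" by blast
  then have "a * u = a * x + a * y" "a * x \<in> M" "a * y \<in> N"
    using omod_mult assms a by (auto simp: algebra_simps)
  then show "a * u \<in> {x + y |x y. x \<in> M \<and> y \<in> N}" by blast
qed

definition adjoin :: "'k::number_field set \<Rightarrow> 'k \<Rightarrow> 'k set" where
  "adjoin M a = {x + y |x y. x \<in> M \<and> y \<in> (*) a ` integers}"

lemma adjoinE:
  assumes "w \<in> adjoin M a"
  obtains x y where "w = x + a * y" "x \<in> M" "algebraic_int y"
  using assms by (auto simp: adjoin_def)

lemma adjoin:
  assumes M: "omod M"
  shows omod_adjoin: "omod (adjoin M a)" and subset_adjoin: "M \<subseteq> adjoin M a"
    and mem_adjoin: "a \<in> adjoin M a"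
    and adjoin_subset: "omod L \<Longrightarrow> M \<subseteq> L \<Longrightarrow> a \<in> L \<Longrightarrow> adjoin M a \<subseteq> L"
proof -
  show "omod (adjoin M a)" unfolding adjoin_def by (intro omod_plus M omod_scale omod_integers)
  have "0 \<in> (*) a ` integers" by (rule omod_0[OF omod_scale[OF omod_integers]])
  then have "x + 0 \<in> adjoin M a" if "x \<in> M" for x unfolding adjoin_def using that by blast
  then show "M \<subseteq> adjoin M a" by auto
  have "a * 1 \<in> (*) a ` integers" by (intro imageI) simp
  then have "0 + a * 1 \<in> adjoin M a" unfolding adjoin_def using omod_0[OF M] by blast
  then show "a \<in> adjoin M a" by simp
  show "adjoin M a \<subseteq> L" if L: "omod L" "M \<subseteq> L" "a \<in> L"
  proof
    fix w assume "w \<in> adjoin M a"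
    then obtain x y where w: "w = x + a * y" "x \<in> M" "algebraic_int y" by (rule adjoinE)
    have "x + y * a \<in> L" using w L by (intro omod_add[OF L(1)] omod_mult[OF L(1)]) auto
    then show "w \<in> L" by (simp add: w mult.commute)
  qed
qed

lemma ip_mult: "x \<in> M \<Longrightarrow> y \<in> N \<Longrightarrow> x * y \<in> ip M N"
  using ideal_prod.prod[of x M y N int_ring] by (simp add: ip_def)

lemma ip_add: "x \<in> ip M N \<Longrightarrow> y \<in> ip M N \<Longrightarrow> x + y \<in> ip M N"
  using ideal_prod.sum[of x int_ring M N y] by (simp add: ip_def)

lemma ip_induct [consumes 1, case_names mult add]:
  assumes "z \<in> ip M N" "\<And>x y. x \<in> M \<Longrightarrow> y \<in> N \<Longrightarrow> P (x * y)" "\<And>x y. P x \<Longrightarrow> P y \<Longrightarrow> P (x + y)"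
  shows "P z"
  using assms(1) unfolding ip_def by (induction rule: ideal_prod.induct) (auto intro: assms(2,3))

lemma ip_le_iff:
  assumes "addsub L"
  shows "ip M N \<subseteq> L \<longleftrightarrow> (\<forall>x\<in>M. \<forall>y\<in>N. x * y \<in> L)"
proof
  assume *: "\<forall>x\<in>M. \<forall>y\<in>N. x * y \<in> L"
  show "ip M N \<subseteq> L"
  proof
    fix z assume "z \<in> ip M N"
    then show "z \<in> L" by (induction rule: ip_induct) (use * addsub_add[OF assms] in auto)
  qed
qed (use ip_mult in blast)

lemma ip_mono: "M \<subseteq> M' \<Longrightarrow> N \<subseteq> N' \<Longrightarrow> ip M N \<subseteq> ip M' N'"
proof
  fix z assume sub: "M \<subseteq> M'" "N \<subseteq> N'" and "z \<in> ip M N"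
  from this(3) show "z \<in> ip M' N'"
    by (induction rule: ip_induct) (use sub ip_mult ip_add in blast)+
qed

lemma omod_ip:
  assumes "omod M" "omod N"
  shows "omod (ip M N)"
proof (rule omodI)
  show "0 \<in> ip M N" using ip_mult[OF omod_0[OF assms(1)] omod_0[OF assms(2)]] by simp
  show "a * x \<in> ip M N" if "algebraic_int a" "x \<in> ip M N" for a x
    using that(2)
  proof (induction rule: ip_induct)
    case (mult x y)
    then show ?case using ip_mult[of "a * x" M y N] omod_mult[OF assms(1) that(1)] by (simp add: mult.assoc)
  next
    case (add x y)
    then show ?case by (simp add: distrib_left ip_add)
  qed
qed (rule ip_add)

lemma ip_commute: "ip M N = ip N M"
proof -
  have "ip M N \<subseteq> ip N M" for M N :: "'a set"
  proof
    fix z assume "z \<in> ip M N"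
    then show "z \<in> ip N M"
    proof (induction rule: ip_induct)
      case (mult x y)
      then show ?case using ip_mult[of y N x M] by (simp add: mult.commute)
    qed (rule ip_add)
  qed
  then show ?thesis by blast
qed

lemma ip_assoc:
  assumes "omod M" "omod N" "omod L"
  shows "ip (ip M N) L = ip M (ip N L)"
proof -
  have *: "ip (ip M N) L \<subseteq> ip M (ip N L)" if "omod M" "omod N" "omod L" for M N L :: "'a set"
  proof -
    have a: "addsub (ip M (ip N L))" using that by (intro omod_addsub omod_ip)
    have "x * y \<in> ip M (ip N L)" if "x \<in> ip M N" "y \<in> L" for x y
      using that
    proof (induction rule: ip_induct)
      case (mult u v)
      then show ?case using ip_mult[of u M "v * y" "ip N L"] ip_mult[of v N y L] by (simp add: mult.assoc)
    next
      case (add u v)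
      then show ?case by (simp add: distrib_right ip_add)
    qed
    then show ?thesis using ip_le_iff[OF a] by blast
  qed
  from *[OF assms] *[OF assms(3,2,1)] show ?thesis
    by (metis ip_commute subset_antisym)
qed

lemma ip_principal:
  assumes "omod M"
  shows "ip ((*) c ` integers) M = (*) c ` M"
proof
  show "ip ((*) c ` integers) M \<subseteq> (*) c ` M"
    by (subst ip_le_iff)
      (auto simp: omod_addsub omod_scale assms mult.assoc intro!: imageI omod_mult[OF assms])
  show "(*) c ` M \<subseteq> ip ((*) c ` integers) M"
  proof clarify
    fix x assume "x \<in> M"
    moreover have "c \<in> (*) c ` integers" by (rule image_eqI[of _ _ 1]) auto
    ultimately show "c * x \<in> ip ((*) c ` integers) M" by (intro ip_mult)
  qed
qed

lemma ip_integers: "omod M \<Longrightarrow> ip integers M = M"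
  using ip_principal[of M 1] by simp

lemma ip_subset_left:
  assumes "omod M" "N \<subseteq> integers"
  shows "ip M N \<subseteq> M"
proof -
  have "ip M N \<subseteq> ip M integers" by (rule ip_mono[OF order_refl assms(2)])
  then show ?thesis using ip_integers[OF assms(1)] ip_commute[of M integers] by simp
qed

section \<open>Finite places as maximal ideals of finite index\<close>

lemma fin_placeD:
  assumes "\<pp> \<in> fin_places"
  shows "omod \<pp>" "\<pp> \<subseteq> integers" "\<pp> \<noteq> integers" "1 \<notin> \<pp>" "\<exists>c\<in>\<pp>. c \<noteq> 0"
    "algebraic_int a \<Longrightarrow> algebraic_int b \<Longrightarrow> a * b \<in> \<pp> \<Longrightarrow> a \<in> \<pp> \<or> b \<in> \<pp>"
proof -
  interpret primeideal \<pp> int_ring using assms by (simp add: fin_places_def)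
  show o: "omod \<pp>"
    using additive_subgroup.zero_closed[OF is_additive_subgroup]
      additive_subgroup.a_closed[OF is_additive_subgroup] I_l_closed by (intro omodI) auto
  show s: "\<pp> \<subseteq> integers" using a_subset by simp
  show ne: "\<pp> \<noteq> integers" using I_notcarr by auto
  show "1 \<notin> \<pp>"
  proof
    assume "1 \<in> \<pp>"
    then have "integers \<subseteq> \<pp>" using omod_mult[OF o, of _ 1] by auto
    then show False using s ne by blast
  qed
  show "\<exists>c\<in>\<pp>. c \<noteq> 0" using assms omod_0[OF o] by (auto simp: fin_places_def)
  show "algebraic_int a \<Longrightarrow> algebraic_int b \<Longrightarrow> a * b \<in> \<pp> \<Longrightarrow> a \<in> \<pp> \<or> b \<in> \<pp>"
    using I_prime[of a b] by simp
qed

lemma fin_placeI: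
  assumes "omod \<pp>" "\<pp> \<subseteq> integers" "\<pp> \<noteq> integers" "c \<in> \<pp>" "c \<noteq> 0"
    "\<And>a b. algebraic_int a \<Longrightarrow> algebraic_int b \<Longrightarrow> a * b \<in> \<pp> \<Longrightarrow> a \<in> \<pp> \<or> b \<in> \<pp>"
  shows "\<pp> \<in> fin_places"
proof -
  have "additive_subgroup \<pp> (int_ring :: 'a ring)"
  proof (rule additive_subgroupI)
    interpret cring "int_ring :: 'a ring" by (rule cring_int_ring)
    have "inv\<^bsub>add_monoid int_ring\<^esub> x \<in> \<pp>" if "x \<in> \<pp>" for x
    proof -
      have x: "x \<in> integers" using that assms by blast
      have "\<ominus>\<^bsub>int_ring\<^esub> x = - x"
        by (rule minus_equality) (use x in auto)
      then show ?thesis using omod_mult[OF assms(1) _ that, of "-1"] by (simp add: a_inv_def)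
    qed
    then show "subgroup \<pp> (add_monoid int_ring)"
      using assms(2) omod_0[OF assms(1)] omod_add[OF assms(1)] by (intro subgroup.intro) auto
  qed
  then have "primeideal \<pp> (int_ring :: 'a ring)"
  proof (rule primeidealI2[OF _ cring_int_ring])
    show "carrier int_ring \<noteq> \<pp>" using assms(3) by simp
  next
    fix a x :: 'a assume "a \<in> \<pp>" "x \<in> carrier int_ring"
    then have "x * a \<in> \<pp>" using omod_mult[OF assms(1)] by simp
    then show "x \<otimes>\<^bsub>int_ring\<^esub> a \<in> \<pp>" "a \<otimes>\<^bsub>int_ring\<^esub> x \<in> \<pp>" by (simp_all add: mult.commute)
  qed (use assms(6) in auto)
  then show ?thesis using assms(4,5) by (auto simp: fin_places_def)
qed

lemma finite_quot_ideal:
  assumes "omod I" "c \<in> I" "c \<noteq> 0" "I \<subseteq> integers"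
  shows "finite (quot integers I)"
proof -
  have "(*) c ` integers \<subseteq> I" using omod_mult[OF assms(1) _ assms(2)] by (auto simp: mult.commute)
  then show ?thesis
    using quot_finite_mono[OF omod_addsub[OF assms(1)] addsub_scale[OF addsub_integers] _
        finite_quot_integers[of c]] assms by auto
qed

text \<open>The finite index serves as a measure for induction and minimal choice, in the role of
  the ascending chain condition.\<close>

lemma idx_strict:
  assumes "omod I" "omod J" "I \<subset> J" "J \<subseteq> integers" "finite (quot integers I)"
  shows "idx integers J < idx integers I"
proof -
  note a = omod_addsub[OF assms(1)] omod_addsub[OF assms(2)]
  have fJ: "finite (quot integers J)" using quot_finite_mono[OF a(2,1)] assms by blast
  have fIJ: "finite (quot J I)" using quot_finite_subset assms(4,5) by blast
  have eq: "idx integers I = idx integers J * idx J I"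
    using quot_tower(2)[OF addsub_integers a(2,1) _ assms(4) fJ fIJ] assms(3) by blast
  obtain x where x: "x \<in> J" "x \<notin> I" using assms(3) by blast
  have "(+) x ` I \<noteq> (+) 0 ` I" using coset_eq_iff[OF a(1), of x 0] x by simp
  moreover have "{(+) x ` I, (+) 0 ` I} \<subseteq> quot J I"
    unfolding quot_def using x omod_0[OF assms(2)] by blast
  then have "card {(+) x ` I, (+) 0 ` I} \<le> idx J I" unfolding idx_def by (rule card_mono[OF fIJ])
  ultimately have "idx J I \<ge> 2" by simp
  moreover have "idx integers J > 0" using fJ by (rule idx_pos) auto
  ultimately have "idx integers J * 1 < idx integers J * idx J I"
    by (intro mult_strict_left_mono) auto
  then show ?thesis by (simp only: eq mult_1_right)
qed

text \<open>A finite integral domain is a field: modulo \<open>\<pp>\<close> the powers of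
  \<open>a\<close> repeat, and cancelling the nonzero factor \<open>a ^ m\<close> leaves
  \<open>a ^ (n - m)\<close> congruent to 1. So an ideal that contains \<open>a\<close> and
  \<open>\<pp>\<close> contains 1.\<close>

lemma fin_place_maximal:
  assumes p: "\<pp> \<in> fin_places" and J: "omod J" "\<pp> \<subset> J" "J \<subseteq> integers"
  shows "J = integers"
proof -
  note pD = fin_placeD[OF p]
  obtain c where "c \<in> \<pp>" "c \<noteq> 0" using pD(5) by blast
  then have fin: "finite (quot integers \<pp>)" using finite_quot_ideal[OF pD(1)] pD(2) by blast
  obtain a where a: "a \<in> J" "a \<notin> \<pp>" using J(2) by blast
  have aO: "algebraic_int a" using a J by blast
  have an: "algebraic_int (a ^ n)" for n by (induction n) (auto intro: algebraic_int_add_mult aO)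
  have nin: "a ^ n \<notin> \<pp>" for n
    by (induction n) (use pD(4) pD(6)[OF aO an] a in auto)
  have "range (\<lambda>n. (+) (a ^ n) ` \<pp>) \<subseteq> quot integers \<pp>" using an by (auto simp: quot_def)
  then have "\<not> inj (\<lambda>n. (+) (a ^ n) ` \<pp>)"
    using fin finite_imageD finite_subset infinite_UNIV_nat by blast
  then obtain m n where mn: "m < n" "(+) (a ^ n) ` \<pp> = (+) (a ^ m) ` \<pp>"
    unfolding inj_def by (metis nat_neq_iff)
  have "a ^ n = a ^ m * a ^ (n - m)" using mn(1) by (simp flip: power_add)
  moreover have "a ^ n - a ^ m \<in> \<pp>"
    using mn(2) coset_eq_iff[OF omod_addsub[OF pD(1)]] by blast
  ultimately have "a ^ m * (a ^ (n - m) - 1) \<in> \<pp>" by (simp add: right_diff_distrib)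
  then have 1: "a ^ (n - m) - 1 \<in> \<pp>"
    using pD(6)[OF an[of m], of "a ^ (n - m) - 1"] nin an by (auto intro: algebraic_int_diff)
  have "a ^ (n - m) = a ^ (n - m - 1) * a" using mn(1) by (metis Suc_diff_1 power_Suc2 zero_less_diff)
  then have 2: "a ^ (n - m) \<in> J" using omod_mult[OF J(1) an a(1)] by simp
  have "a ^ (n - m) - 1 \<in> J" using 1 J(2) by blast
  then have "a ^ (n - m) - (a ^ (n - m) - 1) \<in> J" by (rule omod_diff[OF J(1) 2])
  then have "1 \<in> J" by simp
  then have "integers \<subseteq> J" using omod_mult[OF J(1), of _ 1] by auto
  then show ?thesis using J by blast
qed

text \<open>A proper ideal \<open>J\<close> above \<open>I\<close> of least index is maximal. If
  \<open>a\<close> is not in \<open>J\<close>, then \<open>1 = x + a * y\<close> with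
  \<open>x\<close> in \<open>J\<close>, so \<open>b = b * x + y * (a * b)\<close> lies in
  \<open>J\<close> whenever \<open>a * b\<close> does.\<close>

lemma fin_place_above:
  assumes I: "omod I" "I \<subseteq> integers" "I \<noteq> integers" "c \<in> I" "c \<noteq> 0"
  obtains \<pp> where "\<pp> \<in> fin_places" "I \<subseteq> \<pp>"
proof -
  define Q where "Q J \<longleftrightarrow> omod J \<and> J \<subseteq> integers \<and> J \<noteq> integers \<and> I \<subseteq> J" for J
  have "Q I" using I by (simp add: Q_def)
  then obtain J where J: "Q J" and min: "\<And>J'. Q J' \<Longrightarrow> idx integers J \<le> idx integers J'"
    using ex_has_least_nat[of Q I "idx integers"] by blast
  note J' = J[unfolded Q_def]
  have cJ: "c \<in> J" using J' I by blast
  have fin: "finite (quot integers J)" using finite_quot_ideal[of J c] J' cJ I by blast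
  have max: "J' = integers" if "omod J'" "J \<subset> J'" "J' \<subseteq> integers" for J'
  proof (rule ccontr)
    assume "J' \<noteq> integers"
    then have "Q J'" using that J' by (auto simp: Q_def)
    then show False using min idx_strict[OF _ that(1,2,3) fin] J' by fastforce
  qed
  have "J \<in> fin_places"
  proof (rule fin_placeI[of J c])
    fix a b assume a: "algebraic_int a" and b: "algebraic_int b" and ab: "a * b \<in> J"
    show "a \<in> J \<or> b \<in> J"
    proof (cases "a \<in> J")
      case na: False
      have "adjoin J a \<subseteq> integers"
        using J' a by (intro adjoin_subset omod_integers) auto
      then have "adjoin J a = integers"
        using max[OF omod_adjoin] subset_adjoin[of J a] mem_adjoin[of J a] J' na by blast
      then have "1 \<in> adjoin J a" by simp
      then obtain x y where xy: "1 = x + a * y" "x \<in> J" "algebraic_int y" by (rule adjoinE)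
      have "b = b * x + y * (a * b)"
        using arg_cong[OF xy(1), of "(*) b"] by (simp add: algebra_simps)
      also have "\<dots> \<in> J" using J'
        by (intro omod_add omod_mult[OF _ b xy(2)] omod_mult[OF _ xy(3) ab]) auto
      finally show ?thesis by simp
    qed simp
  qed (use J' cJ I in auto)
  then show ?thesis using that J' by blast
qed

section \<open>Products of primes and unique factorization\<close>

definition iprod :: "'k::number_field set list \<Rightarrow> 'k set" where
  "iprod \<pp>s = foldr ip \<pp>s integers"

lemma iprod_simps [simp]: "iprod [] = integers" "iprod (\<pp> # \<pp>s) = ip \<pp> (iprod \<pp>s)"
  by (auto simp: iprod_def)

lemma omod_iprod: "set \<pp>s \<subseteq> fin_places \<Longrightarrow> omod (iprod \<pp>s)"
  by (induction \<pp>s) (auto intro: omod_integers omod_ip fin_placeD)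

lemma iprod_integers: "set \<pp>s \<subseteq> fin_places \<Longrightarrow> iprod \<pp>s \<subseteq> integers"
proof (induction \<pp>s)
  case (Cons \<pp> \<pp>s)
  then have "ip \<pp> (iprod \<pp>s) \<subseteq> \<pp>" by (intro ip_subset_left fin_placeD(1)) auto
  then show ?case using fin_placeD(2)[of \<pp>] Cons by auto
qed simp

lemma iprod_append:
  "set \<pp>s \<subseteq> fin_places \<Longrightarrow> set \<qq>s \<subseteq> fin_places \<Longrightarrow> iprod (\<pp>s @ \<qq>s) = ip (iprod \<pp>s) (iprod \<qq>s)"
  by (induction \<pp>s) (auto simp: ip_integers omod_iprod ip_assoc fin_placeD)

lemma iprod_remove1:
  "\<pp> \<in> set \<pp>s \<Longrightarrow> set \<pp>s \<subseteq> fin_places \<Longrightarrow> iprod \<pp>s = ip \<pp> (iprod (remove1 \<pp> \<pp>s))"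
proof (induction \<pp>s)
  case (Cons \<qq> \<qq>s)
  show ?case
  proof (cases "\<pp> = \<qq>")
    case False
    then have "iprod \<qq>s = ip \<pp> (iprod (remove1 \<pp> \<qq>s))" using Cons by auto
    moreover have "omod \<pp>" "omod \<qq>" "omod (iprod (remove1 \<pp> \<qq>s))"
      using Cons by (auto intro!: fin_placeD omod_iprod dest: notin_set_remove1 set_mp[OF set_remove1_subset])
    ultimately show ?thesis using False
      by simp (metis ip_assoc ip_commute)
  qed simp
qed simp

text \<open>A prime above a product is above some factor, and maximality turns the inclusion into
  equality.\<close>

lemma prime_contains_iprod:
  assumes p: "\<pp> \<in> fin_places" and "set \<pp>s \<subseteq> fin_places" "iprod \<pp>s \<subseteq> \<pp>"
  shows "\<pp> \<in> set \<pp>s"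
  using assms(2,3)
proof (induction \<pp>s)
  case Nil
  then show ?case using fin_placeD(2,3)[OF p] by auto
next
  case (Cons \<qq> \<qq>s)
  have q: "\<qq> \<in> fin_places" using Cons by simp
  show ?case
  proof (cases "\<qq> \<subseteq> \<pp>")
    case True
    then have "\<qq> = \<pp>"
      using fin_place_maximal[OF q fin_placeD(1)[OF p]] fin_placeD(2,3)[OF p] by blast
    then show ?thesis by simp
  next
    case False
    then obtain a where a: "a \<in> \<qq>" "a \<notin> \<pp>" by blast
    have "iprod \<qq>s \<subseteq> \<pp>"
    proof
      fix b assume b: "b \<in> iprod \<qq>s"
      then have "a * b \<in> \<pp>" using ip_mult[OF a(1) b] Cons.prems by auto
      moreover have "algebraic_int a" using a fin_placeD(2)[OF q] by blast
      moreover have "algebraic_int b" using b iprod_integers[of \<qq>s] Cons.prems by auto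
      ultimately show "b \<in> \<pp>" using fin_placeD(6)[OF p] a by blast
    qed
    then show ?thesis using Cons by auto
  qed
qed

text \<open>If \<open>I\<close> is proper and not prime, some \<open>a * b\<close> lies in
  \<open>I\<close> while neither factor does. The ideals got by adjoining \<open>a\<close> or
  \<open>b\<close> have smaller index, and their product lies in \<open>I\<close>, so the two lists
  of primes can be concatenated.\<close>

lemma ideal_contains_iprod:
  assumes "omod I" "I \<subseteq> integers" "c \<in> I" "c \<noteq> 0"
  shows "\<exists>\<pp>s. set \<pp>s \<subseteq> fin_places \<and> iprod \<pp>s \<subseteq> I"
  using assms
proof (induction "idx integers I" arbitrary: I rule: less_induct)
  case less
  have fin: "finite (quot integers I)" using finite_quot_ideal less.prems by blast
  consider "I = integers" | "I \<in> fin_places" | "I \<noteq> integers" "I \<notin> fin_places" by blast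
  then show ?case
  proof cases
    case 1
    then show ?thesis by (intro exI[of _ "[]"]) auto
  next
    case 2
    then show ?thesis using ip_integers[OF less.prems(1)]
      by (intro exI[of _ "[I]"]) (auto simp: ip_commute)
  next
    case 3
    then obtain a b where ab: "algebraic_int a" "algebraic_int b" "a * b \<in> I" "a \<notin> I" "b \<notin> I"
      using fin_placeI[OF less.prems(1,2) 3(1) less.prems(3,4)] by blast
    define J where "J d = adjoin I d" for d
    have J: "omod (J d)" "I \<subset> J d" "J d \<subseteq> integers" if d: "algebraic_int d" "d \<notin> I" for d
    proof -
      show "omod (J d)" unfolding J_def by (rule omod_adjoin[OF less.prems(1)])
      show "I \<subset> J d" unfolding J_def
        using subset_adjoin[OF less.prems(1)] mem_adjoin[OF less.prems(1)] d(2) by blast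
      show "J d \<subseteq> integers" unfolding J_def
        using d(1) by (intro adjoin_subset less.prems omod_integers) auto
    qed
    have "\<exists>\<pp>s. set \<pp>s \<subseteq> fin_places \<and> iprod \<pp>s \<subseteq> J d" if d: "algebraic_int d" "d \<notin> I" for d
      using J[OF d] less.prems idx_strict[OF less.prems(1) J[OF d] fin]
      by (intro less.hyps[of "J d"]) auto
    then obtain \<pp>s \<qq>s where p: "set \<pp>s \<subseteq> fin_places" "iprod \<pp>s \<subseteq> J a"
      and q: "set \<qq>s \<subseteq> fin_places" "iprod \<qq>s \<subseteq> J b" using ab by meson
    have "ip (J a) (J b) \<subseteq> I"
    proof (subst ip_le_iff[OF omod_addsub[OF less.prems(1)]], intro ballI)
      fix u v assume "u \<in> J a" "v \<in> J b"
      then obtain x y x' y' where x: "u = x + a * y" "v = x' + b * y'" "x \<in> I" "x' \<in> I"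
        "algebraic_int y" "algebraic_int y'" unfolding J_def by (meson adjoinE)
      have "algebraic_int x" using x less.prems by blast
      then have "x * x' + (b * y') * x + (a * y) * x' + (y * y') * (a * b) \<in> I"
        using omod_mult[OF less.prems(1) _ x(4), of x] omod_mult[OF less.prems(1) _ x(3), of "b * y'"]
          omod_mult[OF less.prems(1) _ x(4), of "a * y"] omod_mult[OF less.prems(1) _ ab(3), of "y * y'"]
          x(5,6) ab(1,2) algebraic_int_add_mult(2)
        by (intro omod_add[OF less.prems(1)]) blast+
      then show "u * v \<in> I" by (simp add: x algebra_simps)
    qed
    then have "iprod (\<pp>s @ \<qq>s) \<subseteq> I"
      using ip_mono[OF p(2) q(2)] iprod_append[OF p(1) q(1)] by blast
    then show ?thesis using p q by (intro exI[of _ "\<pp>s @ \<qq>s"]) auto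
  qed
qed

lemma integers_finitely_generated:
  obtains W :: "'k::number_field set" where "finite W" "integers \<subseteq> Z.span W"
proof -
  obtain B :: "'k set" where B: "finite B" "B \<subseteq> integers" "Q.independent B"
    "Q.span B = UNIV" "card B = field_degree TYPE('k)" by (rule integral_basis)
  obtain S where S: "S \<subseteq> integers" "bij_betw (\<lambda>x. (+) x ` Z.span B) S (quot integers (Z.span B))"
    "\<And>x. x \<in> integers \<Longrightarrow> \<exists>s\<in>S. x - s \<in> Z.span B" using quot_reps[OF addsub_Z_span] by metis
  have "finite S" using S(2) finite_quot_Z_span[OF B(1,2,4)] bij_betw_finite by blast
  moreover have "integers \<subseteq> Z.span (B \<union> S)"
  proof
    fix x :: 'k assume "x \<in> integers"
    then obtain s where s: "s \<in> S" "x - s \<in> Z.span B" using S(3) by blast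
    then have "x - s \<in> Z.span (B \<union> S)" "s \<in> Z.span (B \<union> S)"
      using Z.span_mono[of B "B \<union> S"] Z.span_base[of s "B \<union> S"] by auto
    then have "(x - s) + s \<in> Z.span (B \<union> S)" by (rule Z.span_add)
    then show "x \<in> Z.span (B \<union> S)" by simp
  qed
  ultimately show ?thesis using that B by blast
qed

text \<open>All \<open>x ^ n * c\<close> stay in \<open>I\<close>, so all powers of \<open>x\<close>
  lie in one finitely generated group, the integers divided by \<open>c\<close>.\<close>

lemma integral_if_stable:
  fixes x :: "'k::number_field"
  assumes "I \<subseteq> integers" "c \<in> I" "c \<noteq> 0" "\<And>y. y \<in> I \<Longrightarrow> x * y \<in> I"
  shows "algebraic_int x"
proof -
  obtain W :: "'k set" where W: "finite W" "integers \<subseteq> Z.span W" by (rule integers_finitely_generated)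
  have "x ^ n * c \<in> I" for n by (induction n) (use assms(2,4) in \<open>auto simp: mult.assoc\<close>)
  then have "inverse c * (x ^ n * c) \<in> Z.span ((*) (inverse c) ` W)" for n
    using W(2) assms(1) by (intro Z_span_mult) blast
  moreover have "inverse c * (x ^ n * c) = x ^ n" for n using assms(3) by simp
  ultimately show ?thesis using W(1) by (intro algebraic_int_if_powers_in_span[of "(*) (inverse c) ` W"]) auto
qed

text \<open>The colon module of the ring of integers by \<open>\<pp>\<close>; it is the inverse of
  \<open>\<pp>\<close> by \<open>ip_pinv\<close>.\<close>

definition pinv :: "'k::number_field set \<Rightarrow> 'k set" where
  "pinv \<pp> = {x. \<forall>y\<in>\<pp>. algebraic_int (x * y)}"

lemma omod_pinv: "omod (pinv \<pp>)"
  by (rule omodI) (auto simp: pinv_def distrib_right mult.assoc algebraic_int_add_mult)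

text \<open>Take a nonzero \<open>a\<close> in \<open>\<pp>\<close> and a shortest product of primes
  inside \<open>(a)\<close>. One factor is \<open>\<pp>\<close>; without it the product has an
  element \<open>b\<close> outside \<open>(a)\<close>, although \<open>\<pp>\<close> times
  \<open>b\<close> stays inside. Then \<open>b / a\<close> is the required element.\<close>

lemma pinv_nontrivial:
  assumes p: "\<pp> \<in> fin_places"
  obtains x where "x \<in> pinv \<pp>" "\<not> algebraic_int x"
proof -
  note pD = fin_placeD[OF p]
  obtain a where a: "a \<in> \<pp>" "a \<noteq> 0" using pD(5) by blast
  have aO: "algebraic_int a" using a pD by blast
  have "a * 1 \<in> (*) a ` integers" by (intro imageI) simp
  then have "a \<in> (*) a ` integers" by simp
  define good where "good \<pp>s \<longleftrightarrow> set \<pp>s \<subseteq> fin_places \<and> iprod \<pp>s \<subseteq> (*) a ` integers" for \<pp>s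
  have "\<exists>\<pp>s. good \<pp>s" unfolding good_def
    using \<open>a \<in> (*) a ` integers\<close> a(2)
    by (rule ideal_contains_iprod[OF omod_scale[OF omod_integers] mult_integers_subset[OF aO]])
  then obtain \<rr>s where "good \<rr>s" by blast
  then obtain \<pp>s where "good \<pp>s" and min': "\<And>\<qq>s. good \<qq>s \<Longrightarrow> length \<pp>s \<le> length \<qq>s"
    using ex_has_least_nat[of good \<rr>s length] by blast
  then have ps: "set \<pp>s \<subseteq> fin_places" "iprod \<pp>s \<subseteq> (*) a ` integers"
    and min: "\<And>\<qq>s. set \<qq>s \<subseteq> fin_places \<Longrightarrow> iprod \<qq>s \<subseteq> (*) a ` integers \<Longrightarrow> length \<pp>s \<le> length \<qq>s"
    by (simp_all add: good_def)
  have "(*) a ` integers \<subseteq> \<pp>" using omod_mult[OF pD(1) _ a(1)] by (auto simp: mult.commute)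
  then have pin: "\<pp> \<in> set \<pp>s" using prime_contains_iprod[OF p ps(1)] ps(2) by blast
  define \<qq>s where "\<qq>s = remove1 \<pp> \<pp>s"
  have qs: "set \<qq>s \<subseteq> fin_places"
    unfolding \<qq>s_def by (rule subset_trans[OF set_remove1_subset ps(1)])
  have "length \<qq>s < length \<pp>s"
    using pin length_pos_if_in_set[OF pin] by (simp add: \<qq>s_def length_remove1)
  then have "\<not> iprod \<qq>s \<subseteq> (*) a ` integers" using min[OF qs] by auto
  then obtain b where b: "b \<in> iprod \<qq>s" "b \<notin> (*) a ` integers" by blast
  have "iprod \<pp>s = ip \<pp> (iprod \<qq>s)" unfolding \<qq>s_def by (rule iprod_remove1[OF pin ps(1)])
  then have "y * b \<in> (*) a ` integers" if "y \<in> \<pp>" for y using ip_mult[OF that b(1)] ps(2) by blast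
  then have "b / a \<in> pinv \<pp>" using a by (fastforce simp: pinv_def mult.commute)
  moreover have "\<not> algebraic_int (b / a)"
  proof
    assume "algebraic_int (b / a)"
    then have "a * (b / a) \<in> (*) a ` integers" by (intro imageI) simp
    then show False using b a by simp
  qed
  ultimately show ?thesis using that by blast
qed

text \<open>The product is an ideal above \<open>\<pp>\<close>, hence \<open>\<pp>\<close> or the
  whole ring. In the first case a nonintegral element of \<open>pinv \<pp>\<close> would map
  \<open>\<pp>\<close> to itself and so be integral.\<close>

lemma ip_pinv:
  assumes p: "\<pp> \<in> fin_places"
  shows "ip \<pp> (pinv \<pp>) = integers"
proof (rule ccontr)
  assume ne: "ip \<pp> (pinv \<pp>) \<noteq> integers"
  note pD = fin_placeD[OF p]
  have sub: "ip \<pp> (pinv \<pp>) \<subseteq> integers"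
    by (subst ip_le_iff[OF addsub_integers]) (auto simp: pinv_def mult.commute)
  have "1 \<in> pinv \<pp>" using pD(2) by (auto simp: pinv_def)
  then have "\<pp> \<subseteq> ip \<pp> (pinv \<pp>)" using ip_mult[of _ \<pp> 1 "pinv \<pp>"] by auto
  moreover have "omod (ip \<pp> (pinv \<pp>))" by (intro omod_ip pD omod_pinv)
  ultimately have eq: "ip \<pp> (pinv \<pp>) = \<pp>" using fin_place_maximal[OF p] sub ne by blast
  obtain x where x: "x \<in> pinv \<pp>" "\<not> algebraic_int x" by (rule pinv_nontrivial[OF p])
  obtain c where c: "c \<in> \<pp>" "c \<noteq> 0" using pD(5) by blast
  have "x * y \<in> \<pp>" if "y \<in> \<pp>" for y using ip_mult[OF that x(1)] eq by (simp add: mult.commute)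
  then show False using integral_if_stable[OF pD(2) c] x(2) by blast
qed

text \<open>Multiplying by the inverse of a prime above \<open>I\<close> enlarges \<open>I\<close>,
  strictly because a nonintegral element cannot stabilize \<open>I\<close>. The index drops, and
  multiplying back by the prime recovers \<open>I\<close>.\<close>

lemma ideal_factorization:
  assumes "omod I" "I \<subseteq> integers" "c \<in> I" "c \<noteq> 0"
  shows "\<exists>\<pp>s. set \<pp>s \<subseteq> fin_places \<and> iprod \<pp>s = I"
  using assms
proof (induction "idx integers I" arbitrary: I rule: less_induct)
  case less
  have fin: "finite (quot integers I)" using finite_quot_ideal less.prems by blast
  show ?case
  proof (cases "I = integers")
    case True
    then show ?thesis by (intro exI[of _ "[]"]) auto
  next
    case False
    then obtain \<pp> where p: "\<pp> \<in> fin_places" "I \<subseteq> \<pp>"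
      using fin_place_above[OF less.prems(1,2) _ less.prems(3,4)] by blast
    note pD = fin_placeD[OF p(1)]
    define J where "J = ip I (pinv \<pp>)"
    have oJ: "omod J" unfolding J_def by (intro omod_ip less.prems omod_pinv)
    have "1 \<in> pinv \<pp>" using pD(2) by (auto simp: pinv_def)
    then have IJ: "I \<subseteq> J" unfolding J_def using ip_mult[of _ I 1 "pinv \<pp>"] by auto
    have JO: "J \<subseteq> integers" unfolding J_def using ip_mono[OF p(2) order_refl] ip_pinv[OF p(1)] by blast
    have "I \<noteq> J"
    proof
      assume eq: "I = J"
      obtain x where x: "x \<in> pinv \<pp>" "\<not> algebraic_int x" by (rule pinv_nontrivial[OF p(1)])
      have "x * y \<in> I" if "y \<in> I" for y
        using ip_mult[OF that x(1)] unfolding J_def[symmetric] eq[symmetric] by (simp add: mult.commute)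
      then show False using integral_if_stable[OF less.prems(2,3,4)] x(2) by blast
    qed
    then have "idx integers J < idx integers I" using idx_strict[OF less.prems(1) oJ _ JO fin] IJ by blast
    then obtain \<pp>s where ps: "set \<pp>s \<subseteq> fin_places" "iprod \<pp>s = J"
      using less.hyps[of J] oJ JO IJ less.prems by blast
    have "ip \<pp> J = ip (ip \<pp> (pinv \<pp>)) I"
      unfolding J_def using less.prems(1) pD(1) omod_pinv by (metis ip_assoc ip_commute)
    also have "\<dots> = I" unfolding ip_pinv[OF p(1)] by (rule ip_integers[OF less.prems(1)])
    finally show ?thesis using ps p by (intro exI[of _ "\<pp> # \<pp>s"]) auto
  qed
qed

lemma ip_cancel_prime:
  assumes p: "\<pp> \<in> fin_places" and o: "omod M" "omod N" and sub: "ip \<pp> M \<subseteq> ip \<pp> N"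
  shows "M \<subseteq> N"
proof -
  have *: "ip (pinv \<pp>) (ip \<pp> L) = L" if "omod L" for L
    using ip_assoc[OF omod_pinv fin_placeD(1)[OF p] that] ip_pinv[OF p] ip_integers[OF that] ip_commute
    by metis
  show ?thesis using ip_mono[OF order_refl sub, of "pinv \<pp>"] *[OF o(1)] *[OF o(2)] by simp
qed

lemma iprod_inverse:
  assumes "set \<pp>s \<subseteq> fin_places"
  shows "\<exists>N. omod N \<and> ip (iprod \<pp>s) N = integers"
  using assms
proof (induction \<pp>s)
  case Nil
  then show ?case by (auto intro!: exI[of _ integers] omod_integers simp: ip_integers omod_integers)
next
  case (Cons \<pp> \<pp>s)
  then obtain N where N: "omod N" "ip (iprod \<pp>s) N = integers" by auto
  have p: "\<pp> \<in> fin_places" and o: "omod (iprod \<pp>s)" using Cons omod_iprod by auto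
  have "ip (ip \<pp> (iprod \<pp>s)) (ip N (pinv \<pp>)) = ip \<pp> (ip (ip (iprod \<pp>s) N) (pinv \<pp>))"
    using ip_assoc[OF fin_placeD(1)[OF p] o omod_ip[OF N(1) omod_pinv]]
      ip_assoc[OF o N(1) omod_pinv] by metis
  also have "\<dots> = integers" using N(2) ip_pinv[OF p] by (simp add: ip_integers omod_pinv)
  finally show ?case
    using omod_ip[OF N(1) omod_pinv, of \<pp>] by (intro exI[of _ "ip N (pinv \<pp>)"]) simp
qed

lemma card_image_cong_eq:
  assumes "\<And>x y. x \<in> A \<Longrightarrow> y \<in> A \<Longrightarrow> f x = f y \<longleftrightarrow> g x = g y"
  shows "card (f ` A) = card (g ` A)" "finite (f ` A) \<longleftrightarrow> finite (g ` A)"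
proof -
  define h where "h z = g (SOME x. x \<in> A \<and> f x = z)" for z
  have h: "h (f x) = g x" if "x \<in> A" for x
  proof -
    have "\<exists>y. y \<in> A \<and> f y = f x" using that by blast
    from someI_ex[OF this] show ?thesis unfolding h_def using assms[OF _ that] by blast
  qed
  have "bij_betw h (f ` A) (g ` A)"
    unfolding bij_betw_def
  proof
    show "inj_on h (f ` A)" using assms h by (auto simp: inj_on_def)
    show "h ` f ` A = g ` A" using h by (auto simp: image_image)
  qed
  then show "card (f ` A) = card (g ` A)" "finite (f ` A) \<longleftrightarrow> finite (g ` A)"
    using bij_betw_same_card bij_betw_finite by blast+
qed

text \<open>For any \<open>a\<close> in \<open>I\<close> outside \<open>\<pp> I\<close>, multiplication by \<open>a\<close> identifies the residue field of
  \<open>\<pp>\<close> with \<open>I\<close> modulo \<open>\<pp> I\<close>, because no ideal lies strictly between \<open>\<pp> I\<close> and \<open>I\<close>.\<close>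

lemma idx_ip_prime:
  assumes p: "\<pp> \<in> fin_places" and ps: "set \<pp>s \<subseteq> fin_places"
  shows "idx (iprod \<pp>s) (ip \<pp> (iprod \<pp>s)) = idx integers \<pp>" "finite (quot (iprod \<pp>s) (ip \<pp> (iprod \<pp>s)))"
proof -
  note pD = fin_placeD[OF p]
  define I where "I = iprod \<pp>s"
  define pI where "pI = ip \<pp> I"
  have oI: "omod I" unfolding I_def by (rule omod_iprod[OF ps])
  have opI: "omod pI" unfolding pI_def by (intro omod_ip oI pD)
  have pII: "pI \<subseteq> I" unfolding pI_def using ip_subset_left[OF oI pD(2)] ip_commute by metis
  obtain N where N: "omod N" "ip I N = integers" using iprod_inverse[OF ps] unfolding I_def by blast
  have pN: "ip pI N = \<pp>" unfolding pI_def ip_assoc[OF pD(1) oI N(1)] N(2)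
    using ip_integers[OF pD(1)] ip_commute by metis
  have "pI \<noteq> I" using pN N(2) pD(3) by blast
  then obtain a where a: "a \<in> I" "a \<notin> pI" using pII by blast
  define J where "J = adjoin pI a"
  have oJ: "omod J" and pIJ: "pI \<subseteq> J" and aJ: "a \<in> J" and JI: "J \<subseteq> I"
    unfolding J_def
    using omod_adjoin[OF opI] subset_adjoin[OF opI] mem_adjoin[OF opI]
      adjoin_subset[OF opI oI pII a(1)] by simp_all
  have aI: "y * a \<in> I" if "algebraic_int y" for y using omod_mult[OF oI that a(1)] .
  \<comment> \<open>Multiplication by \<open>N\<close>, the inverse of \<open>I\<close>, carries
    \<open>J\<close> to an ideal between \<open>\<pp>\<close> and the ring of integers, where
    maximality applies; multiplication by \<open>I\<close> brings it back.\<close>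
  have J_back: "ip (ip J N) I = J"
    using ip_assoc[OF oJ N(1) oI] N(2) ip_integers[OF oJ] ip_commute by metis
  have "\<pp> \<subseteq> ip J N" using ip_mono[OF pIJ order_refl, of N] pN by blast
  moreover have "ip J N \<noteq> \<pp>" using J_back aJ a unfolding pI_def by auto
  moreover have "ip J N \<subseteq> integers" using ip_mono[OF JI order_refl, of N] N by blast
  ultimately have "ip J N = integers" using fin_place_maximal[OF p omod_ip[OF oJ N(1)]] by blast
  then have J: "J = I" using J_back ip_integers[OF oI] by simp
  have iff: "(+) (x * a) ` pI = (+) (y * a) ` pI \<longleftrightarrow> (+) x ` \<pp> = (+) y ` \<pp>"
    if "x \<in> integers" "y \<in> integers" for x y
  proof -
    have "(x - y) * a \<in> pI \<longleftrightarrow> x - y \<in> \<pp>"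
    proof
      assume "x - y \<in> \<pp>"
      then show "(x - y) * a \<in> pI" unfolding pI_def using a by (intro ip_mult)
    next
      assume z: "(x - y) * a \<in> pI"
      show "x - y \<in> \<pp>"
      proof (rule ccontr)
        \<comment> \<open>A factor outside \<open>\<pp>\<close> is invertible modulo
          \<open>\<pp>\<close>, so it would bring \<open>a\<close> itself into
          \<open>pI\<close>.\<close>
        assume nz: "x - y \<notin> \<pp>"
        have zO: "algebraic_int (x - y)" using that by (simp add: algebraic_int_diff)
        define K where "K = adjoin \<pp> (x - y)"
        have oK: "omod K" and "\<pp> \<subseteq> K" "x - y \<in> K" and "K \<subseteq> integers"
          unfolding K_def
          using omod_adjoin[OF pD(1)] subset_adjoin[OF pD(1)] mem_adjoin[OF pD(1)]
            adjoin_subset[OF pD(1) omod_integers pD(2)] zO by simp_all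
        then have "K = integers" using fin_place_maximal[OF p oK] nz by auto
        then have "1 \<in> K" by simp
        then obtain u v where uv: "1 = u + (x - y) * v" "u \<in> \<pp>" "algebraic_int v"
          unfolding K_def by (rule adjoinE)
        have "a = u * a + v * ((x - y) * a)"
          using arg_cong[OF uv(1), of "\<lambda>t. t * a"] by (simp add: algebra_simps)
        also have "\<dots> \<in> pI"
          using ip_mult[OF uv(2) a(1)] omod_mult[OF opI uv(3) z]
          by (intro omod_add[OF opI]) (simp_all add: pI_def)
        finally show False using a by simp
      qed
    qed
    then show ?thesis
      using coset_eq_iff[OF omod_addsub[OF opI]] coset_eq_iff[OF omod_addsub[OF pD(1)]]
      by (simp add: left_diff_distrib)
  qed
  have "quot I pI = (\<lambda>x. (+) (x * a) ` pI) ` integers"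
  proof
    show "quot I pI \<subseteq> (\<lambda>x. (+) (x * a) ` pI) ` integers"
    proof
      fix X assume "X \<in> quot I pI"
      then obtain w where w: "w \<in> J" "X = (+) w ` pI" by (auto simp: quot_def J)
      then obtain u v where "w = u + a * v" "u \<in> pI" "algebraic_int v" unfolding J_def by (auto elim: adjoinE)
      then have "X = (+) (v * a) ` pI" using coset_eq_iff[OF omod_addsub[OF opI]] w by (simp add: mult.commute)
      then show "X \<in> (\<lambda>x. (+) (x * a) ` pI) ` integers" using \<open>algebraic_int v\<close> by blast
    qed
    show "(\<lambda>x. (+) (x * a) ` pI) ` integers \<subseteq> quot I pI" using aI by (auto simp: quot_def)
  qed
  moreover have "finite (quot integers \<pp>)"
    using pD(5) finite_quot_ideal[OF pD(1) _ _ pD(2)] by blast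
  ultimately show "idx (iprod \<pp>s) (ip \<pp> (iprod \<pp>s)) = idx integers \<pp>" "finite (quot (iprod \<pp>s) (ip \<pp> (iprod \<pp>s)))"
    using card_image_cong_eq[of integers "\<lambda>x. (+) (x * a) ` pI" "\<lambda>x. (+) x ` \<pp>", OF iff]
    unfolding I_def[symmetric] pI_def[symmetric] idx_def by (simp_all add: quot_def)
qed

lemma idx_iprod:
  assumes "set \<pp>s \<subseteq> fin_places"
  shows "finite (quot integers (iprod \<pp>s)) \<and> idx integers (iprod \<pp>s) = (\<Prod>\<pp>\<leftarrow>\<pp>s. idx integers \<pp>)"
  using assms
proof (induction \<pp>s)
  case Nil
  have "quot integers integers = {(+) 0 ` (integers :: 'a set)}"
    using coset_eq_iff[OF addsub_integers, of _ 0] by (auto simp: quot_def image_def)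
  then show ?case by (simp add: idx_def)
next
  case (Cons \<pp> \<pp>s)
  have p: "\<pp> \<in> fin_places" and ps: "set \<pp>s \<subseteq> fin_places" using Cons by auto
  note q = idx_ip_prime[OF p ps]
  have o: "omod (iprod \<pp>s)" "omod (ip \<pp> (iprod \<pp>s))" using omod_iprod[OF ps] omod_ip fin_placeD(1)[OF p] by auto
  have sub: "ip \<pp> (iprod \<pp>s) \<subseteq> iprod \<pp>s"
    using ip_subset_left[OF o(1) fin_placeD(2)[OF p]] ip_commute by metis
  from quot_tower[OF addsub_integers omod_addsub[OF o(1)] omod_addsub[OF o(2)] sub iprod_integers[OF ps] _ q(2)]
  show ?case using Cons q(1) by simp
qed

text \<open>To contain is to divide: common primes are cancelled one at a time by their inverses.
  Uniqueness of the factorization is included, as inclusions both ways force equal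
  multisets.\<close>

lemma iprod_subset_iff:
  assumes "set \<pp>s \<subseteq> fin_places" "set \<qq>s \<subseteq> fin_places"
  shows "iprod \<pp>s \<subseteq> iprod \<qq>s \<longleftrightarrow> mset \<qq>s \<subseteq># mset \<pp>s"
  using assms
proof (induction \<qq>s arbitrary: \<pp>s)
  case Nil
  then show ?case using iprod_integers by simp
next
  case (Cons \<qq> \<qq>s)
  have q: "\<qq> \<in> fin_places" and qs: "set \<qq>s \<subseteq> fin_places" using Cons.prems by auto
  have main: "iprod \<pp>s \<subseteq> iprod (\<qq> # \<qq>s) \<longleftrightarrow> mset (\<qq> # \<qq>s) \<subseteq># mset \<pp>s" if "\<qq> \<in> set \<pp>s"
  proof -
    have r: "set (remove1 \<qq> \<pp>s) \<subseteq> fin_places" using Cons.prems set_remove1_subset by fastforce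
    have e: "iprod \<pp>s = ip \<qq> (iprod (remove1 \<qq> \<pp>s))" by (rule iprod_remove1[OF that Cons.prems(1)])
    have "iprod \<pp>s \<subseteq> iprod (\<qq> # \<qq>s) \<longleftrightarrow> iprod (remove1 \<qq> \<pp>s) \<subseteq> iprod \<qq>s"
      unfolding e iprod_simps
      using ip_cancel_prime[OF q omod_iprod[OF r] omod_iprod[OF qs]] ip_mono[OF order_refl] by blast
    also have "\<dots> \<longleftrightarrow> mset \<qq>s \<subseteq># mset (remove1 \<qq> \<pp>s)" by (rule Cons.IH[OF r qs])
    also have "\<dots> \<longleftrightarrow> mset (\<qq> # \<qq>s) \<subseteq># mset \<pp>s" using that by (simp add: insert_subset_eq_iff)
    finally show ?thesis .
  qed
  moreover have "\<qq> \<in> set \<pp>s" if "iprod \<pp>s \<subseteq> iprod (\<qq> # \<qq>s)"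
  proof -
    have "iprod (\<qq> # \<qq>s) \<subseteq> \<qq>" using ip_subset_left[OF fin_placeD(1)[OF q] iprod_integers[OF qs]] by simp
    then show ?thesis using prime_contains_iprod[OF q Cons.prems(1)] that by blast
  qed
  moreover have "\<qq> \<in> set \<pp>s" if "mset (\<qq> # \<qq>s) \<subseteq># mset \<pp>s"
    using that by (metis list.set_intros(1) mset_subset_eqD set_mset_mset)
  ultimately show ?case by blast
qed

section \<open>Finite places and the product formula\<close>

lemma card_residue_ring:
  assumes p: "\<pp> \<in> fin_places"
  shows "card (carrier (int_ring Quot \<pp>)) = idx integers \<pp>"
proof -
  have "carrier (int_ring Quot \<pp>) = quot integers \<pp>"
    unfolding FactRing_def A_RCOSETS_def' a_r_coset_def' quot_def
    by (auto simp: image_def add.commute)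
  then show ?thesis by (simp add: idx_def)
qed

lemma finite_quot_fin_place: "\<pp> \<in> fin_places \<Longrightarrow> finite (quot integers \<pp>)"
  using fin_placeD(1,2,5)[of \<pp>] finite_quot_ideal by blast

lemma idx_fin_place_ge_2:
  assumes p: "\<pp> \<in> fin_places"
  shows "idx integers \<pp> \<ge> 2"
proof -
  have "(+) 1 ` \<pp> \<noteq> (+) 0 ` \<pp>"
    using coset_eq_iff[OF omod_addsub[OF fin_placeD(1)[OF p]], of 1 0] fin_placeD(4)[OF p] by simp
  moreover have "{(+) 1 ` \<pp>, (+) 0 ` \<pp>} \<subseteq> quot integers \<pp>"
  proof -
    have "1 \<in> integers" "0 \<in> integers" by auto
    then show ?thesis unfolding quot_def by blast
  qed
  then have "card {(+) 1 ` \<pp>, (+) 0 ` \<pp>} \<le> idx integers \<pp>"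
    unfolding idx_def by (rule card_mono[OF finite_quot_fin_place[OF p]])
  ultimately show ?thesis by simp
qed

text \<open>Translation by 1 permutes the residue classes, so it preserves the sum of a system of
  representatives modulo \<open>\<pp>\<close>.\<close>

lemma idx_in_fin_place:
  assumes p: "\<pp> \<in> fin_places"
  shows "of_nat (idx integers \<pp>) \<in> \<pp>"
proof -
  note pD = fin_placeD[OF p]
  note a = omod_addsub[OF pD(1)]
  obtain S where S: "S \<subseteq> integers" "bij_betw (\<lambda>x. (+) x ` \<pp>) S (quot integers \<pp>)"
    "\<And>x. x \<in> integers \<Longrightarrow> \<exists>s\<in>S. x - s \<in> \<pp>" using quot_reps[OF a] by metis
  have fin: "finite S" using S(2) finite_quot_fin_place[OF p] bij_betw_finite by blast
  have card: "card S = idx integers \<pp>" using S(2) bij_betw_same_card by (simp add: idx_def) blast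
  have "\<exists>t\<in>S. (s + 1) - t \<in> \<pp>" if "s \<in> S" for s
    using S(1) that by (intro S(3)) (auto intro: algebraic_int_add_mult)
  then obtain \<pi> where \<pi>: "\<And>s. s \<in> S \<Longrightarrow> \<pi> s \<in> S" "\<And>s. s \<in> S \<Longrightarrow> (s + 1) - \<pi> s \<in> \<pp>" by metis
  have "inj_on \<pi> S"
  proof (rule inj_onI)
    fix s t assume st: "s \<in> S" "t \<in> S" "\<pi> s = \<pi> t"
    have "((s + 1) - \<pi> s) - ((t + 1) - \<pi> t) \<in> \<pp>" using st by (intro addsub_diff[OF a] \<pi>(2))
    then have "s - t \<in> \<pp>" using st(3) by simp
    then have "(+) s ` \<pp> = (+) t ` \<pp>" using coset_eq_iff[OF a] by blast
    then show "s = t" using S(2) st by (auto simp: bij_betw_def inj_on_def)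
  qed
  moreover have "\<pi> ` S = S" using endo_inj_surj[OF fin _ \<open>inj_on \<pi> S\<close>] \<pi>(1) by blast
  ultimately have "sum \<pi> S = sum (\<lambda>s. s) S" using sum.reindex[of \<pi> S "\<lambda>s. s"] by simp
  then have "(\<Sum>s\<in>S. (s + 1) - \<pi> s) = of_nat (card S)"
    by (simp add: sum_subtractf sum.distrib)
  moreover have "(\<Sum>s\<in>S. (s + 1) - \<pi> s) \<in> \<pp>" by (intro addsub_sum[OF a] \<pi>(2))
  ultimately show ?thesis by (simp add: card)
qed

lemma ideal_power_eq: "ideal_power \<pp> n = iprod (replicate n \<pp>)"
proof -
  have "ideal_prod int_ring \<pp> = ip \<pp>" by (simp add: ip_def fun_eq_iff)
  then show ?thesis unfolding ideal_power_def by (induction n) auto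
qed

lemma principal_factorization:
  fixes a :: "'k::number_field"
  assumes "algebraic_int a" "a \<noteq> 0"
  obtains \<pp>s where "set \<pp>s \<subseteq> fin_places" "iprod \<pp>s = (*) a ` integers"
proof -
  have "a * 1 \<in> (*) a ` integers" by (intro imageI) simp
  then have "a \<in> (*) a ` integers" by simp
  from ideal_factorization[OF omod_scale[OF omod_integers] mult_integers_subset[OF assms(1)] this assms(2)]
  show ?thesis using that by blast
qed

lemma principal_subset_iff:
  assumes "omod M"
  shows "(*) a ` integers \<subseteq> M \<longleftrightarrow> a \<in> M"
proof
  assume "(*) a ` integers \<subseteq> M"
  moreover have "a * 1 \<in> (*) a ` integers" by (intro imageI) simp
  ultimately show "a \<in> M" by auto
qed (auto simp: mult.commute[of a] intro: omod_mult[OF assms])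

lemma mem_ideal_power_count:
  assumes p: "\<pp> \<in> fin_places" and ps: "set \<pp>s \<subseteq> fin_places" "iprod \<pp>s = (*) a ` integers"
  shows "a \<in> ideal_power \<pp> n \<longleftrightarrow> n \<le> count (mset \<pp>s) \<pp>"
proof -
  have r: "set (replicate n \<pp>) \<subseteq> fin_places" using p by (auto simp: set_replicate_conv_if)
  have "a \<in> ideal_power \<pp> n \<longleftrightarrow> iprod \<pp>s \<subseteq> iprod (replicate n \<pp>)"
    unfolding ideal_power_eq ps(2) using principal_subset_iff[OF omod_iprod[OF r]] by simp
  also have "\<dots> \<longleftrightarrow> n \<le> count (mset \<pp>s) \<pp>"
    by (simp add: iprod_subset_iff[OF ps(1) r] count_le_replicate_mset_subset_eq)
  finally show ?thesis .
qed

lemma ord_int_count: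
  assumes p: "\<pp> \<in> fin_places" and ps: "set \<pp>s \<subseteq> fin_places" "iprod \<pp>s = (*) a ` integers"
  shows "ord_int \<pp> a = count (mset \<pp>s) \<pp>"
  unfolding ord_int_def mem_ideal_power_count[OF assms] by (rule Greatest_equality) auto

lemma mem_ideal_power_iff:
  assumes "\<pp> \<in> fin_places" "algebraic_int a" "a \<noteq> 0"
  shows "a \<in> ideal_power \<pp> n \<longleftrightarrow> n \<le> ord_int \<pp> a"
proof -
  obtain \<pp>s where "set \<pp>s \<subseteq> fin_places" "iprod \<pp>s = (*) a ` integers"
    by (rule principal_factorization[OF assms(2,3)])
  then show ?thesis using mem_ideal_power_count ord_int_count assms by metis
qed

lemma ord_int_mult:
  assumes p: "\<pp> \<in> fin_places" and a: "algebraic_int a" "a \<noteq> 0" and b: "algebraic_int b" "b \<noteq> 0"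
  shows "ord_int \<pp> (a * b) = ord_int \<pp> a + ord_int \<pp> b"
proof -
  obtain \<pp>s where ps: "set \<pp>s \<subseteq> fin_places" "iprod \<pp>s = (*) a ` integers"
    by (rule principal_factorization[OF a])
  obtain \<qq>s where qs: "set \<qq>s \<subseteq> fin_places" "iprod \<qq>s = (*) b ` integers"
    by (rule principal_factorization[OF b])
  have "iprod (\<pp>s @ \<qq>s) = (*) (a * b) ` integers"
    unfolding iprod_append[OF ps(1) qs(1)] ps(2) qs(2) ip_principal[OF omod_scale[OF omod_integers]]
    by (simp add: image_image mult.assoc)
  then have "ord_int \<pp> (a * b) = count (mset (\<pp>s @ \<qq>s)) \<pp>"
    using ps qs by (intro ord_int_count[OF p]) auto
  then show ?thesis by (simp add: ord_int_count[OF p ps] ord_int_count[OF p qs])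
qed

text \<open>Orders are multiplicities of primes, so the inequalities compare multisets of factors,
  hence principal ideals.\<close>

lemma dvd_if_ord_int_le:
  assumes a: "algebraic_int a" "a \<noteq> 0" and b: "algebraic_int b" "b \<noteq> 0"
    and le: "\<And>\<pp>. \<pp> \<in> fin_places \<Longrightarrow> ord_int \<pp> b \<le> ord_int \<pp> a"
  shows "algebraic_int (a / b)"
proof -
  obtain \<pp>s where ps: "set \<pp>s \<subseteq> fin_places" "iprod \<pp>s = (*) a ` integers"
    by (rule principal_factorization[OF a])
  obtain \<qq>s where qs: "set \<qq>s \<subseteq> fin_places" "iprod \<qq>s = (*) b ` integers"
    by (rule principal_factorization[OF b])
  have "count (mset \<qq>s) \<pp> \<le> count (mset \<pp>s) \<pp>" for \<pp>
  proof (cases "\<pp> \<in> fin_places")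
    case True
    then show ?thesis using le[OF True] by (simp add: ord_int_count[OF True ps] ord_int_count[OF True qs])
  next
    case False
    then have "\<pp> \<notin># mset \<qq>s" using qs(1) by auto
    then have "count (mset \<qq>s) \<pp> = 0" by (meson not_in_iff)
    then show ?thesis by linarith
  qed
  then have "mset \<qq>s \<subseteq># mset \<pp>s" by (simp add: subseteq_mset_def)
  then have "(*) a ` integers \<subseteq> (*) b ` integers"
    using iprod_subset_iff[OF ps(1) qs(1)] ps(2) qs(2) by simp
  then have "a \<in> (*) b ` integers" using principal_subset_iff[OF omod_scale[OF omod_integers]] by blast
  then show ?thesis using b by auto
qed

section \<open>Orders and absolute values on the whole field\<close>

lemma integral_fraction:
  fixes x :: "'k::number_field"
  assumes "x \<noteq> 0"
  obtains a b where "algebraic_int a" "a \<noteq> 0" "algebraic_int b" "b \<noteq> 0" "x = a / b"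
proof -
  obtain n :: int where n: "n > 0" "algebraic_int (of_int n * x)" by (rule integral_multiple)
  show ?thesis by (rule that[of "of_int n * x" "of_int n"]) (use n assms in auto)
qed

text \<open>The definite description has a unique value: two fractions for one element are
  cross-multiplied, and orders of integers are additive.\<close>

lemma ord_at_divide:
  assumes p: "\<pp> \<in> fin_places" and a: "algebraic_int a" "a \<noteq> 0" and b: "algebraic_int b" "b \<noteq> 0"
  shows "ord_at \<pp> (a / b) = int (ord_int \<pp> a) - int (ord_int \<pp> b)"
  unfolding ord_at_def
proof (rule the_equality)
  show "\<exists>a'\<in>carrier int_ring - {0}. \<exists>b'\<in>carrier int_ring - {0}. a / b = a' / b' \<and>
      int (ord_int \<pp> a) - int (ord_int \<pp> b) = int (ord_int \<pp> a') - int (ord_int \<pp> b')"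
    using a b by (intro bexI[of _ a] bexI[of _ b]) auto
  fix e assume "\<exists>a'\<in>carrier int_ring - {0}. \<exists>b'\<in>carrier int_ring - {0}. a / b = a' / b' \<and>
      e = int (ord_int \<pp> a') - int (ord_int \<pp> b')"
  then obtain a' b' where a': "algebraic_int a'" "a' \<noteq> 0" and b': "algebraic_int b'" "b' \<noteq> 0"
    and eq: "a / b = a' / b'" and e: "e = int (ord_int \<pp> a') - int (ord_int \<pp> b')" by auto
  have "a * b' = a' * b" using eq b(2) b'(2) by (simp add: frac_eq_eq)
  then have "ord_int \<pp> a + ord_int \<pp> b' = ord_int \<pp> a' + ord_int \<pp> b"
    using ord_int_mult[OF p a b'] ord_int_mult[OF p a' b] by simp
  then show "e = int (ord_int \<pp> a) - int (ord_int \<pp> b)" unfolding e by linarith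
qed

lemma ord_int_1: "\<pp> \<in> fin_places \<Longrightarrow> ord_int \<pp> 1 = 0"
  using ord_int_mult[of \<pp> 1 1] by simp

lemma ord_at_int: "\<pp> \<in> fin_places \<Longrightarrow> algebraic_int a \<Longrightarrow> a \<noteq> 0 \<Longrightarrow> ord_at \<pp> a = int (ord_int \<pp> a)"
  using ord_at_divide[of \<pp> a 1] by (simp add: ord_int_1)

lemma ord_at_mult:
  assumes p: "\<pp> \<in> fin_places" and xy: "x \<noteq> 0" "y \<noteq> 0"
  shows "ord_at \<pp> (x * y) = ord_at \<pp> x + ord_at \<pp> y"
proof -
  obtain a b where a: "algebraic_int a" "a \<noteq> 0" "algebraic_int b" "b \<noteq> 0" "x = a / b"
    by (rule integral_fraction[OF xy(1)])
  obtain c d where c: "algebraic_int c" "c \<noteq> 0" "algebraic_int d" "d \<noteq> 0" "y = c / d"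
    by (rule integral_fraction[OF xy(2)])
  have "x * y = (a * c) / (b * d)" by (simp add: a(5) c(5))
  then have "ord_at \<pp> (x * y) = int (ord_int \<pp> (a * c)) - int (ord_int \<pp> (b * d))"
    using a c by (simp add: ord_at_divide[OF p] algebraic_int_add_mult)
  then show ?thesis
    using a c by (simp add: ord_int_mult[OF p] ord_at_divide[OF p])
qed

lemma fin_abs_idx:
  "\<pp> \<in> fin_places \<Longrightarrow> fin_abs \<pp> x = (if x = 0 then 0 else real (idx integers \<pp>) powi (- ord_at \<pp> x))"
  by (simp add: fin_abs_def card_residue_ring)

lemma fin_abs_0 [simp]: "fin_abs \<pp> 0 = 0"
  by (simp add: fin_abs_def)

lemma fin_abs_nonneg [simp]: "fin_abs \<pp> x \<ge> 0"
  by (simp add: fin_abs_def)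

lemma fin_abs_pos: "\<pp> \<in> fin_places \<Longrightarrow> x \<noteq> 0 \<Longrightarrow> fin_abs \<pp> x > 0"
  using idx_fin_place_ge_2[of \<pp>] by (simp add: fin_abs_idx)

lemma fin_abs_mult: "\<pp> \<in> fin_places \<Longrightarrow> fin_abs \<pp> (x * y) = fin_abs \<pp> x * fin_abs \<pp> y"
  using idx_fin_place_ge_2[of \<pp>]
  by (auto simp: fin_abs_idx ord_at_mult power_int_add[symmetric] add.commute)

lemma fin_abs_1: "\<pp> \<in> fin_places \<Longrightarrow> fin_abs \<pp> 1 = 1"
  using fin_abs_mult[of \<pp> 1 1] fin_abs_pos[of \<pp> 1] by simp

lemma fin_abs_power: "\<pp> \<in> fin_places \<Longrightarrow> fin_abs \<pp> (x ^ n) = fin_abs \<pp> x ^ n"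
  by (induction n) (auto simp: fin_abs_mult fin_abs_1)

lemma fin_abs_prod: "\<pp> \<in> fin_places \<Longrightarrow> fin_abs \<pp> (prod f A) = (\<Prod>i\<in>A. fin_abs \<pp> (f i))"
  by (induction A rule: infinite_finite_induct) (auto simp: fin_abs_mult fin_abs_1)

lemma fin_abs_inverse: "\<pp> \<in> fin_places \<Longrightarrow> fin_abs \<pp> (inverse x) = inverse (fin_abs \<pp> x)"
proof (cases "x = 0")
  case False
  assume p: "\<pp> \<in> fin_places"
  have "fin_abs \<pp> x * fin_abs \<pp> (inverse x) = 1"
    using False p by (simp flip: fin_abs_mult add: fin_abs_1)
  then show ?thesis by (simp add: inverse_unique)
qed simp

lemma fin_abs_int:
  "\<pp> \<in> fin_places \<Longrightarrow> algebraic_int a \<Longrightarrow> a \<noteq> 0 \<Longrightarrow>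
    fin_abs \<pp> a = inverse (real (idx integers \<pp>) ^ ord_int \<pp> a)"
  by (simp add: fin_abs_idx ord_at_int power_int_minus)

lemma fin_abs_int_le_iff:
  assumes p: "\<pp> \<in> fin_places" and a: "algebraic_int a" "a \<noteq> 0" and b: "algebraic_int b" "b \<noteq> 0"
  shows "fin_abs \<pp> a \<le> fin_abs \<pp> b \<longleftrightarrow> ord_int \<pp> b \<le> ord_int \<pp> a"
proof -
  have "real (idx integers \<pp>) > 1" using idx_fin_place_ge_2[OF p] by simp
  then show ?thesis
    by (simp add: fin_abs_int[OF p a] fin_abs_int[OF p b] power_increasing_iff)
qed

lemma fin_abs_le_1:
  assumes p: "\<pp> \<in> fin_places" and a: "algebraic_int a"
  shows "fin_abs \<pp> a \<le> 1"
proof (cases "a = 0")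
  case False
  then show ?thesis
    using fin_abs_int_le_iff[OF p a False, of 1] by (simp add: fin_abs_1[OF p] ord_int_1[OF p])
qed simp

lemma integral_if_fin_abs_le_1:
  fixes x :: "'k::number_field"
  assumes "\<And>\<pp>. \<pp> \<in> fin_places \<Longrightarrow> fin_abs \<pp> x \<le> 1"
  shows "algebraic_int x"
proof (cases "x = 0")
  case False
  then obtain a b where a: "algebraic_int a" "a \<noteq> 0" and b: "algebraic_int b" "b \<noteq> 0" and x: "x = a / b"
    by (rule integral_fraction)
  have "ord_int \<pp> b \<le> ord_int \<pp> a" if p: "\<pp> \<in> fin_places" for \<pp>
  proof -
    have "fin_abs \<pp> x * fin_abs \<pp> b = fin_abs \<pp> a" using b p x by (simp flip: fin_abs_mult)
    moreover have "fin_abs \<pp> x * fin_abs \<pp> b \<le> 1 * fin_abs \<pp> b"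
      using assms[OF p] by (intro mult_right_mono) auto
    ultimately show ?thesis using fin_abs_int_le_iff[OF p a b] by simp
  qed
  then show ?thesis unfolding x by (rule dvd_if_ord_int_le[OF a b])
qed simp

text \<open>For integers this says that a power of \<open>\<pp>\<close> is closed under addition.
  The general case follows on multiplying both summands by a common denominator.\<close>

lemma fin_abs_add:
  assumes p: "\<pp> \<in> fin_places"
  shows "fin_abs \<pp> (x + y) \<le> max (fin_abs \<pp> x) (fin_abs \<pp> y)"
proof -
  have int: "fin_abs \<pp> (a + b) \<le> fin_abs \<pp> b"
    if a: "algebraic_int a" "a \<noteq> 0" and b: "algebraic_int b" "b \<noteq> 0"
      and ab: "a + b \<noteq> 0" and le: "fin_abs \<pp> a \<le> fin_abs \<pp> b" for a b
  proof -
    have "a \<in> ideal_power \<pp> (ord_int \<pp> b)" "b \<in> ideal_power \<pp> (ord_int \<pp> b)"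
      using le mem_ideal_power_iff[OF p a] mem_ideal_power_iff[OF p b] fin_abs_int_le_iff[OF p a b] by auto
    moreover have "set (replicate n \<pp>) \<subseteq> fin_places" for n using p by (auto simp: set_replicate_conv_if)
    then have "omod (ideal_power \<pp> n)" for n unfolding ideal_power_eq by (rule omod_iprod)
    ultimately have "a + b \<in> ideal_power \<pp> (ord_int \<pp> b)" using omod_add by blast
    then show ?thesis
      using mem_ideal_power_iff[OF p _ ab] fin_abs_int_le_iff[OF p _ ab b] a b
      by (simp add: algebraic_int_add_mult)
  qed
  have main: "fin_abs \<pp> (x + y) \<le> fin_abs \<pp> y"
    if nz: "x \<noteq> 0" "y \<noteq> 0" "x + y \<noteq> 0" and le: "fin_abs \<pp> x \<le> fin_abs \<pp> y" for x y
  proof -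
    obtain a b where a: "algebraic_int a" "a \<noteq> 0" "algebraic_int b" "b \<noteq> 0" "x = a / b"
      by (rule integral_fraction[OF nz(1)])
    obtain c d where c: "algebraic_int c" "c \<noteq> 0" "algebraic_int d" "d \<noteq> 0" "y = c / d"
      by (rule integral_fraction[OF nz(2)])
    define e where "e = b * d"
    have e: "e \<noteq> 0" using a c by (simp add: e_def)
    have ex: "e * x = a * d" and ey: "e * y = c * b" using a c by (auto simp: e_def)
    have exy: "e * x + e * y \<noteq> 0" using nz(3) e by (simp flip: distrib_left)
    have "fin_abs \<pp> (e * x) \<le> fin_abs \<pp> (e * y)"
      unfolding fin_abs_mult[OF p] using le by (intro mult_left_mono) auto
    then have "fin_abs \<pp> (e * x + e * y) \<le> fin_abs \<pp> (e * y)"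
      using a c exy unfolding ex ey by (intro int) (simp_all add: algebraic_int_add_mult)
    then have "fin_abs \<pp> e * fin_abs \<pp> (x + y) \<le> fin_abs \<pp> e * fin_abs \<pp> y"
      by (simp flip: distrib_left fin_abs_mult[OF p])
    then show ?thesis using fin_abs_pos[OF p e] by simp
  qed
  show ?thesis
  proof (cases "x = 0 \<or> y = 0 \<or> x + y = 0")
    case True
    then show ?thesis by (auto simp: le_max_iff_disj)
  next
    case False
    then show ?thesis
      using main[of x y] main[of y x] linear[of "fin_abs \<pp> x" "fin_abs \<pp> y"]
      by (auto simp: le_max_iff_disj add.commute)
  qed
qed

lemma fin_abs_uminus:
  assumes p: "\<pp> \<in> fin_places"
  shows "fin_abs \<pp> (- x) = fin_abs \<pp> x"
proof -
  have "fin_abs \<pp> (- 1) * fin_abs \<pp> (- 1) = 1" using fin_abs_1[OF p] by (simp flip: fin_abs_mult[OF p])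
  then have "fin_abs \<pp> (- 1) = 1" using fin_abs_nonneg[of \<pp> "- 1"]
    by (metis abs_of_nonneg abs_1 power2_eq_1_iff power2_eq_square abs_minus_cancel)
  then show ?thesis using fin_abs_mult[OF p, of "- 1" x] by simp
qed

lemma fin_abs_diff:
  assumes p: "\<pp> \<in> fin_places"
  shows "fin_abs \<pp> (x - y) \<le> max (fin_abs \<pp> x) (fin_abs \<pp> y)"
  using fin_abs_add[OF p, of x "- y"] fin_abs_uminus[OF p] by simp

text \<open>The residue cardinality is a natural number of order at least 1 at \<open>\<pp>\<close>,
  so its powers can serve as denominators in \<open>northcott\<close>.\<close>

lemma fin_abs_idx_le:
  assumes p: "\<pp> \<in> fin_places"
  shows "fin_abs \<pp> (of_nat (idx integers \<pp>)) \<le> inverse (real (idx integers \<pp>))"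
proof -
  let ?N = "idx integers \<pp>"
  have N: "?N \<ge> 2" by (rule idx_fin_place_ge_2[OF p])
  have nz: "(of_nat ?N :: 'a) \<noteq> 0" using N by simp
  have "of_nat ?N \<in> ideal_power \<pp> 1"
    using idx_in_fin_place[OF p] ip_integers[OF fin_placeD(1)[OF p]] by (simp add: ideal_power_eq ip_commute)
  then have "1 \<le> ord_int \<pp> (of_nat ?N)" using mem_ideal_power_iff[OF p _ nz] by simp
  then have "real ?N ^ 1 \<le> real ?N ^ ord_int \<pp> (of_nat ?N :: 'a)" using N by (intro power_increasing) auto
  then show ?thesis using N by (simp add: fin_abs_int[OF p _ nz])
qed

text \<open>A nonnegative exponent makes the value a natural number. In \<open>northcott\<close>
  this turns the finite part of the height into a usable denominator.\<close>

lemma fin_abs_ge_1: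
  assumes p: "\<pp> \<in> fin_places" and "fin_abs \<pp> x \<ge> 1"
  obtains e where "fin_abs \<pp> x = real (idx integers \<pp>) ^ e"
proof -
  have x: "x \<noteq> 0" using assms by auto
  have N: "real (idx integers \<pp>) > 1" using idx_fin_place_ge_2[OF p] by simp
  have "real (idx integers \<pp>) powi (- ord_at \<pp> x) \<ge> real (idx integers \<pp>) powi 0"
    using assms(2) x by (simp add: fin_abs_idx[OF p])
  then have "- ord_at \<pp> x \<ge> 0"
    using power_int_strict_increasing[OF _ N, of "- ord_at \<pp> x" 0] by (meson not_le)
  then have "fin_abs \<pp> x = real (idx integers \<pp>) ^ nat (- ord_at \<pp> x)"
    using x by (simp add: fin_abs_idx[OF p] power_int_def)
  then show ?thesis using that by blast
qed

text \<open>The absolute values undo the norms of the prime factors, whose product is the index.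
  \<open>A\<close> may exceed the set of places that contribute, so several elements can share one
  set.\<close>

lemma prod_fin_abs_int:
  assumes a: "algebraic_int a" "a \<noteq> 0"
  shows "finite {\<pp> \<in> fin_places. fin_abs \<pp> a \<noteq> 1}"
    and "\<lbrakk>finite A; A \<subseteq> fin_places; {\<pp> \<in> fin_places. fin_abs \<pp> a \<noteq> 1} \<subseteq> A\<rbrakk> \<Longrightarrow>
      (\<Prod>\<pp>\<in>A. fin_abs \<pp> a) = inverse (real (norm_idx a))"
proof -
  obtain \<pp>s where ps: "set \<pp>s \<subseteq> fin_places" "iprod \<pp>s = (*) a ` integers"
    by (rule principal_factorization[OF a])
  have val: "fin_abs \<pp> a = inverse (real (idx integers \<pp>) ^ count (mset \<pp>s) \<pp>)" if "\<pp> \<in> fin_places" for \<pp>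
    by (simp add: fin_abs_int[OF that a] ord_int_count[OF that ps])
  have eq: "{\<pp> \<in> fin_places. fin_abs \<pp> a \<noteq> 1} = set \<pp>s"
  proof (intro equalityI subsetI)
    fix \<pp> assume "\<pp> \<in> {\<pp> \<in> fin_places. fin_abs \<pp> a \<noteq> 1}"
    then have p: "\<pp> \<in> fin_places" "fin_abs \<pp> a \<noteq> 1" by auto
    show "\<pp> \<in> set \<pp>s"
    proof (rule ccontr)
      assume "\<pp> \<notin> set \<pp>s"
      then have "count (mset \<pp>s) \<pp> = 0" by (metis count_eq_zero_iff set_mset_mset)
      then have "fin_abs \<pp> a = 1" using val[OF p(1)] by (simp only: power_0 of_nat_1 inverse_1)
      then show False using p(2) by simp
    qed
  next
    fix \<pp> assume s: "\<pp> \<in> set \<pp>s"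
    then have p: "\<pp> \<in> fin_places" using ps by blast
    have "real (idx integers \<pp>) ^ count (mset \<pp>s) \<pp> > 1"
      using idx_fin_place_ge_2[OF p] s by (intro one_less_power) auto
    then show "\<pp> \<in> {\<pp> \<in> fin_places. fin_abs \<pp> a \<noteq> 1}" using p by (auto simp: val)
  qed
  show "finite {\<pp> \<in> fin_places. fin_abs \<pp> a \<noteq> 1}" unfolding eq by simp
  have "real (norm_idx a) = (\<Prod>\<pp>\<in>set \<pp>s. real (idx integers \<pp>) ^ count (mset \<pp>s) \<pp>)"
  proof -
    have "norm_idx a = prod_list (map (idx integers) \<pp>s)"
      using idx_iprod[OF ps(1)] ps(2) by (simp add: norm_idx_def)
    also have "\<dots> = prod_mset (image_mset (idx integers) (mset \<pp>s))"
      by (simp flip: mset_map add: prod_mset_prod_list)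
    also have "\<dots> = (\<Prod>\<pp>\<in>set \<pp>s. idx integers \<pp> ^ count (mset \<pp>s) \<pp>)"
      by (simp add: image_prod_mset_multiplicity)
    finally show ?thesis by simp
  qed
  moreover assume A: "finite A" "A \<subseteq> fin_places" "{\<pp> \<in> fin_places. fin_abs \<pp> a \<noteq> 1} \<subseteq> A"
  have "(\<Prod>\<pp>\<in>A. fin_abs \<pp> a) = (\<Prod>\<pp>\<in>set \<pp>s. fin_abs \<pp> a)"
    using A unfolding eq by (intro prod.mono_neutral_right) (auto simp flip: eq)
  moreover have "\<dots> = (\<Prod>\<pp>\<in>set \<pp>s. inverse (real (idx integers \<pp>) ^ count (mset \<pp>s) \<pp>))"
    using ps(1) by (intro prod.cong) (auto simp: val)
  ultimately show "(\<Prod>\<pp>\<in>A. fin_abs \<pp> a) = inverse (real (norm_idx a))"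
    by (simp add: prod_inversef[symmetric] o_def)
qed

lemma finite_fin_abs_neq_1:
  assumes "x \<noteq> 0"
  shows "finite {\<pp> \<in> fin_places. fin_abs \<pp> x \<noteq> 1}"
proof -
  obtain a b where a: "algebraic_int a" "a \<noteq> 0" and b: "algebraic_int b" "b \<noteq> 0" and x: "x = a / b"
    by (rule integral_fraction[OF assms])
  have "{\<pp> \<in> fin_places. fin_abs \<pp> x \<noteq> 1}
      \<subseteq> {\<pp> \<in> fin_places. fin_abs \<pp> a \<noteq> 1} \<union> {\<pp> \<in> fin_places. fin_abs \<pp> b \<noteq> 1}"
    by (auto simp: x divide_inverse fin_abs_mult fin_abs_inverse)
  then show ?thesis using prod_fin_abs_int(1)[OF a] prod_fin_abs_int(1)[OF b] by (meson finite_UnI finite_subset)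
qed

theorem product_formula:
  fixes x :: "'k::number_field"
  assumes x: "x \<noteq> 0" and A: "finite A" "A \<subseteq> fin_places" "{\<pp> \<in> fin_places. fin_abs \<pp> x \<noteq> 1} \<subseteq> A"
  shows "(\<Prod>\<sigma>\<in>embeddings. cmod (\<sigma> x)) * (\<Prod>\<pp>\<in>A. fin_abs \<pp> x) = 1"
proof -
  obtain a b where a: "algebraic_int a" "a \<noteq> 0" and b: "algebraic_int b" "b \<noteq> 0" and ab: "x = a / b"
    by (rule integral_fraction[OF x])
  \<comment> \<open>One finite set of places outside of which \<open>x\<close>, \<open>a\<close> and
    \<open>b\<close> all have absolute value 1, so that their products multiply factor by
    factor.\<close>
  define B where "B = A \<union> {\<pp> \<in> fin_places. fin_abs \<pp> a \<noteq> 1} \<union> {\<pp> \<in> fin_places. fin_abs \<pp> b \<noteq> 1}"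
  have B: "finite B" "B \<subseteq> fin_places" using A prod_fin_abs_int(1)[OF a] prod_fin_abs_int(1)[OF b] by (auto simp: B_def)
  have one: "norm_emb c * (\<Prod>\<pp>\<in>B. fin_abs \<pp> c) = 1"
    if c: "algebraic_int c" "c \<noteq> 0" "{\<pp> \<in> fin_places. fin_abs \<pp> c \<noteq> 1} \<subseteq> B" for c
    using prod_fin_abs_int(2)[OF c(1,2) B c(3)] norm_idx_eq_norm_emb[OF c(1,2)] norm_emb_pos[OF c(2)] by simp
  have 1: "norm_emb a * (\<Prod>\<pp>\<in>B. fin_abs \<pp> a) = 1" "norm_emb b * (\<Prod>\<pp>\<in>B. fin_abs \<pp> b) = 1"
    using one a b by (auto simp: B_def)
  have "x * b = a" using ab b by simp
  then have e: "norm_emb x * norm_emb b = norm_emb a" by (metis norm_emb_mult)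
  have f: "(\<Prod>\<pp>\<in>B. fin_abs \<pp> x) * (\<Prod>\<pp>\<in>B. fin_abs \<pp> b) = (\<Prod>\<pp>\<in>B. fin_abs \<pp> a)"
    unfolding prod.distrib[symmetric] \<open>x * b = a\<close>[symmetric]
    using B(2) by (intro prod.cong) (auto simp: fin_abs_mult)
  have "(norm_emb x * (\<Prod>\<pp>\<in>B. fin_abs \<pp> x)) * (norm_emb b * (\<Prod>\<pp>\<in>B. fin_abs \<pp> b)) = 1"
    using 1 e f by (metis mult.assoc mult.left_commute)
  then have "norm_emb x * (\<Prod>\<pp>\<in>B. fin_abs \<pp> x) = 1" using 1 by simp
  moreover have "(\<Prod>\<pp>\<in>B. fin_abs \<pp> x) = (\<Prod>\<pp>\<in>A. fin_abs \<pp> x)"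
    using A B by (intro prod.mono_neutral_right) (auto simp: B_def)
  ultimately show ?thesis by (simp add: norm_emb_def)
qed

section \<open>Heights\<close>

lemma field_degree_pos: "field_degree TYPE('k::number_field) > 0"
proof -
  obtain B :: "'k set" where B: "finite B" "Q.span B = UNIV" "card B = field_degree TYPE('k)"
    using finite_Q_basis by metis
  have "B \<noteq> {}"
  proof
    assume "B = {}"
    then have "(1::'k) \<in> {0}" using B(2) Q.span_empty by blast
    then show False by simp
  qed
  then show ?thesis using B by (metis card_gt_0_iff)
qed

lemma max_abs_ge: "f (x $ i) \<le> max_abs f x"
  unfolding max_abs_def by (rule Max_ge) auto

lemma max_abs_attained: "\<exists>i. max_abs f x = f (x $ i)"
proof -
  have "Max (range (\<lambda>i. f (x $ i))) \<in> range (\<lambda>i. f (x $ i))" by (rule Max_in) auto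
  then show ?thesis unfolding max_abs_def by (rule rangeE) blast
qed

lemma max_abs_le: "(\<And>i. f (x $ i) \<le> c) \<Longrightarrow> max_abs f x \<le> c"
  using max_abs_attained[of f x] by auto

lemma max_abs_scale:
  assumes "\<And>y. f (c * y) = f c * f y" "f c \<ge> 0"
  shows "max_abs f (c *s x) = f c * max_abs f x"
proof (rule antisym)
  show "max_abs f (c *s x) \<le> f c * max_abs f x"
    by (rule max_abs_le) (simp add: assms mult_left_mono max_abs_ge)
  obtain i where "max_abs f x = f (x $ i)" using max_abs_attained by blast
  then have "f c * max_abs f x = f ((c *s x) $ i)" using assms by simp
  then show "f c * max_abs f x \<le> max_abs f (c *s x)" using max_abs_ge[of f "c *s x" i] by simp
qed

lemma max_abs_nonneg: "(\<And>t. f t \<ge> 0) \<Longrightarrow> max_abs f x \<ge> 0"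
  using max_abs_attained[of f x] by auto

definition arch_max :: "('k::number_field \<Rightarrow> complex) \<Rightarrow> 'k ^ 'm \<Rightarrow> real" where
  "arch_max \<sigma> x = max_abs (\<lambda>t. cmod (\<sigma> t)) x"

definition fin_max :: "'k::number_field set \<Rightarrow> 'k ^ 'm \<Rightarrow> real" where
  "fin_max \<pp> x = max_abs (fin_abs \<pp>) x"

text \<open>The \<open>d\<close>-th power of the height, with \<open>d\<close> the degree; most
  estimates are made before the root is taken.\<close>

definition hprod :: "'k::number_field ^ 'm \<Rightarrow> real" where
  "hprod x = (\<Prod>\<sigma>\<in>embeddings. arch_max \<sigma> x) *
     (\<Prod>\<pp>\<in>{\<pp>\<in>fin_places. fin_max \<pp> x \<noteq> 1}. fin_max \<pp> x)"

lemma height_vec_hprod: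
  fixes x :: "'k::number_field ^ 'm"
  shows "height_vec x = hprod x powr (1 / real (field_degree TYPE('k)))"
  by (simp add: height_vec_def hprod_def arch_max_def fin_max_def)

lemma vec_nonzero_coord: "x \<noteq> 0 \<Longrightarrow> \<exists>i. x $ i \<noteq> 0"
  by (auto simp: vec_eq_iff)

lemma arch_max_ge: "cmod (\<sigma> (x $ i)) \<le> arch_max \<sigma> x"
  unfolding arch_max_def by (rule max_abs_ge)

lemma fin_max_ge: "fin_abs \<pp> (x $ i) \<le> fin_max \<pp> x"
  unfolding fin_max_def by (rule max_abs_ge)

lemma arch_max_pos:
  assumes "\<sigma> \<in> embeddings" "x \<noteq> 0"
  shows "arch_max \<sigma> x > 0"
proof -
  obtain i where "x $ i \<noteq> 0" using vec_nonzero_coord[OF assms(2)] by blast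
  then have "cmod (\<sigma> (x $ i)) > 0" using assms(1) by (simp add: embedding_eq_0_iff)
  then show ?thesis using arch_max_ge[of \<sigma> x i] by linarith
qed

lemma fin_max_pos:
  assumes "\<pp> \<in> fin_places" "x \<noteq> 0"
  shows "fin_max \<pp> x > 0"
proof -
  obtain i where "x $ i \<noteq> 0" using vec_nonzero_coord[OF assms(2)] by blast
  then show ?thesis using fin_abs_pos[OF assms(1), of "x $ i"] fin_max_ge[of \<pp> x i] by linarith
qed

lemma arch_max_scale: "\<sigma> \<in> embeddings \<Longrightarrow> arch_max \<sigma> (c *s x) = cmod (\<sigma> c) * arch_max \<sigma> x"
  unfolding arch_max_def by (rule max_abs_scale) (auto simp: embedding_mult norm_mult)

lemma fin_max_scale: "\<pp> \<in> fin_places \<Longrightarrow> fin_max \<pp> (c *s x) = fin_abs \<pp> c * fin_max \<pp> x"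
  unfolding fin_max_def by (rule max_abs_scale) (auto simp: fin_abs_mult)

lemma finite_fin_max_neq_1:
  fixes x :: "'k::number_field ^ 'm"
  assumes "x \<noteq> 0"
  shows "finite {\<pp> \<in> fin_places. fin_max \<pp> x \<noteq> 1}"
proof (rule finite_subset)
  show "finite (\<Union>i\<in>{i. x $ i \<noteq> 0}. {\<pp> \<in> fin_places. fin_abs \<pp> (x $ i) \<noteq> 1})"
    by (intro finite_UN_I finite_fin_abs_neq_1) auto
  show "{\<pp> \<in> fin_places. fin_max \<pp> x \<noteq> 1}
      \<subseteq> (\<Union>i\<in>{i. x $ i \<noteq> 0}. {\<pp> \<in> fin_places. fin_abs \<pp> (x $ i) \<noteq> 1})"
  proof
    fix \<pp> assume p: "\<pp> \<in> {\<pp> \<in> fin_places. fin_max \<pp> x \<noteq> 1}"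
    obtain i where i: "fin_max \<pp> x = fin_abs \<pp> (x $ i)" using max_abs_attained unfolding fin_max_def by blast
    have "fin_max \<pp> x > 0" using fin_max_pos[OF _ assms] p by simp
    then have "x $ i \<noteq> 0" using i by auto
    then show "\<pp> \<in> (\<Union>i\<in>{i. x $ i \<noteq> 0}. {\<pp> \<in> fin_places. fin_abs \<pp> (x $ i) \<noteq> 1})" using p i by auto
  qed
qed

lemma hprod_eq:
  assumes "finite A" "A \<subseteq> fin_places" "{\<pp> \<in> fin_places. fin_max \<pp> x \<noteq> 1} \<subseteq> A"
  shows "hprod x = (\<Prod>\<sigma>\<in>embeddings. arch_max \<sigma> x) * (\<Prod>\<pp>\<in>A. fin_max \<pp> x)"
proof -
  have "(\<Prod>\<pp>\<in>{\<pp>\<in>fin_places. fin_max \<pp> x \<noteq> 1}. fin_max \<pp> x) = (\<Prod>\<pp>\<in>A. fin_max \<pp> x)"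
    using assms by (intro prod.mono_neutral_left) auto
  then show ?thesis by (simp add: hprod_def)
qed

lemma hprod_pos: "x \<noteq> 0 \<Longrightarrow> hprod x > 0"
  unfolding hprod_def by (intro mult_pos_pos prod_pos) (auto intro: arch_max_pos fin_max_pos)

lemma hprod_scale:
  fixes x :: "'k::number_field ^ 'm"
  assumes c: "c \<noteq> 0" and x: "x \<noteq> 0"
  shows "hprod (c *s x) = hprod x"
proof -
  have cx: "c *s x \<noteq> 0" using c x by (simp add: vector_mul_eq_0)
  define A where "A = {\<pp> \<in> fin_places. fin_max \<pp> x \<noteq> 1} \<union> {\<pp> \<in> fin_places. fin_max \<pp> (c *s x) \<noteq> 1}
    \<union> {\<pp> \<in> fin_places. fin_abs \<pp> c \<noteq> 1}"
  have A: "finite A" "A \<subseteq> fin_places"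
    using finite_fin_max_neq_1[OF x] finite_fin_max_neq_1[OF cx] finite_fin_abs_neq_1[OF c] by (auto simp: A_def)
  have "hprod (c *s x) = (\<Prod>\<sigma>\<in>embeddings. arch_max \<sigma> (c *s x)) * (\<Prod>\<pp>\<in>A. fin_max \<pp> (c *s x))"
    by (rule hprod_eq[OF A]) (auto simp: A_def)
  also have "(\<Prod>\<sigma>\<in>embeddings. arch_max \<sigma> (c *s x)) = (\<Prod>\<sigma>\<in>embeddings. cmod (\<sigma> c) * arch_max \<sigma> x)"
    by (intro prod.cong) (auto simp: arch_max_scale)
  also have "(\<Prod>\<pp>\<in>A. fin_max \<pp> (c *s x)) = (\<Prod>\<pp>\<in>A. fin_abs \<pp> c * fin_max \<pp> x)"
    using A by (intro prod.cong) (auto simp: fin_max_scale)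
  also have "(\<Prod>\<sigma>\<in>embeddings. cmod (\<sigma> c) * arch_max \<sigma> x) * (\<Prod>\<pp>\<in>A. fin_abs \<pp> c * fin_max \<pp> x)
      = ((\<Prod>\<sigma>\<in>embeddings. cmod (\<sigma> c)) * (\<Prod>\<pp>\<in>A. fin_abs \<pp> c)) *
        ((\<Prod>\<sigma>\<in>embeddings. arch_max \<sigma> x) * (\<Prod>\<pp>\<in>A. fin_max \<pp> x))"
    by (simp add: prod.distrib mult_ac)
  also have "(\<Prod>\<sigma>\<in>embeddings. cmod (\<sigma> c)) * (\<Prod>\<pp>\<in>A. fin_abs \<pp> c) = 1"
    by (rule product_formula[OF c A]) (auto simp: A_def)
  also have "(\<Prod>\<sigma>\<in>embeddings. arch_max \<sigma> x) * (\<Prod>\<pp>\<in>A. fin_max \<pp> x) = hprod x"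
    by (rule hprod_eq[OF A, symmetric]) (auto simp: A_def)
  finally show ?thesis by simp
qed

lemma max_ge_1_if_coord_1:
  assumes "u $ i = 1"
  shows "\<sigma> \<in> embeddings \<Longrightarrow> arch_max \<sigma> u \<ge> 1" and "\<pp> \<in> fin_places \<Longrightarrow> fin_max \<pp> u \<ge> 1"
  using arch_max_ge[of \<sigma> u i] fin_max_ge[of \<pp> u i] assms by (auto simp: embedding_1 fin_abs_1)

text \<open>After scaling one coordinate to 1, each local maximum is at least 1; scaling does not
  change the product.\<close>

lemma hprod_ge_1:
  assumes "x \<noteq> 0"
  shows "hprod x \<ge> 1"
proof -
  obtain i where i: "x $ i \<noteq> 0" using vec_nonzero_coord[OF assms] by blast
  define u where "u = inverse (x $ i) *s x"
  have ui: "u $ i = 1" using i by (simp add: u_def)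
  have "(\<Prod>\<sigma>\<in>embeddings. arch_max \<sigma> u) \<ge> 1"
    "(\<Prod>\<pp>\<in>{\<pp>\<in>fin_places. fin_max \<pp> u \<noteq> 1}. fin_max \<pp> u) \<ge> 1"
    using max_ge_1_if_coord_1[OF ui] by (auto intro!: prod_ge_1)
  then have "hprod u \<ge> 1 * 1" unfolding hprod_def by (intro mult_mono) auto
  moreover have "hprod u = hprod x" unfolding u_def using i assms by (intro hprod_scale) auto
  ultimately show ?thesis by simp
qed

lemma member_le_prod:
  fixes f :: "'a \<Rightarrow> real"
  assumes "finite A" "a \<in> A" "\<And>x. x \<in> A \<Longrightarrow> f x \<ge> 1"
  shows "f a \<le> prod f A"
proof -
  have "prod f A = f a * prod f (A - {a})" using assms by (intro prod.remove)
  moreover have "prod f (A - {a}) \<ge> 1" using assms by (intro prod_ge_1) auto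
  moreover have "f a \<ge> 0" using assms(3)[OF assms(2)] by simp
  ultimately show ?thesis using mult_left_mono[of 1 "prod f (A - {a})" "f a"] by simp
qed

text \<open>A common denominator of the coordinates divides the product of the finite parts of the
  height, so it is bounded, and so are the conjugates of the resulting algebraic integers.\<close>

theorem northcott:
  fixes B :: real
  shows "finite {u :: 'k::number_field ^ 'm. (\<exists>i. u $ i = 1) \<and> hprod u \<le> B}"
proof -
  \<comment> \<open>The members of \<open>E\<close> are the numerators \<open>m * u $ j\<close>: the
    denominator \<open>m\<close> and the conjugates of \<open>u $ j\<close> are each at most
    \<open>B\<close>.\<close>
  define E where "E = {e \<in> (integers :: 'k set). \<forall>\<sigma>\<in>embeddings. cmod (\<sigma> e) \<le> B * B}"
  define T where "T = (\<lambda>(e, m). e / of_nat m) ` (E \<times> {..nat \<lfloor>B\<rfloor>})"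
  have finT: "finite T" unfolding T_def E_def using finite_bounded_integers by blast
  have sub: "{u :: 'k ^ 'm. (\<exists>i. u $ i = 1) \<and> hprod u \<le> B} \<subseteq> (\<lambda>f. \<chi> i. f i) ` (PiE UNIV (\<lambda>_. T))"
  proof
    fix u :: "'k ^ 'm" assume "u \<in> {u. (\<exists>i. u $ i = 1) \<and> hprod u \<le> B}"
    then obtain i where ui: "u $ i = 1" and uB: "hprod u \<le> B" by blast
    have u0: "u \<noteq> 0" using ui by auto
    define A where "A = {\<pp> \<in> fin_places. fin_max \<pp> u \<noteq> 1}"
    have A: "finite A" "A \<subseteq> fin_places" using finite_fin_max_neq_1[OF u0] by (auto simp: A_def)
    note ge = max_ge_1_if_coord_1[OF ui]
    have pa: "(\<Prod>\<sigma>\<in>embeddings. arch_max \<sigma> u) \<ge> 1" using ge by (intro prod_ge_1) auto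
    have pf: "(\<Prod>\<pp>\<in>A. fin_max \<pp> u) \<ge> 1" using ge A by (intro prod_ge_1) auto
    have h: "hprod u = (\<Prod>\<sigma>\<in>embeddings. arch_max \<sigma> u) * (\<Prod>\<pp>\<in>A. fin_max \<pp> u)" by (simp add: hprod_def A_def)
    have paB: "(\<Prod>\<sigma>\<in>embeddings. arch_max \<sigma> u) \<le> B"
      using mult_left_mono[OF pf, of "\<Prod>\<sigma>\<in>embeddings. arch_max \<sigma> u"] pa h uB by linarith
    have pfB: "(\<Prod>\<pp>\<in>A. fin_max \<pp> u) \<le> B"
      using mult_right_mono[OF pa, of "\<Prod>\<pp>\<in>A. fin_max \<pp> u"] pf h uB by linarith
    have "\<exists>e. fin_max \<pp> u = real (idx integers \<pp>) ^ e" if p: "\<pp> \<in> fin_places" for \<pp>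
    proof -
      obtain j where "fin_max \<pp> u = fin_abs \<pp> (u $ j)" using max_abs_attained unfolding fin_max_def by blast
      then show ?thesis using fin_abs_ge_1[OF p, of "u $ j"] ge(2)[OF p] by metis
    qed
    then obtain e where e: "\<And>\<pp>. \<pp> \<in> fin_places \<Longrightarrow> fin_max \<pp> u = real (idx integers \<pp>) ^ e \<pp>" by metis
    \<comment> \<open>Every local maximum is at least 1, hence a power of the residue cardinality,
      and \<open>m\<close> is the whole finite part of the height.\<close>
    define m where "m = (\<Prod>\<pp>\<in>A. idx integers \<pp> ^ e \<pp>)"
    have m_eq: "real m = (\<Prod>\<pp>\<in>A. fin_max \<pp> u)" unfolding m_def using A by (simp add: e subset_iff)
    have m: "real m \<le> B" "m > 0" using pfB pf m_eq by auto
    have mk: "(of_nat m :: 'k) = (\<Prod>\<pp>\<in>A. of_nat (idx integers \<pp>) ^ e \<pp>)" by (simp add: m_def)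
    have muj: "algebraic_int (of_nat m * u $ j)" for j
    proof (rule integral_if_fin_abs_le_1)
      fix \<qq> :: "'k set" assume q: "\<qq> \<in> fin_places"
      have uj: "fin_abs \<qq> (u $ j) \<le> fin_max \<qq> u" by (rule fin_max_ge)
      have le1: "fin_abs \<qq> (of_nat (idx integers \<pp>) ^ e \<pp>) \<le> 1" for \<pp> :: "'k set"
        using fin_abs_le_1[OF q, of "of_nat (idx integers \<pp>)"] by (simp add: fin_abs_power[OF q] power_le_one)
      show "fin_abs \<qq> (of_nat m * u $ j) \<le> 1"
      proof (cases "\<qq> \<in> A")
        case True
        have N: "idx integers \<qq> \<ge> 2" by (rule idx_fin_place_ge_2[OF q])
        \<comment> \<open>Only the factor of \<open>m\<close> that belongs to \<open>\<qq>\<close>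
          is needed to absorb the denominator; the others are integers and cannot enlarge the
          value.\<close>
        have "fin_abs \<qq> (of_nat m) = fin_abs \<qq> (of_nat (idx integers \<qq>) ^ e \<qq>) *
            (\<Prod>\<pp>\<in>A - {\<qq>}. fin_abs \<qq> (of_nat (idx integers \<pp>) ^ e \<pp>))"
          unfolding mk fin_abs_prod[OF q] using A True by (intro prod.remove)
        also have "\<dots> \<le> fin_abs \<qq> (of_nat (idx integers \<qq>) ^ e \<qq>) * 1"
          using le1 by (intro mult_left_mono prod_le_1) auto
        also have "\<dots> \<le> inverse (real (idx integers \<qq>)) ^ e \<qq>"
          unfolding fin_abs_power[OF q] mult_1_right by (intro power_mono fin_abs_idx_le q) auto
        finally have "fin_abs \<qq> (of_nat m) * fin_abs \<qq> (u $ j)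
            \<le> inverse (real (idx integers \<qq>)) ^ e \<qq> * real (idx integers \<qq>) ^ e \<qq>"
          using uj e[OF q] by (intro mult_mono) auto
        also have "\<dots> = 1" using N by (simp flip: power_mult_distrib)
        finally show ?thesis by (simp add: fin_abs_mult[OF q])
      next
        case False
        then have "fin_max \<qq> u = 1" using q by (simp add: A_def)
        then have "fin_abs \<qq> (of_nat m) * fin_abs \<qq> (u $ j) \<le> 1"
          using uj fin_abs_le_1[OF q, of "of_nat m"] by (intro mult_le_one) auto
        then show ?thesis by (simp add: fin_abs_mult[OF q])
      qed
    qed
    have "cmod (\<sigma> (of_nat m * u $ j)) \<le> B * B" if s: "\<sigma> \<in> embeddings" for \<sigma> j
    proof -
      have "cmod (\<sigma> (u $ j)) \<le> arch_max \<sigma> u" by (rule arch_max_ge)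
      also have "\<dots> \<le> (\<Prod>\<sigma>\<in>embeddings. arch_max \<sigma> u)" by (rule member_le_prod[OF finite_embeddings s ge(1)])
      finally have "cmod (\<sigma> (u $ j)) \<le> B" using paB by simp
      then show ?thesis using m s by (auto simp: embedding_mult embedding_of_nat norm_mult intro!: mult_mono)
    qed
    then have "of_nat m * u $ j \<in> E" for j using muj by (simp add: E_def)
    moreover have "m \<in> {..nat \<lfloor>B\<rfloor>}" using m by (simp add: le_nat_floor)
    ultimately have "(\<lambda>(e, m). e / of_nat m) (of_nat m * u $ j, m) \<in> T" for j unfolding T_def by blast
    then have "u $ j \<in> T" for j using m by simp
    then show "u \<in> (\<lambda>f. \<chi> i. f i) ` (PiE UNIV (\<lambda>_. T))"
      by (intro image_eqI[of _ _ "\<lambda>i. u $ i"]) (auto simp: vec_eq_iff)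
  qed
  show ?thesis by (rule finite_subset[OF sub]) (intro finite_imageI finite_PiE finT, simp)
qed

section \<open>Points, lines and distances\<close>

lemma proj_point_nonzero:
  assumes "Q \<in> proj_points"
  shows "\<exists>x\<in>Q. x \<noteq> 0"
proof (rule ccontr)
  assume "\<not> ?thesis"
  then have "Q \<subseteq> vec.span {}" by auto
  then have "vec.dim Q \<le> card ({} :: ('a ^ 'b) set)" by (rule vec.dim_le_card) simp
  moreover have "vec.dim Q = 1" using assms by (simp add: proj_points_def)
  ultimately show False unfolding card.empty by linarith
qed

lemma coords_mem:
  assumes "Q \<in> proj_points"
  shows "coords Q \<in> Q" "coords Q \<noteq> 0"
proof -
  have "\<exists>x. x \<in> Q \<and> x \<noteq> 0" using proj_point_nonzero[OF assms] by blast
  from someI_ex[OF this] show "coords Q \<in> Q" "coords Q \<noteq> 0" by (simp_all add: coords_def)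
qed

lemma proj_point_eq_span:
  assumes Q: "Q \<in> proj_points" and x: "x \<in> Q" "x \<noteq> 0"
  shows "Q = vec.span {x}"
proof
  have i: "vec.independent {x}" using x(2) by simp
  show "Q \<subseteq> vec.span {x}"
    using Q x(1) i by (intro vec.card_ge_dim_independent) (auto simp: proj_points_def)
  show "vec.span {x} \<subseteq> Q" using Q x(1) by (intro vec.span_minimal) (auto simp: proj_points_def)
qed

lemma span_in_proj_points: "x \<noteq> 0 \<Longrightarrow> vec.span {x} \<in> proj_points"
  using vec.dim_span_eq_card_independent[of "{x}"] by (simp add: proj_points_def vec.subspace_span)

lemma proj_point_scale:
  assumes "Q \<in> proj_points" "x \<in> Q" "x \<noteq> 0"
  obtains c where "c \<noteq> 0" "coords Q = c *s x"
proof -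
  have "coords Q \<in> vec.span {x}" using coords_mem(1) proj_point_eq_span assms by blast
  then obtain c where c: "coords Q = c *s x" by (auto simp: vec.span_singleton)
  then show ?thesis using that coords_mem(2)[OF assms(1)] by (cases "c = 0") auto
qed

lemma height_eq_hprod:
  fixes Q :: "('k::number_field ^ 'n) set"
  assumes "Q \<in> proj_points" "x \<in> Q" "x \<noteq> 0"
  shows "height Q ^ field_degree TYPE('k) = hprod x" "height Q > 0"
proof -
  obtain c where c: "c \<noteq> 0" "coords Q = c *s x" by (rule proj_point_scale[OF assms])
  have h: "height Q = hprod x powr (1 / real (field_degree TYPE('k)))"
    by (simp add: height_def height_vec_hprod c(2) hprod_scale[OF c(1) assms(3)])
  have pos: "hprod x > 0" by (rule hprod_pos[OF assms(3)])
  show "height Q > 0" using pos by (simp add: h)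
  then show "height Q ^ field_degree TYPE('k) = hprod x"
    using pos field_degree_pos[where 'k = 'k] by (simp add: h powr_powr flip: powr_realpow)
qed

text \<open>All ordered pairs are used as indices, so every minor occurs twice up to sign and the
  diagonal vanishes. Maxima are unaffected, and a Euclidean norm gains the factor
  \<open>sqrt 2\<close>.\<close>

definition wedge :: "'k::number_field ^ 'n \<Rightarrow> 'k ^ 'n \<Rightarrow> 'k ^ ('n \<times> 'n)" where
  "wedge x y = (\<chi> ij. x $ fst ij * y $ snd ij - x $ snd ij * y $ fst ij)"

lemma wedge_nth: "wedge x y $ (i, j) = x $ i * y $ j - x $ j * y $ i"
  by (simp add: wedge_def)

text \<open>Since \<open>x\<close> is known, the coefficients can be read off at a coordinate where
  it is nonzero. For \<open>c = 0\<close> this says that \<open>wedge x\<close> vanishes only on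
  multiples of \<open>x\<close>.\<close>

lemma mem_span_if_wedge_eq:
  assumes x: "x \<noteq> 0" and w: "wedge x z = c *s wedge x y"
  shows "z \<in> vec.span {x, y}"
proof -
  obtain i where i: "x $ i \<noteq> 0" using vec_nonzero_coord[OF x] by blast
  have "z = ((z $ i - c * y $ i) / x $ i) *s x + c *s y"
  proof (subst vec_eq_iff, rule allI)
    fix j
    have "wedge x z $ (i, j) = c * wedge x y $ (i, j)" using w by simp
    then have "x $ i * z $ j = x $ j * z $ i + c * (x $ i * y $ j - x $ j * y $ i)"
      by (simp add: wedge_nth algebra_simps)
    then show "z $ j = (((z $ i - c * y $ i) / x $ i) *s x + c *s y) $ j"
      using i by (simp add: field_simps)
  qed
  then show ?thesis
    by (metis (no_types, lifting) insertI1 insertI2 vec.span_add vec.span_base vec.span_scale singletonI)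
qed

lemma wedge_nonzero:
  assumes "x \<noteq> 0" "y \<notin> vec.span {x}"
  shows "wedge x y \<noteq> 0"
proof
  assume "wedge x y = 0"
  then have "wedge x y = 0 *s wedge x 0" by simp
  then have "y \<in> vec.span {x, 0}" by (rule mem_span_if_wedge_eq[OF assms(1)])
  then show False using assms(2) by (simp add: insert_commute)
qed

lemma wedge_add_left: "wedge x (m *s x + y) = wedge x y"
  by (simp add: wedge_def vec_eq_iff algebra_simps)

section \<open>Chordal distance at one place and its sum over the places\<close>

definition norm2 :: "('k::field \<Rightarrow> real) \<Rightarrow> 'k ^ 'n \<Rightarrow> real" where
  "norm2 v x = sqrt (\<Sum>i\<in>UNIV. (v (x $ i))\<^sup>2)"

lemma dist_vec_norm2:
  "dist_vec v x y = norm2 v (wedge x y) / sqrt 2 / (norm2 v x * norm2 v y)"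
proof -
  have "(\<Sum>ij\<in>UNIV. (v (wedge x y $ ij))\<^sup>2) = (\<Sum>i\<in>UNIV. \<Sum>j\<in>UNIV. (v (x $ i * y $ j - x $ j * y $ i))\<^sup>2)"
    unfolding sum.cartesian_product UNIV_Times_UNIV
    by (intro sum.cong) (auto simp: wedge_nth)
  then show ?thesis by (simp add: dist_vec_def norm2_def real_sqrt_divide)
qed

lemma norm2_ge: "(\<And>t. v t \<ge> 0) \<Longrightarrow> v (x $ i) \<le> norm2 v x"
  unfolding norm2_def by (rule real_le_rsqrt) (rule member_le_sum, auto)

lemma norm2_nonneg: "norm2 v x \<ge> 0"
  by (simp add: norm2_def sum_nonneg)

lemma norm2_le:
  assumes "\<And>t. v t \<ge> 0"
  shows "norm2 v (x :: 'k::field ^ 'n) \<le> sqrt (real CARD('n)) * max_abs v x"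
proof -
  have "(\<Sum>i\<in>UNIV. (v (x $ i))\<^sup>2) \<le> (\<Sum>i\<in>(UNIV::'n set). (max_abs v x)\<^sup>2)"
    using assms by (intro sum_mono power_mono max_abs_ge)
  also have "\<dots> = real CARD('n) * (max_abs v x)\<^sup>2" by simp
  finally have "norm2 v x \<le> sqrt (real CARD('n) * (max_abs v x)\<^sup>2)" unfolding norm2_def by simp
  also have "\<dots> = sqrt (real CARD('n)) * max_abs v x"
    using max_abs_nonneg[of v x] assms by (simp add: real_sqrt_mult)
  finally show ?thesis .
qed

lemma norm2_scale:
  assumes "\<And>t. v (c * t) = v c * v t" "v c \<ge> 0"
  shows "norm2 v (c *s x) = v c * norm2 v x"
proof -
  have "(\<Sum>i\<in>UNIV. (v ((c *s x) $ i))\<^sup>2) = (v c)\<^sup>2 * (\<Sum>i\<in>UNIV. (v (x $ i))\<^sup>2)"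
    by (simp add: assms(1) power_mult_distrib sum_distrib_left)
  then show ?thesis using assms(2) by (simp add: norm2_def real_sqrt_mult)
qed

lemma wedge_scale: "wedge (a *s x) (b *s y) = (a * b) *s wedge x y"
  by (simp add: wedge_def vec_eq_iff algebra_simps)

abbreviation place :: "('k::number_field \<Rightarrow> complex) \<Rightarrow> 'k \<Rightarrow> real" where
  "place \<sigma> \<equiv> (\<lambda>t. cmod (\<sigma> t))"

lemma dist_vec_scale:
  assumes s: "\<sigma> \<in> embeddings" and ab: "a \<noteq> 0" "b \<noteq> 0"
  shows "dist_vec (place \<sigma>) (a *s x) (b *s y) = dist_vec (place \<sigma>) x y"
proof -
  have m: "cmod (\<sigma> (c * t)) = cmod (\<sigma> c) * cmod (\<sigma> t)" for c t using s by (simp add: embedding_mult norm_mult)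
  have "cmod (\<sigma> a) \<noteq> 0" "cmod (\<sigma> b) \<noteq> 0" using s ab by (auto simp: embedding_eq_0_iff)
  then show ?thesis
    by (simp add: dist_vec_norm2 wedge_scale norm2_scale m)
qed

lemma dist_vec_nonneg: "dist_vec v x y \<ge> 0"
  for x y :: "'k::number_field ^ 'n"
  by (simp add: dist_vec_norm2 norm2_nonneg)

lemma finite_arch_places: "finite (arch_places :: ('k::number_field \<Rightarrow> real) set)"
  by (simp add: arch_places_def finite_embeddings)

lemma proj_dist_ge:
  assumes s: "\<sigma> \<in> embeddings" and P: "P \<in> proj_points" "x \<in> P" "x \<noteq> 0" and Q: "Q \<in> proj_points" "y \<in> Q" "y \<noteq> 0"
  shows "dist_vec (place \<sigma>) x y \<le> proj_dist P Q"
proof -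
  obtain a where a: "a \<noteq> 0" "coords P = a *s x" by (rule proj_point_scale[OF P])
  obtain b where b: "b \<noteq> 0" "coords Q = b *s y" by (rule proj_point_scale[OF Q])
  have "dist_vec (place \<sigma>) x y = dist_vec (place \<sigma>) (coords P) (coords Q)"
    by (simp add: a b dist_vec_scale[OF s])
  also have "\<dots> \<le> proj_dist P Q" unfolding proj_dist_def
    using s by (intro member_le_sum finite_arch_places) (auto simp: arch_places_def dist_vec_nonneg)
  finally show ?thesis .
qed

text \<open>Conjugate embeddings give the same place, so the right side may count it twice; as an
  upper bound this is enough.\<close>

lemma proj_dist_le:
  assumes P: "P \<in> proj_points" "x \<in> P" "x \<noteq> 0" and Q: "Q \<in> proj_points" "y \<in> Q" "y \<noteq> 0"
  shows "proj_dist P Q \<le> (\<Sum>\<sigma>\<in>embeddings. dist_vec (place \<sigma>) x y)"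
proof -
  obtain a where a: "a \<noteq> 0" "coords P = a *s x" by (rule proj_point_scale[OF P])
  obtain b where b: "b \<noteq> 0" "coords Q = b *s y" by (rule proj_point_scale[OF Q])
  have "proj_dist P Q \<le> (\<Sum>\<sigma>\<in>embeddings. dist_vec (place \<sigma>) (coords P) (coords Q))"
    unfolding proj_dist_def arch_places_def
    using sum_image_le[OF finite_embeddings, of "\<lambda>v. dist_vec v (coords P) (coords Q)" place]
    by (auto simp: dist_vec_nonneg o_def)
  also have "\<dots> = (\<Sum>\<sigma>\<in>embeddings. dist_vec (place \<sigma>) x y)"
    by (intro sum.cong) (auto simp: a b dist_vec_scale)
  finally show ?thesis .
qed

text \<open>The norms of \<open>x\<close> and \<open>y\<close> each cost a factor
  \<open>sqrt (CARD('n))\<close> against the maximum, and \<open>sqrt 2\<close> accounts for the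
  repeated minors.\<close>

lemma dist_vec_ge:
  fixes x y :: "'k::number_field ^ 'n"
  assumes s: "\<sigma> \<in> embeddings" and x: "x \<noteq> 0" and y: "y \<noteq> 0"
  shows "arch_max \<sigma> (wedge x y) / (sqrt 2 * real CARD('n) * arch_max \<sigma> x * arch_max \<sigma> y)
    \<le> dist_vec (place \<sigma>) x y"
proof -
  define n where "n = real CARD('n)"
  have n: "n > 0" by (simp add: n_def)
  obtain ij where "arch_max \<sigma> (wedge x y) = cmod (\<sigma> (wedge x y $ ij))"
    using max_abs_attained unfolding arch_max_def by blast
  then have 1: "arch_max \<sigma> (wedge x y) \<le> norm2 (place \<sigma>) (wedge x y)"
    using norm2_ge[of "place \<sigma>" "wedge x y" ij] by simp
  have np: "norm2 (place \<sigma>) z > 0" if z: "z \<noteq> 0" for z :: "'k ^ 'n"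
  proof -
    obtain i where "z $ i \<noteq> 0" using vec_nonzero_coord[OF z] by blast
    then have "cmod (\<sigma> (z $ i)) > 0" using s by (simp add: embedding_eq_0_iff)
    moreover have "cmod (\<sigma> (z $ i)) \<le> norm2 (place \<sigma>) z" using norm2_ge[of "place \<sigma>" z i] by simp
    ultimately show ?thesis by linarith
  qed
  have "norm2 (place \<sigma>) x * norm2 (place \<sigma>) y \<le> (sqrt n * arch_max \<sigma> x) * (sqrt n * arch_max \<sigma> y)"
    unfolding n_def arch_max_def by (intro mult_mono norm2_le) (auto simp: norm2_nonneg max_abs_nonneg)
  also have "\<dots> = n * arch_max \<sigma> x * arch_max \<sigma> y" using n by simp
  finally have 2: "norm2 (place \<sigma>) x * norm2 (place \<sigma>) y \<le> n * arch_max \<sigma> x * arch_max \<sigma> y" .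
  have "arch_max \<sigma> (wedge x y) / (sqrt 2 * n * arch_max \<sigma> x * arch_max \<sigma> y)
      = arch_max \<sigma> (wedge x y) / sqrt 2 / (n * arch_max \<sigma> x * arch_max \<sigma> y)" by simp
  also have "\<dots> \<le> norm2 (place \<sigma>) (wedge x y) / sqrt 2 / (norm2 (place \<sigma>) x * norm2 (place \<sigma>) y)"
    using 1 2 np[OF x] np[OF y] arch_max_pos[OF s x] arch_max_pos[OF s y] n
    by (intro frac_le divide_right_mono) (auto simp: norm2_nonneg)
  finally show ?thesis unfolding n_def dist_vec_norm2 .
qed

lemma fin_max_nonneg: "fin_max \<pp> x \<ge> 0"
  by (simp add: fin_max_def max_abs_nonneg)

lemma fin_max_wedge:
  assumes p: "\<pp> \<in> fin_places"
  shows "fin_max \<pp> (wedge x y) \<le> fin_max \<pp> x * fin_max \<pp> y"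
proof -
  obtain i j where "fin_max \<pp> (wedge x y) = fin_abs \<pp> (wedge x y $ (i, j))"
    using max_abs_attained unfolding fin_max_def by (metis prod.exhaust)
  also have "\<dots> \<le> max (fin_abs \<pp> (x $ i * y $ j)) (fin_abs \<pp> (x $ j * y $ i))"
    unfolding wedge_nth by (rule fin_abs_diff[OF p])
  also have "\<dots> \<le> fin_max \<pp> x * fin_max \<pp> y"
    unfolding fin_abs_mult[OF p] by (intro max.boundedI mult_mono fin_max_ge)
      (auto intro: order_trans[OF fin_abs_nonneg fin_max_ge])
  finally show ?thesis .
qed

text \<open>\<open>wedge x y\<close> is the vector of Pluecker coordinates of the line joining the two points.\<close>

lemma hprod_wedge_le:
  fixes P Q :: "('k::number_field ^ 'n) set"
  assumes P: "P \<in> proj_points" "x \<in> P" "x \<noteq> 0" and Q: "Q \<in> proj_points" "y \<in> Q" "y \<noteq> 0"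
    and w: "wedge x y \<noteq> 0"
  shows "hprod (wedge x y) \<le> (sqrt 2 * real CARD('n)) ^ field_degree TYPE('k) * hprod x *
    (proj_dist P Q * height Q) ^ field_degree TYPE('k)"
proof -
  let ?d = "field_degree TYPE('k)"
  define K where "K = sqrt 2 * real CARD('n)"
  have K: "K > 0" by (simp add: K_def)
  define A where "A = {\<pp> \<in> fin_places. fin_max \<pp> x \<noteq> 1} \<union> {\<pp> \<in> fin_places. fin_max \<pp> y \<noteq> 1}
    \<union> {\<pp> \<in> fin_places. fin_max \<pp> (wedge x y) \<noteq> 1}"
  have A: "finite A" "A \<subseteq> fin_places"
    using finite_fin_max_neq_1[OF P(3)] finite_fin_max_neq_1[OF Q(3)] finite_fin_max_neq_1[OF w]
    by (auto simp: A_def)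
  have hx: "hprod x = (\<Prod>\<sigma>\<in>embeddings. arch_max \<sigma> x) * (\<Prod>\<pp>\<in>A. fin_max \<pp> x)"
    and hy: "hprod y = (\<Prod>\<sigma>\<in>embeddings. arch_max \<sigma> y) * (\<Prod>\<pp>\<in>A. fin_max \<pp> y)"
    and hw: "hprod (wedge x y) = (\<Prod>\<sigma>\<in>embeddings. arch_max \<sigma> (wedge x y)) * (\<Prod>\<pp>\<in>A. fin_max \<pp> (wedge x y))"
    by (rule hprod_eq[OF A], force simp: A_def)+
  have pos: "(\<Prod>\<sigma>\<in>embeddings. arch_max \<sigma> z) > 0" if "z \<noteq> 0" for z :: "'k ^ 'm"
    using arch_max_pos that by (intro prod_pos) auto
  \<comment> \<open>Every local distance is at most the total one, so the product over the
    embeddings produces its \<open>d\<close>-th power.\<close>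
  have "(\<Prod>\<sigma>\<in>embeddings. arch_max \<sigma> (wedge x y))
      \<le> (\<Prod>\<sigma>\<in>embeddings. K * arch_max \<sigma> x * arch_max \<sigma> y * proj_dist P Q)"
  proof (rule prod_mono)
    fix \<sigma> :: "'k \<Rightarrow> complex" assume s: "\<sigma> \<in> embeddings"
    have "arch_max \<sigma> (wedge x y) / (K * arch_max \<sigma> x * arch_max \<sigma> y) \<le> proj_dist P Q"
      unfolding K_def using dist_vec_ge[OF s P(3) Q(3)] proj_dist_ge[OF s P Q] by linarith
    moreover have "K * arch_max \<sigma> x * arch_max \<sigma> y > 0"
      by (intro mult_pos_pos K arch_max_pos s P(3) Q(3))
    ultimately have "arch_max \<sigma> (wedge x y) \<le> K * arch_max \<sigma> x * arch_max \<sigma> y * proj_dist P Q"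
      by (simp add: divide_le_eq mult.commute)
    then show "0 \<le> arch_max \<sigma> (wedge x y) \<and>
        arch_max \<sigma> (wedge x y) \<le> K * arch_max \<sigma> x * arch_max \<sigma> y * proj_dist P Q"
      using arch_max_pos[OF s w] by simp
  qed
  also have "\<dots> = K ^ ?d * (\<Prod>\<sigma>\<in>embeddings. arch_max \<sigma> x) * (\<Prod>\<sigma>\<in>embeddings. arch_max \<sigma> y) * proj_dist P Q ^ ?d"
    by (simp add: prod.distrib card_embeddings)
  finally have arch: "(\<Prod>\<sigma>\<in>embeddings. arch_max \<sigma> (wedge x y))
      \<le> K ^ ?d * (\<Prod>\<sigma>\<in>embeddings. arch_max \<sigma> x) * (\<Prod>\<sigma>\<in>embeddings. arch_max \<sigma> y) * proj_dist P Q ^ ?d" .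
  have "(\<Prod>\<pp>\<in>A. fin_max \<pp> (wedge x y)) \<le> (\<Prod>\<pp>\<in>A. fin_max \<pp> x * fin_max \<pp> y)"
    using A fin_max_wedge fin_max_nonneg by (intro prod_mono) blast
  then have fin: "(\<Prod>\<pp>\<in>A. fin_max \<pp> (wedge x y)) \<le> (\<Prod>\<pp>\<in>A. fin_max \<pp> x) * (\<Prod>\<pp>\<in>A. fin_max \<pp> y)"
    by (simp add: prod.distrib)
  have fw: "(\<Prod>\<pp>\<in>A. fin_max \<pp> (wedge x y)) \<ge> 0"
    by (intro prod_nonneg fin_max_nonneg)
  have "hprod (wedge x y) \<le> (K ^ ?d * (\<Prod>\<sigma>\<in>embeddings. arch_max \<sigma> x) * (\<Prod>\<sigma>\<in>embeddings. arch_max \<sigma> y) * proj_dist P Q ^ ?d)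
      * ((\<Prod>\<pp>\<in>A. fin_max \<pp> x) * (\<Prod>\<pp>\<in>A. fin_max \<pp> y))"
    unfolding hw using arch fin fw pos[OF w] by (intro mult_mono) auto
  also have "\<dots> = K ^ ?d * hprod x * (proj_dist P Q ^ ?d * hprod y)" by (simp add: hx hy mult_ac)
  also have "hprod y = height Q ^ ?d" using height_eq_hprod(1)[OF Q] by simp
  finally show ?thesis by (simp add: K_def power_mult_distrib)
qed

section \<open>Lines are curves\<close>

lemma homogeneous_poly_scale: "homogeneous_poly d f \<Longrightarrow> f (c *s x) = c ^ d * f x"
  by (induction rule: homogeneous_poly.induct) (auto simp: algebra_simps power_add)

lemma homogeneous_poly_along_line:
  "homogeneous_poly d f \<Longrightarrow> \<exists>p. \<forall>t. f (u + t *s v) = poly p t"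
proof (induction rule: homogeneous_poly.induct)
  case (const c)
  show ?case by (rule exI[of _ "[:c:]"]) simp
next
  case (coord i)
  show ?case by (rule exI[of _ "[:u $ i, v $ i:]"]) simp
next
  case (add d f g)
  then obtain p q where "\<forall>t. f (u + t *s v) = poly p t" "\<forall>t. g (u + t *s v) = poly q t" by blast
  then show ?case by (intro exI[of _ "p + q"]) simp
next
  case (mult d f e g)
  then obtain p q where "\<forall>t. f (u + t *s v) = poly p t" "\<forall>t. g (u + t *s v) = poly q t" by blast
  then show ?case by (intro exI[of _ "p * q"]) simp
qed

lemma homogeneous_poly_monomial: "homogeneous_poly 1 (\<lambda>x. c * x $ i)"
  using homogeneous_poly.mult[OF homogeneous_poly.const homogeneous_poly.coord] by simp

lemma zariski_closed_Un:
  fixes A B :: "('k::field ^ 'n) set set"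
  assumes "zariski_closed A" "zariski_closed B"
  shows "zariski_closed (A \<union> B)"
proof -
  obtain F where F: "\<forall>f\<in>F. \<exists>d. homogeneous_poly d f" "A = {Q \<in> proj_points. \<forall>f\<in>F. \<forall>x\<in>Q. f x = 0}"
    using assms(1) unfolding zariski_closed_def by blast
  obtain G where G: "\<forall>f\<in>G. \<exists>d. homogeneous_poly d f" "B = {Q \<in> proj_points. \<forall>f\<in>G. \<forall>x\<in>Q. f x = 0}"
    using assms(2) unfolding zariski_closed_def by blast
  define H where "H = (\<lambda>(f, g) x. f x * g x) ` (F \<times> G)"
  have "\<forall>f\<in>H. \<exists>d. homogeneous_poly d f"
  proof
    fix h assume "h \<in> H"
    then obtain f g where fg: "f \<in> F" "g \<in> G" "h = (\<lambda>x. f x * g x)" by (auto simp: H_def)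
    then obtain d e where "homogeneous_poly d f" "homogeneous_poly e g" using F(1) G(1) by blast
    then show "\<exists>d. homogeneous_poly d h" unfolding fg(3) using homogeneous_poly.mult by blast
  qed
  moreover have "A \<union> B = {Q \<in> proj_points. \<forall>f\<in>H. \<forall>x\<in>Q. f x = 0}"
  proof (intro equalityI subsetI)
    fix Q assume "Q \<in> A \<union> B"
    then show "Q \<in> {Q \<in> proj_points. \<forall>f\<in>H. \<forall>x\<in>Q. f x = 0}" by (auto simp: F(2) G(2) H_def)
  next
    fix Q assume Q: "Q \<in> {Q \<in> proj_points. \<forall>f\<in>H. \<forall>x\<in>Q. f x = 0}"
    show "Q \<in> A \<union> B"
    proof (rule ccontr)
      assume "Q \<notin> A \<union> B"
      then obtain f x g y where f: "f \<in> F" "x \<in> Q" "f x \<noteq> 0" and g: "g \<in> G" "y \<in> Q" "g y \<noteq> 0"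
        using Q by (auto simp: F(2) G(2))
      obtain d e where d: "homogeneous_poly d f" and e: "homogeneous_poly e g" using F(1) G(1) f g by blast
      have Qp: "Q \<in> proj_points" using Q by simp
      \<comment> \<open>The two polynomials may be nonzero at different vectors of \<open>Q\<close>;
        homogeneity moves both to one generator.\<close>
      obtain z where z: "z \<in> Q" "z \<noteq> 0" using proj_point_nonzero[OF Qp] by blast
      have "Q = vec.span {z}" by (rule proj_point_eq_span[OF Qp z])
      then obtain a b where "x = a *s z" "y = b *s z" using f(2) g(2) by (auto simp: vec.span_singleton)
      then have "f z \<noteq> 0" "g z \<noteq> 0"
        using f(3) g(3) homogeneous_poly_scale[OF d] homogeneous_poly_scale[OF e] by auto
      moreover have h: "(\<lambda>x. f x * g x) \<in> H"
        unfolding H_def using f(1) g(1) by (intro image_eqI[of _ _ "(f, g)"]) auto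
      have "\<forall>h\<in>H. \<forall>x\<in>Q. h x = 0" using Q by simp
      from this[rule_format, OF h z(1)] have "f z * g z = 0" .
      ultimately show False by simp
    qed
  qed
  ultimately show ?thesis unfolding zariski_closed_def by (intro exI[of _ H] conjI)
qed

lemma zariski_closed_empty: "zariski_closed ({} :: ('k::field ^ 'n) set set)"
proof -
  have "{Q \<in> proj_points. \<forall>f\<in>{\<lambda>_. 1}. \<forall>x\<in>Q. f x = (0::'k)} = ({} :: ('k ^ 'n) set set)"
    using proj_point_nonzero by fastforce
  moreover have "\<forall>f\<in>{\<lambda>_::'k ^ 'n. 1::'k}. \<exists>d. homogeneous_poly d f"
    using homogeneous_poly.const by blast
  ultimately show ?thesis unfolding zariski_closed_def by blast
qed

lemma zariski_closed_singleton:
  assumes P: "P \<in> proj_points"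
  shows "zariski_closed {P}"
proof -
  obtain x where x: "x \<in> P" "x \<noteq> 0" using proj_point_nonzero[OF P] by blast
  obtain i where i: "x $ i \<noteq> 0" using x(2) by (auto simp: vec_eq_iff)
  \<comment> \<open>The minors of \<open>x\<close> and \<open>z\<close> that involve coordinate
    \<open>i\<close>; they suffice because \<open>x $ i\<close> is nonzero. The sum form fits the
    rules of \<open>homogeneous_poly\<close>.\<close>
  define f where "f j z = x $ i * z $ j + (- (x $ j)) * z $ i" for j z
  have Pe: "P = vec.span {x}" by (rule proj_point_eq_span[OF P x])
  have "{P} = {Q \<in> proj_points. \<forall>g\<in>range f. \<forall>z\<in>Q. g z = 0}"
  proof (intro equalityI subsetI)
    fix Q assume "Q \<in> {P}"
    then show "Q \<in> {Q \<in> proj_points. \<forall>g\<in>range f. \<forall>z\<in>Q. g z = 0}"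
      using P by (auto simp: Pe vec.span_singleton f_def)
  next
    fix Q assume Q: "Q \<in> {Q \<in> proj_points. \<forall>g\<in>range f. \<forall>z\<in>Q. g z = 0}"
    have Qp: "Q \<in> proj_points" using Q by simp
    obtain z where z: "z \<in> Q" "z \<noteq> 0" using proj_point_nonzero[OF Qp] by blast
    have "f j z = 0" for j using Q z by auto
    then have e: "x $ i * z $ j = x $ j * z $ i" for j by (simp add: f_def)
    define c where "c = z $ i / x $ i"
    have "z $ j = c * x $ j" for j
    proof -
      have "x $ i * z $ j = x $ i * (c * x $ j)" using e[of j] i by (simp add: c_def)
      then show ?thesis using i by simp
    qed
    then have "z = c *s x" by (simp add: vec_eq_iff)
    then have zP: "z \<in> P" unfolding Pe vec.span_singleton by blast
    have "Q = vec.span {z}" by (rule proj_point_eq_span[OF Qp z])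
    also have "\<dots> = P" using proj_point_eq_span[OF P zP z(2)] by simp
    finally show "Q \<in> {P}" by simp
  qed
  moreover have "homogeneous_poly 1 (f j)" for j
    using homogeneous_poly.add[OF homogeneous_poly_monomial homogeneous_poly_monomial] unfolding f_def .
  then have "\<forall>g\<in>range f. \<exists>d. homogeneous_poly d g" by blast
  ultimately show ?thesis unfolding zariski_closed_def by (intro exI[of _ "range f"] conjI)
qed

lemma zariski_closed_finite:
  assumes "finite Z" "Z \<subseteq> proj_points"
  shows "zariski_closed Z"
  using assms
proof (induction Z rule: finite_induct)
  case (insert P Z)
  then show ?case using zariski_closed_Un[of "{P}" Z] zariski_closed_singleton[of P] by simp
qed (rule zariski_closed_empty)

lemma zariski_irreducible_singleton:
  assumes "P \<in> proj_points"
  shows "zariski_irreducible {P}"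
  unfolding zariski_irreducible_def
proof (intro conjI allI impI)
  show "zariski_closed {P}" by (rule zariski_closed_singleton[OF assms])
  fix A B :: "('a ^ 'b) set set" assume "zariski_closed A \<and> zariski_closed B \<and> {P} = A \<union> B"
  then have e: "{P} = A \<union> B" by simp
  then have "A \<subseteq> {P}" by simp
  then have "A = {} \<or> A = {P}" by (rule subset_singletonD)
  then show "{P} = A \<or> {P} = B" using e by (metis sup_bot_left)
qed simp

lemma line_span:
  assumes L: "L \<in> proj_lines" and x: "x \<in> L" "x \<noteq> 0" and y: "y \<in> L" "y \<notin> vec.span {x}"
  shows "L = vec.span {x, y}"
proof
  have xy: "x \<noteq> y" using y(2) vec.span_base by blast
  have "vec.independent {x}" using x(2) by simp
  then have i: "vec.independent {y, x}" by (rule vec.independent_insertI[OF y(2)])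
  show "L \<subseteq> vec.span {x, y}"
    using L x(1) y(1) i xy by (intro vec.card_ge_dim_independent) (auto simp: proj_lines_def insert_commute)
  show "vec.span {x, y} \<subseteq> L" using L x(1) y(1) by (intro vec.span_minimal) (auto simp: proj_lines_def)
qed

lemma span_in_proj_lines:
  assumes "x \<noteq> 0" "y \<notin> vec.span {x}"
  shows "vec.span {x, y} \<in> proj_lines"
proof -
  have xy: "x \<noteq> y" using assms(2) vec.span_base by blast
  have "vec.independent {x}" using assms(1) by simp
  then have "vec.independent {y, x}" by (rule vec.independent_insertI[OF assms(2)])
  then have "vec.dim (vec.span {y, x}) = card {y, x}" by (rule vec.dim_span_eq_card_independent)
  then show ?thesis using xy by (simp add: proj_lines_def insert_commute)
qed

lemma line_not_point:
  assumes L: "L \<in> proj_lines"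
  shows "\<exists>y\<in>L. y \<notin> vec.span {x}"
proof (rule ccontr)
  assume "\<not> ?thesis"
  then have "L \<subseteq> vec.span {x}" by blast
  then have "vec.dim L \<le> card {x}" by (rule vec.dim_le_card) simp
  then show False using L by (simp add: proj_lines_def)
qed

lemma mem_span_pair: "z \<in> vec.span {x, y} \<longleftrightarrow> (\<exists>a b. z = a *s x + b *s y)"
proof
  assume "z \<in> vec.span {x, y}"
  then obtain a where "z - a *s x \<in> vec.span {y}" by (auto simp: vec.span_breakdown_eq)
  then obtain b where "z - a *s x = b *s y" by (auto simp: vec.span_singleton)
  then have "z = a *s x + b *s y" by (simp add: algebra_simps)
  then show "\<exists>a b. z = a *s x + b *s y" by blast
next
  assume "\<exists>a b. z = a *s x + b *s y"
  moreover have "x \<in> vec.span {x, y}" "y \<in> vec.span {x, y}" by (auto intro: vec.span_base)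
  ultimately show "z \<in> vec.span {x, y}" using vec.span_add vec.span_scale by metis
qed

lemma zariski_closed_line:
  assumes L: "L \<in> proj_lines"
  shows "zariski_closed (points_on (L :: ('k::number_field ^ 'n) set))"
proof -
  obtain x where x: "x \<in> L" "x \<noteq> 0" using line_not_point[OF L, of 0] by auto
  obtain y where y: "y \<in> L" "y \<notin> vec.span {x}" using line_not_point[OF L] by blast
  have Le: "L = vec.span {x, y}" by (rule line_span[OF L x y])
  obtain ij where "wedge x y $ ij \<noteq> 0" using vec_nonzero_coord[OF wedge_nonzero[OF x(2) y(2)]] by blast
  then obtain i j where w: "x $ i * y $ j - x $ j * y $ i \<noteq> 0" by (cases ij) (auto simp: wedge_nth)
  define w where "w = x $ i * y $ j - x $ j * y $ i"
  \<comment> \<open>The determinant of \<open>x\<close>, \<open>y\<close>, \<open>z\<close> in the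
    coordinates \<open>i\<close>, \<open>j\<close>, \<open>k\<close>, expanded along
    \<open>z\<close>. As \<open>w\<close> is nonzero, Cramer's rule gives the coefficients of
    \<open>z\<close> below.\<close>
  define f where "f k z = (w * z $ k + (x $ j * y $ k - y $ j * x $ k) * z $ i)
    + (y $ i * x $ k - x $ i * y $ k) * z $ j" for k z
  have zero: "(\<forall>k. f k z = 0) \<longleftrightarrow> z \<in> L" for z
  proof
    assume z: "\<forall>k. f k z = 0"
    have "z = ((z $ i * y $ j - z $ j * y $ i) / w) *s x + ((x $ i * z $ j - x $ j * z $ i) / w) *s y"
    proof (subst vec_eq_iff, rule allI)
      fix k
      have "w * z $ k = (z $ i * y $ j - z $ j * y $ i) * x $ k + (x $ i * z $ j - x $ j * z $ i) * y $ k"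
        using z[rule_format, of k] by (simp add: f_def algebra_simps)
      then have "z $ k = ((z $ i * y $ j - z $ j * y $ i) * x $ k + (x $ i * z $ j - x $ j * z $ i) * y $ k) / w"
        using w unfolding w_def[symmetric] by (simp add: eq_divide_eq mult.commute)
      then show "z $ k = (((z $ i * y $ j - z $ j * y $ i) / w) *s x + ((x $ i * z $ j - x $ j * z $ i) / w) *s y) $ k"
        by (simp add: add_divide_distrib)
    qed
    then show "z \<in> L" unfolding Le mem_span_pair by blast
  next
    assume "z \<in> L"
    then obtain a b where z: "z = a *s x + b *s y" unfolding Le mem_span_pair by blast
    show "\<forall>k. f k z = 0" by (simp add: f_def w_def z algebra_simps)
  qed
  have "points_on L = {Q \<in> proj_points. \<forall>g\<in>range f. \<forall>z\<in>Q. g z = 0}"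
    using zero by (auto simp: points_on_def)
  moreover have "homogeneous_poly 1 (f k)" for k
    using homogeneous_poly.add[OF homogeneous_poly.add[OF homogeneous_poly_monomial homogeneous_poly_monomial]
        homogeneous_poly_monomial] unfolding f_def .
  then have "\<forall>g\<in>range f. \<exists>d. homogeneous_poly d g" by blast
  ultimately show ?thesis unfolding zariski_closed_def by (intro exI[of _ "range f"] conjI)
qed

text \<open>Some equation \<open>f\<close> of \<open>Z\<close> fails at a point \<open>z\<close> of
  the line. Along \<open>z + t *s v\<close> it is a polynomial in \<open>t\<close>, nonzero at 0, so
  it has finitely many roots; the parametrization misses only the point of \<open>v\<close>.\<close>

lemma finite_proper_closed_subset_of_line:
  fixes L :: "('k::number_field ^ 'n) set"
  assumes L: "L \<in> proj_lines" and Z: "zariski_closed Z" "Z \<subset> points_on L"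
  shows "finite Z"
proof -
  obtain F where F: "\<forall>f\<in>F. \<exists>d. homogeneous_poly d f" "Z = {Q \<in> proj_points. \<forall>f\<in>F. \<forall>x\<in>Q. f x = 0}"
    using Z(1) unfolding zariski_closed_def by blast
  obtain Q0 where Q0: "Q0 \<in> points_on L" "Q0 \<notin> Z" using Z(2) by blast
  then have Q0': "Q0 \<in> proj_points" "Q0 \<subseteq> L" by (auto simp: points_on_def)
  then obtain f x where f: "f \<in> F" "x \<in> Q0" "f x \<noteq> 0" using Q0(2) F(2) by blast
  obtain d where d: "homogeneous_poly d f" using F f by blast
  obtain z where z: "z \<in> Q0" "z \<noteq> 0" using proj_point_nonzero[OF Q0'(1)] by blast
  obtain a where a: "x = a *s z" using f(2) proj_point_eq_span[OF Q0'(1) z] by (auto simp: vec.span_singleton)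
  then have fz: "f z \<noteq> 0" using f(3) homogeneous_poly_scale[OF d] by auto
  obtain v where v: "v \<in> L" "v \<notin> vec.span {z}" using line_not_point[OF L] by blast
  have Le: "L = vec.span {z, v}" using line_span[OF L _ z(2) v] z(1) Q0'(2) by blast
  obtain p where p: "\<forall>t. f (z + t *s v) = poly p t" using homogeneous_poly_along_line[OF d] by blast
  have "poly p 0 \<noteq> 0" using p[rule_format, of 0] fz by simp
  then have p0: "p \<noteq> 0" by auto
  have "Z \<subseteq> insert (vec.span {v}) ((\<lambda>t. vec.span {z + t *s v}) ` {t. poly p t = 0})"
  proof
    fix Q assume Q: "Q \<in> Z"
    then have Q': "Q \<in> proj_points" "Q \<subseteq> L" using Z(2) by (auto simp: points_on_def)
    obtain y where y: "y \<in> Q" "y \<noteq> 0" using proj_point_nonzero[OF Q'(1)] by blast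
    have Qy: "Q = vec.span {y}" by (rule proj_point_eq_span[OF Q'(1) y])
    obtain a b where ab: "y = a *s z + b *s v" using y(1) Q'(2) unfolding Le by (metis mem_span_pair subsetD)
    show "Q \<in> insert (vec.span {v}) ((\<lambda>t. vec.span {z + t *s v}) ` {t. poly p t = 0})"
    proof (cases "a = 0")
      case True
      then have b: "y = b *s v" "b \<noteq> 0" using ab y(2) by auto
      have "inverse b *s y \<in> Q" unfolding Qy by (intro vec.span_scale vec.span_base) simp
      then have "v \<in> Q" using b by simp
      moreover have "v \<noteq> 0" using b y(2) by auto
      ultimately show ?thesis using proj_point_eq_span[OF Q'(1)] by blast
    next
      case False
      have "inverse a *s y \<in> Q" unfolding Qy by (intro vec.span_scale vec.span_base) simp
      moreover have e: "inverse a *s y = z + (b / a) *s v"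
        using False by (simp add: ab vec_eq_iff field_simps)
      ultimately have m: "z + (b / a) *s v \<in> Q" by simp
      then have "poly p (b / a) = 0" using Q f(1) p unfolding F(2) by force
      moreover have "z + (b / a) *s v \<noteq> 0"
        unfolding e[symmetric] using False y(2) by (simp add: vector_mul_eq_0)
      then have "Q = vec.span {z + (b / a) *s v}" using proj_point_eq_span[OF Q'(1) m] by blast
      ultimately show ?thesis by blast
    qed
  qed
  then show ?thesis using poly_roots_finite[OF p0] finite_subset by blast
qed

lemma infinite_points_on_line:
  fixes L :: "('k::number_field ^ 'n) set"
  assumes L: "L \<in> proj_lines"
  shows "infinite (points_on L)"
proof -
  obtain x where x: "x \<in> L" "x \<noteq> 0" using line_not_point[OF L, of 0] by auto
  obtain y where y: "y \<in> L" "y \<notin> vec.span {x}" using line_not_point[OF L] by blast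
  have sub: "vec.subspace L" using L by (simp add: proj_lines_def)
  define q where "q n = of_nat n *s x + y" for n
  have nz: "q n \<noteq> 0" for n
  proof
    assume "q n = 0"
    then have "y = (- of_nat n) *s x" by (simp add: q_def vec_eq_iff eq_neg_iff_add_eq_0 add.commute)
    then have "y \<in> vec.span {x}" unfolding vec.span_singleton by blast
    then show False using y(2) by simp
  qed
  have on_L: "vec.span {q n} \<in> points_on L" for n
  proof -
    have "q n \<in> L" unfolding q_def using sub x y by (intro vec.subspace_add vec.subspace_scale)
    then show ?thesis using span_in_proj_points[OF nz] sub by (auto simp: points_on_def intro: vec.span_minimal[THEN subsetD])
  qed
  have "inj (\<lambda>n. vec.span {q n})"
  proof (rule injI, rule ccontr)
    fix m n assume eq: "vec.span {q m} = vec.span {q n}" and "m \<noteq> n"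
    have "q m \<in> vec.span {q n}" unfolding eq[symmetric] by (rule vec.span_base) simp
    moreover have "q n \<in> vec.span {q n}" by (rule vec.span_base) simp
    ultimately have "q m - q n \<in> vec.span {q n}" by (rule vec.span_diff)
    moreover define e :: 'k where "e = of_nat m - of_nat n"
    have "q m - q n = e *s x" by (simp add: q_def e_def vec_eq_iff algebra_simps)
    ultimately have "inverse e *s (e *s x) \<in> vec.span {q n}" by (metis vec.span_scale)
    moreover have "e \<noteq> 0" using \<open>m \<noteq> n\<close> by (simp add: e_def)
    ultimately have "x \<in> vec.span {q n}" by simp
    then obtain c where c: "x = c *s q n" by (auto simp: vec.span_singleton)
    then have "c \<noteq> 0" using x(2) by auto
    then have "inverse c *s x = q n" by (subst c) simp
    then have "y = (inverse c - of_nat n) *s x"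
      by (simp add: q_def vec.scale_left_diff_distrib algebra_simps)
    then have "y \<in> vec.span {x}" unfolding vec.span_singleton by blast
    then show False using y(2) by simp
  qed
  then have "infinite (range (\<lambda>n. vec.span {q n}))" by (simp add: finite_image_iff)
  moreover have "range (\<lambda>n. vec.span {q n}) \<subseteq> points_on L" using on_L by (rule image_subsetI)
  ultimately show ?thesis using infinite_super by metis
qed

text \<open>Proper closed subsets are finite and the line is infinite, so the line is irreducible. A
  finite irreducible set is a single point, which leaves no room for longer chains.\<close>

theorem curve_line:
  fixes L :: "('k::number_field ^ 'n) set"
  assumes L: "L \<in> proj_lines"
  shows "curve (points_on L)"
proof -
  note fin = finite_proper_closed_subset_of_line[OF L] and inf = infinite_points_on_line[OF L]
  have irr: "zariski_irreducible (points_on L)"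
    unfolding zariski_irreducible_def
  proof (intro conjI allI impI)
    show "zariski_closed (points_on L)" by (rule zariski_closed_line[OF L])
    show "points_on L \<noteq> {}" using inf by auto
    fix A B assume AB: "zariski_closed A \<and> zariski_closed B \<and> points_on L = A \<union> B"
    show "points_on L = A \<or> points_on L = B"
    proof (rule ccontr)
      assume "\<not> ?thesis"
      then have "A \<subset> points_on L" "B \<subset> points_on L" using AB by auto
      then have "finite A" "finite B" using fin AB by blast+
      then show False using inf AB by simp
    qed
  qed
  moreover have "\<exists>Z. zariski_irreducible Z \<and> Z \<subset> points_on L"
  proof -
    obtain P where P: "P \<in> points_on L" using inf by (metis finite.emptyI ex_in_conv)
    have "{P} \<subset> points_on L" using P inf by (metis finite.simps insert_subset psubsetI empty_subsetI)
    then show ?thesis using zariski_irreducible_singleton[of P] P by (auto simp: points_on_def)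
  qed
  moreover have "\<not> (\<exists>Z0 Z1. zariski_irreducible Z0 \<and> zariski_irreducible Z1 \<and> Z0 \<subset> Z1 \<and> Z1 \<subset> points_on L)"
  proof (rule notI, elim exE conjE)
    fix Z0 Z1 assume Z0: "zariski_irreducible Z0" and Z1: "zariski_irreducible Z1"
      and sub: "Z0 \<subset> Z1" "Z1 \<subset> points_on L"
    have f: "finite Z1" using fin Z1 sub(2) by (auto simp: zariski_irreducible_def)
    have pts: "Z1 \<subseteq> proj_points" using sub(2) by (auto simp: points_on_def)
    obtain a where a: "a \<in> Z0" using Z0 by (auto simp: zariski_irreducible_def)
    obtain b where b: "b \<in> Z1" "b \<notin> Z0" using sub(1) by blast
    have "zariski_closed {a}" "zariski_closed (Z1 - {a})"
      using f pts a sub(1) by (auto intro!: zariski_closed_finite)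
    moreover have "Z1 = {a} \<union> (Z1 - {a})" using a sub(1) by blast
    ultimately have "Z1 = {a} \<or> Z1 = Z1 - {a}" using Z1 unfolding zariski_irreducible_def by blast
    then show False using a b sub(1) by blast
  qed
  ultimately show ?thesis unfolding curve_def by blast
qed

section \<open>The approximation constant\<close>

lemma wedge_nonzero_points:
  assumes P: "P \<in> proj_points" "x \<in> P" "x \<noteq> 0" and Q: "Q \<in> proj_points" "y \<in> Q" "y \<noteq> 0" and ne: "Q \<noteq> P"
  shows "y \<notin> vec.span {x}" "wedge x y \<noteq> 0"
proof -
  show ni: "y \<notin> vec.span {x}"
  proof
    assume "y \<in> vec.span {x}"
    then have "y \<in> P" using proj_point_eq_span[OF P] by blast
    then have "P = vec.span {y}" using proj_point_eq_span[OF P(1)] Q(3) by blast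
    then show False using proj_point_eq_span[OF Q] ne by blast
  qed
  show "wedge x y \<noteq> 0" by (rule wedge_nonzero[OF P(3) ni])
qed

lemma proj_dist_nonneg: "proj_dist P Q \<ge> 0"
  for P Q :: "('k::number_field ^ 'n) set"
  unfolding proj_dist_def by (intro sum_nonneg dist_vec_nonneg)

text \<open>The joining line has height at least 1, and \<open>hprod_wedge_le\<close> turns this
  into a lower bound for distance times height.\<close>

theorem liouville:
  fixes P :: "('k::number_field ^ 'n) set"
  assumes P: "P \<in> proj_points"
  obtains c where "c > 0" "\<And>Q. Q \<in> proj_points \<Longrightarrow> Q \<noteq> P \<Longrightarrow> c \<le> proj_dist P Q * height Q"
proof -
  let ?d = "field_degree TYPE('k)"
  define x where "x = coords P"
  have x: "x \<in> P" "x \<noteq> 0" unfolding x_def by (rule coords_mem[OF P])+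
  define M where "M = (sqrt 2 * real CARD('n)) ^ ?d * hprod x"
  have M: "M > 0" unfolding M_def using hprod_pos[OF x(2)] by simp
  \<comment> \<open>The minimum avoids extracting a \<open>d\<close>-th root: below 1 a positive
    power only makes the number \<open>t\<close> smaller.\<close>
  have "min 1 (1 / M) \<le> proj_dist P Q * height Q" if Q: "Q \<in> proj_points" "Q \<noteq> P" for Q
  proof -
    obtain y where y: "y \<in> Q" "y \<noteq> 0" using proj_point_nonzero[OF Q(1)] by blast
    have w: "wedge x y \<noteq> 0" by (rule wedge_nonzero_points(2)[OF P x Q(1) y Q(2)])
    define t where "t = proj_dist P Q * height Q"
    have t0: "t \<ge> 0" unfolding t_def using proj_dist_nonneg height_eq_hprod(2)[OF Q(1) y]
      by (intro mult_nonneg_nonneg) auto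
    have "1 \<le> M * t ^ ?d"
      using hprod_ge_1[OF w] hprod_wedge_le[OF P x Q(1) y w] by (simp add: M_def t_def)
    then have td: "1 / M \<le> t ^ ?d" using M by (simp add: divide_le_eq mult.commute)
    show ?thesis
    proof (cases "t \<ge> 1")
      case True
      then show ?thesis unfolding t_def[symmetric] by simp
    next
      case False
      then have "t ^ ?d \<le> t ^ 1" using t0 field_degree_pos[where 'k = 'k] by (intro power_decreasing) auto
      then show ?thesis unfolding t_def[symmetric] using td by simp
    qed
  qed
  moreover have "min 1 (1 / M) > 0" using M by simp
  ultimately show ?thesis using that by blast
qed

lemma limsup_ereal_less_PInf_iff:
  fixes f :: "nat \<Rightarrow> real"
  shows "limsup (\<lambda>i. ereal (f i)) < \<infinity> \<longleftrightarrow> (\<exists>M. \<forall>\<^sub>F i in sequentially. f i \<le> M)"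
proof
  assume "limsup (\<lambda>i. ereal (f i)) < \<infinity>"
  then obtain n :: nat where "limsup (\<lambda>i. ereal (f i)) < ereal (real n)"
    by (auto simp: less_PInf_Ex_of_nat)
  then have "\<forall>\<^sub>F i in sequentially. ereal (f i) < ereal (real n)" by (rule Limsup_lessD)
  then have "\<forall>\<^sub>F i in sequentially. f i \<le> real n" by (rule eventually_mono) simp
  then show "\<exists>M. \<forall>\<^sub>F i in sequentially. f i \<le> M" by blast
next
  assume "\<exists>M. \<forall>\<^sub>F i in sequentially. f i \<le> M"
  then obtain M where "\<forall>\<^sub>F i in sequentially. ereal (f i) \<le> ereal M" by auto
  then have "limsup (\<lambda>i. ereal (f i)) \<le> ereal M" by (rule Limsup_bounded)
  then show "limsup (\<lambda>i. ereal (f i)) < \<infinity>" by (rule le_less_trans) simp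
qed

text \<open>With \<open>t\<close> the distance and \<open>h\<close> the height, \<open>t * h\<close>
  is \<open>t powr \<beta> * h\<close> times \<open>t powr (1 - \<beta>)\<close>. For
  \<open>\<beta> < 1\<close> the last factor tends to 0 while the first stays bounded, against
  \<open>liouville\<close>.\<close>

lemma approx_exponents_ge_1:
  fixes P :: "('k::number_field ^ 'n) set"
  assumes P: "P \<in> proj_points" and s: "approx_seq P s" and b: "\<beta> \<in> approx_exponents P s"
  shows "\<beta> \<ge> 1"
proof (rule ccontr)
  assume "\<not> \<beta> \<ge> 1"
  then have b1: "1 - \<beta> > 0" by simp
  obtain c where c: "c > 0" "\<And>Q. Q \<in> proj_points \<Longrightarrow> Q \<noteq> P \<Longrightarrow> c \<le> proj_dist P Q * height Q"
    using liouville[OF P] by blast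
  define t where "t i = proj_dist P (s i)" for i
  define h where "h i = height (s i)" for i
  have si: "s i \<in> proj_points" "s i \<noteq> P" for i using s by (auto simp: approx_seq_def)
  have h0: "h i > 0" for i
    unfolding h_def using height_eq_hprod(2)[OF si(1)] proj_point_nonzero[OF si(1)] by blast
  have th: "c \<le> t i * h i" for i unfolding t_def h_def by (rule c(2)[OF si])
  \<comment> \<open>Positivity of the distance is read off from the lower bound, without any study
    of the metric.\<close>
  have t0: "t i > 0" for i
    using th[of i] c(1) h0[of i] by (metis less_le_trans zero_less_mult_pos2)
  obtain M where M: "\<forall>\<^sub>F i in sequentially. t i powr \<beta> * h i \<le> M"
    using b unfolding approx_exponents_def limsup_ereal_less_PInf_iff t_def h_def by blast
  have "\<forall>\<^sub>F i in sequentially. c \<le> M * t i powr (1 - \<beta>)"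
    using M
  proof (rule eventually_mono)
    fix i assume "t i powr \<beta> * h i \<le> M"
    then have "t i powr \<beta> * h i * t i powr (1 - \<beta>) \<le> M * t i powr (1 - \<beta>)"
      by (intro mult_right_mono) auto
    moreover have "t i powr \<beta> * t i powr (1 - \<beta>) = t i" using t0[of i] by (simp flip: powr_add)
    then have "t i powr \<beta> * h i * t i powr (1 - \<beta>) = t i * h i" by (metis mult.assoc mult.commute)
    ultimately show "c \<le> M * t i powr (1 - \<beta>)" using th[of i] by simp
  qed
  moreover have "(\<lambda>i. M * t i powr (1 - \<beta>)) \<longlonglongrightarrow> M * 0"
  proof (intro tendsto_mult tendsto_const)
    have "t = (\<lambda>i. proj_dist P (s i))" by (rule ext) (simp add: t_def)
    then have "t \<longlonglongrightarrow> 0" using s by (simp add: approx_seq_def)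
    then show "(\<lambda>i. t i powr (1 - \<beta>)) \<longlonglongrightarrow> 0"
      using tendsto_zero_powrI[of t sequentially "\<lambda>_. 1 - \<beta>" "1 - \<beta>"] b1 t0
      by (auto simp: less_imp_le)
  qed
  ultimately have "c \<le> M * 0" by (intro tendsto_lowerbound) auto
  then show False using c(1) by simp
qed

lemma one_in_approx_exponents_iff:
  "1 \<in> approx_exponents P s \<longleftrightarrow>
    (\<exists>M. \<forall>\<^sub>F i in sequentially. proj_dist P (s i) * height (s i) \<le> M)"
  unfolding approx_exponents_def limsup_ereal_less_PInf_iff
  by (simp add: abs_of_nonneg[OF proj_dist_nonneg])

lemma seq_approx_const_1:
  fixes P :: "('k::number_field ^ 'n) set"
  assumes P: "P \<in> proj_points" and s: "approx_seq P s"
    and M: "\<forall>\<^sub>F i in sequentially. proj_dist P (s i) * height (s i) \<le> M"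
  shows "seq_approx_const P s 1"
proof -
  have "1 \<in> approx_exponents P s"
    unfolding one_in_approx_exponents_iff using M by blast
  then show ?thesis using approx_exponents_ge_1[OF P s] by (simp add: seq_approx_const_def)
qed

section \<open>Approximating sequences on a line\<close>

lemma integral_scaling:
  fixes z :: "'k::number_field ^ 'n"
  shows "\<exists>c. c \<noteq> 0 \<and> (\<forall>i. algebraic_int ((c *s z) $ i))"
proof -
  have "\<exists>n::int. n > 0 \<and> algebraic_int (of_int n * z $ i)" for i
    by (rule integral_multiple[of "z $ i"]) blast
  then obtain n :: "'n \<Rightarrow> int" where n: "\<And>i. n i > 0" "\<And>i. algebraic_int (of_int (n i) * z $ i)" by metis
  define N where "N = (\<Prod>i\<in>UNIV. n i)"
  show ?thesis
  proof (intro exI[of _ "of_int N"] conjI allI)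
    have "N > 0" unfolding N_def using n by (intro prod_pos) auto
    then show "(of_int N :: 'k) \<noteq> 0" by simp
    fix i
    have "N = (\<Prod>j\<in>UNIV - {i}. n j) * n i" unfolding N_def by (subst prod.remove[of _ i]) auto
    then have "(of_int N *s z) $ i = of_int (\<Prod>j\<in>UNIV - {i}. n j) * (of_int (n i) * z $ i)"
      by (simp add: mult.assoc)
    then show "algebraic_int ((of_int N *s z) $ i)" using n(2) by (simp only: algebraic_int_add_mult algebraic_int_of_int)
  qed
qed

lemma arch_max_nonneg: "arch_max \<sigma> x \<ge> 0"
  by (simp add: arch_max_def max_abs_nonneg)

text \<open>Integral coordinates make every finite factor at most 1. Each archimedean factor is at
  most \<open>K * m\<close>, and the root of their product over the \<open>d\<close> embeddings is
  again \<open>K * m\<close>.\<close>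

lemma height_multiple_plus:
  fixes x r :: "'k::number_field ^ 'n"
  assumes int: "\<And>i. algebraic_int (x $ i)" "\<And>i. algebraic_int (r $ i)"
    and q: "\<And>m::nat. of_nat m *s x + r \<noteq> 0"
  obtains K where "K > 0" "\<And>m::nat. m \<ge> 1 \<Longrightarrow> height (vec.span {of_nat m *s x + r}) \<le> K * real m"
proof -
  let ?d = "field_degree TYPE('k)"
  define K where "K = 1 + (\<Sum>\<sigma>\<in>embeddings. arch_max \<sigma> x + arch_max \<sigma> r)"
  have K: "K > 0" unfolding K_def by (intro add_pos_nonneg sum_nonneg) (auto simp: arch_max_nonneg)
  have "height (vec.span {of_nat m *s x + r}) \<le> K * real m" if m: "m \<ge> 1" for m :: nat
  proof -
    define y where "y = of_nat m *s x + r"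
    have y0: "y \<noteq> 0" unfolding y_def by (rule q)
    have yint: "algebraic_int (y $ i)" for i
      unfolding y_def by (simp add: int algebraic_int_add_mult)
    have a: "arch_max \<sigma> y \<le> K * real m" if s: "\<sigma> \<in> embeddings" for \<sigma>
    proof -
      have "arch_max \<sigma> y \<le> real m * (arch_max \<sigma> x + arch_max \<sigma> r)"
        unfolding arch_max_def[of \<sigma> y]
      proof (rule max_abs_le)
        fix i
        have "cmod (\<sigma> (y $ i)) \<le> real m * cmod (\<sigma> (x $ i)) + cmod (\<sigma> (r $ i))"
          using s norm_triangle_ineq[of "of_nat m * \<sigma> (x $ i)" "\<sigma> (r $ i)"]
          by (simp add: y_def embedding_add embedding_mult embedding_of_nat norm_mult)
        also have "\<dots> \<le> real m * arch_max \<sigma> x + real m * arch_max \<sigma> r"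
        proof (rule add_mono)
          show "real m * cmod (\<sigma> (x $ i)) \<le> real m * arch_max \<sigma> x"
            by (intro mult_left_mono arch_max_ge) simp
          have "1 * cmod (\<sigma> (r $ i)) \<le> real m * arch_max \<sigma> r"
            using m by (intro mult_mono arch_max_ge) auto
          then show "cmod (\<sigma> (r $ i)) \<le> real m * arch_max \<sigma> r" by simp
        qed
        finally show "cmod (\<sigma> (y $ i)) \<le> real m * (arch_max \<sigma> x + arch_max \<sigma> r)"
          by (simp add: distrib_left)
      qed
      also have "\<dots> \<le> real m * K"
      proof (rule mult_left_mono)
        have "arch_max \<sigma> x + arch_max \<sigma> r \<le> (\<Sum>\<sigma>\<in>embeddings. arch_max \<sigma> x + arch_max \<sigma> r)"
          using s by (intro member_le_sum finite_embeddings) (auto simp: arch_max_nonneg)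
        then show "arch_max \<sigma> x + arch_max \<sigma> r \<le> K" by (simp add: K_def)
      qed simp
      finally show ?thesis by (simp add: mult.commute)
    qed
    have f: "fin_max \<pp> y \<le> 1" if "\<pp> \<in> fin_places" for \<pp>
      unfolding fin_max_def using fin_abs_le_1[OF that yint] by (rule max_abs_le)
    have "hprod y \<le> (\<Prod>\<sigma>\<in>(embeddings :: ('k \<Rightarrow> complex) set). K * real m) * 1"
      unfolding hprod_def
    proof (rule mult_mono)
      show "(\<Prod>\<sigma>\<in>embeddings. arch_max \<sigma> y) \<le> (\<Prod>\<sigma>\<in>(embeddings :: ('k \<Rightarrow> complex) set). K * real m)"
        using a by (intro prod_mono) (auto simp: arch_max_nonneg)
      show "(\<Prod>\<pp>\<in>{\<pp> \<in> fin_places. fin_max \<pp> y \<noteq> 1}. fin_max \<pp> y) \<le> 1"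
        using f by (intro prod_le_1) (auto simp: fin_max_nonneg)
      show "0 \<le> (\<Prod>\<sigma>\<in>(embeddings :: ('k \<Rightarrow> complex) set). K * real m)"
        using K by (intro prod_nonneg) simp
      show "0 \<le> (\<Prod>\<pp>\<in>{\<pp> \<in> fin_places. fin_max \<pp> y \<noteq> 1}. fin_max \<pp> y)"
        by (intro prod_nonneg fin_max_nonneg)
    qed
    then have "height (vec.span {y}) ^ ?d \<le> (K * real m) ^ ?d"
      using height_eq_hprod(1)[OF span_in_proj_points[OF y0] vec.span_base y0] by (simp add: card_embeddings)
    moreover have "height (vec.span {y}) > 0"
      using height_eq_hprod(2)[OF span_in_proj_points[OF y0] vec.span_base y0] by simp
    ultimately show ?thesis
      using field_degree_pos[where 'k = 'k] K unfolding y_def[symmetric]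
      by (subst (asm) power_mono_iff) auto
  qed
  then show ?thesis using that K by blast
qed

text \<open>Adding a multiple of \<open>x\<close> does not change the wedge with \<open>x\<close>,
  so the numerator of each local distance is constant while the denominator grows like
  \<open>m\<close>.\<close>

lemma dist_multiple_plus:
  fixes x r :: "'k::number_field ^ 'n"
  assumes x: "x \<noteq> 0" and q: "\<And>m::nat. of_nat m *s x + r \<noteq> 0"
  obtains C m0 where "\<And>m::nat. m \<ge> m0 \<Longrightarrow> m \<ge> 1 \<Longrightarrow>
    proj_dist (vec.span {x}) (vec.span {of_nat m *s x + r}) \<le> C / real m"
proof -
  obtain i where i: "x $ i \<noteq> 0" using vec_nonzero_coord[OF x] by blast
  define D where "D \<sigma> = norm2 (place \<sigma>) (wedge x r) / sqrt 2" for \<sigma>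
  define E where "E \<sigma> = norm2 (place \<sigma>) x * (cmod (\<sigma> (x $ i)) / 2)" for \<sigma>
  define C where "C = (\<Sum>\<sigma>\<in>embeddings. D \<sigma> / E \<sigma>)"
  \<comment> \<open>From \<open>m0\<close> on, \<open>m * x $ i\<close> has at least twice the size
    of \<open>r $ i\<close> at every embedding, so the sum keeps at least half the size of its first
    term.\<close>
  define m0 where "m0 = nat \<lceil>\<Sum>\<sigma>\<in>embeddings. 2 * cmod (\<sigma> (r $ i)) / cmod (\<sigma> (x $ i))\<rceil>"
  have "proj_dist (vec.span {x}) (vec.span {of_nat m *s x + r}) \<le> C / real m"
    if m: "m \<ge> m0" "m \<ge> 1" for m :: nat
  proof -
    define y where "y = of_nat m *s x + r"
    have y0: "y \<noteq> 0" unfolding y_def by (rule q)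
    have "proj_dist (vec.span {x}) (vec.span {y}) \<le> (\<Sum>\<sigma>\<in>embeddings. dist_vec (place \<sigma>) x y)"
      by (rule proj_dist_le[OF span_in_proj_points[OF x] vec.span_base x span_in_proj_points[OF y0] vec.span_base y0]) auto
    also have "\<dots> \<le> (\<Sum>\<sigma>\<in>embeddings. (D \<sigma> / E \<sigma>) / real m)"
    proof (rule sum_mono)
      fix \<sigma> :: "'k \<Rightarrow> complex" assume s: "\<sigma> \<in> embeddings"
      have xi: "cmod (\<sigma> (x $ i)) > 0" using s i by (simp add: embedding_eq_0_iff)
      have "2 * cmod (\<sigma> (r $ i)) / cmod (\<sigma> (x $ i)) \<le> (\<Sum>\<sigma>\<in>embeddings. 2 * cmod (\<sigma> (r $ i)) / cmod (\<sigma> (x $ i)))"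
        using s by (intro member_le_sum[of \<sigma> embeddings "\<lambda>\<sigma>. 2 * cmod (\<sigma> (r $ i)) / cmod (\<sigma> (x $ i))"] finite_embeddings) auto
      also have "\<dots> \<le> real m0" unfolding m0_def by linarith
      also have "\<dots> \<le> real m" using m by simp
      finally have "2 * cmod (\<sigma> (r $ i)) \<le> real m * cmod (\<sigma> (x $ i))" using xi by (simp add: divide_le_eq)
      moreover have "real m * cmod (\<sigma> (x $ i)) - cmod (\<sigma> (r $ i)) \<le> cmod (\<sigma> (y $ i))"
        using s norm_diff_ineq[of "of_nat m * \<sigma> (x $ i)" "\<sigma> (r $ i)"]
        by (simp add: y_def embedding_add embedding_mult embedding_of_nat norm_mult)
      ultimately have yi: "real m * (cmod (\<sigma> (x $ i)) / 2) \<le> cmod (\<sigma> (y $ i))" by linarith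
      have "cmod (\<sigma> (y $ i)) \<le> norm2 (place \<sigma>) y" using norm2_ge[of "place \<sigma>" y i] by simp
      then have ny: "real m * (cmod (\<sigma> (x $ i)) / 2) \<le> norm2 (place \<sigma>) y" using yi by linarith
      have "cmod (\<sigma> (x $ i)) \<le> norm2 (place \<sigma>) x" using norm2_ge[of "place \<sigma>" x i] by simp
      then have nx: "norm2 (place \<sigma>) x > 0" using xi by linarith
      have wy: "wedge x y = wedge x r" unfolding y_def by (rule wedge_add_left)
      have "dist_vec (place \<sigma>) x y = D \<sigma> / (norm2 (place \<sigma>) x * norm2 (place \<sigma>) y)"
        by (simp add: dist_vec_norm2 wy D_def)
      also have "\<dots> \<le> D \<sigma> / (norm2 (place \<sigma>) x * (real m * (cmod (\<sigma> (x $ i)) / 2)))"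
      proof (rule divide_left_mono)
        have pos: "real m * (cmod (\<sigma> (x $ i)) / 2) > 0" using xi m by simp
        show "norm2 (place \<sigma>) x * (real m * (cmod (\<sigma> (x $ i)) / 2)) \<le> norm2 (place \<sigma>) x * norm2 (place \<sigma>) y"
          using ny nx by (intro mult_left_mono) auto
        show "0 \<le> D \<sigma>" by (simp add: D_def norm2_nonneg)
        show "0 < norm2 (place \<sigma>) x * norm2 (place \<sigma>) y * (norm2 (place \<sigma>) x * (real m * (cmod (\<sigma> (x $ i)) / 2)))"
          by (rule mult_pos_pos[OF mult_pos_pos[OF nx less_le_trans[OF pos ny]] mult_pos_pos[OF nx pos]])
      qed
      also have "\<dots> = (D \<sigma> / E \<sigma>) / real m" by (simp add: E_def field_simps)
      finally show "dist_vec (place \<sigma>) x y \<le> (D \<sigma> / E \<sigma>) / real m" .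
    qed
    also have "\<dots> = C / real m" by (simp add: C_def sum_divide_distrib)
    finally show ?thesis by (simp add: y_def)
  qed
  then show ?thesis using that by blast
qed

lemma sequence_on_line:
  fixes P :: "('k::number_field ^ 'n) set"
  assumes P: "P \<in> proj_points" and L: "L \<in> proj_lines" and PL: "P \<subseteq> L"
  obtains s where "approx_seq P s" "seq_approx_const P s 1" "range s \<subseteq> points_on L"
proof -
  have subL: "vec.subspace L" and subP: "vec.subspace P" using L P by (auto simp: proj_lines_def proj_points_def)
  obtain x0 where x0: "x0 \<in> P" "x0 \<noteq> 0" using proj_point_nonzero[OF P] by blast
  obtain r0 where r0: "r0 \<in> L" "r0 \<notin> vec.span {x0}" using line_not_point[OF L] by blast
  obtain a where a: "a \<noteq> 0" "\<And>i. algebraic_int ((a *s x0) $ i)" using integral_scaling[of x0] by blast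
  obtain b where b: "b \<noteq> 0" "\<And>i. algebraic_int ((b *s r0) $ i)" using integral_scaling[of r0] by blast
  define x where "x = a *s x0"
  define r where "r = b *s r0"
  have x: "x \<in> P" "x \<noteq> 0" using x0 a(1) subP by (auto simp: x_def vec.subspace_scale)
  have Px: "P = vec.span {x}" by (rule proj_point_eq_span[OF P x])
  have Px0: "P = vec.span {x0}" by (rule proj_point_eq_span[OF P x0])
  have rP: "r \<notin> P"
  proof
    assume "r \<in> P"
    then have "inverse b *s r \<in> P" by (rule vec.subspace_scale[OF subP])
    then show False using r0(2) b(1) unfolding r_def Px0 by simp
  qed
  define q where "q m = of_nat m *s x + r" for m :: nat
  have qP: "q m \<notin> P" for m
  proof
    assume "q m \<in> P"
    then have "q m - of_nat m *s x \<in> P" using subP x(1) by (intro vec.subspace_diff vec.subspace_scale)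
    then show False using rP by (simp add: q_def)
  qed
  have q0: "q m \<noteq> 0" for m using qP[of m] vec.subspace_0[OF subP] by auto
  have qL: "q m \<in> L" for m
    unfolding q_def r_def using subL r0(1) x(1) PL by (intro vec.subspace_add vec.subspace_scale) auto
  obtain K where K: "K > 0" "\<And>m::nat. m \<ge> 1 \<Longrightarrow> height (vec.span {q m}) \<le> K * real m"
    using height_multiple_plus[of x r] a(2) b(2) q0 unfolding q_def x_def r_def by metis
  obtain C m0 where C: "\<And>m::nat. m \<ge> m0 \<Longrightarrow> m \<ge> 1 \<Longrightarrow> proj_dist P (vec.span {q m}) \<le> C / real m"
    using dist_multiple_plus[OF x(2), of r] q0 unfolding q_def Px by metis
  \<comment> \<open>The shift by \<open>Suc m0\<close> meets both conditions,
    \<open>m \<ge> m0\<close> and \<open>m \<ge> 1\<close>, from the first term on.\<close>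
  define s where "s i = vec.span {q (i + Suc m0)}" for i
  have si: "s i \<in> proj_points" "s i \<noteq> P" for i
  proof -
    show "s i \<in> proj_points" unfolding s_def by (rule span_in_proj_points[OF q0])
    have "q (i + Suc m0) \<in> s i" unfolding s_def by (rule vec.span_base) simp
    then show "s i \<noteq> P" using qP by blast
  qed
  have sd: "proj_dist P (s i) \<le> C / real (i + Suc m0)" for i unfolding s_def by (intro C) auto
  have sh: "height (s i) \<le> K * real (i + Suc m0)" for i unfolding s_def by (intro K) auto
  have "(\<lambda>i. proj_dist P (s i)) \<longlonglongrightarrow> 0"
  proof (rule tendsto_sandwich)
    show "(\<lambda>_. 0 :: real) \<longlonglongrightarrow> 0" by simp
    show "(\<lambda>i. C / real (i + Suc m0)) \<longlonglongrightarrow> 0"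
      using LIMSEQ_ignore_initial_segment[OF lim_const_over_n[of C], of "Suc m0"] by simp
    show "\<forall>\<^sub>F i in sequentially. proj_dist P (s i) \<le> C / real (i + Suc m0)"
      by (rule always_eventually) (use sd in blast)
    show "\<forall>\<^sub>F i in sequentially. 0 \<le> proj_dist P (s i)"
      by (rule always_eventually) (use proj_dist_nonneg in blast)
  qed
  then have as: "approx_seq P s" using si by (simp add: approx_seq_def)
  have "proj_dist P (s i) * height (s i) \<le> C * K" for i
  proof -
    have h0: "height (s i) > 0"
      using height_eq_hprod(2)[OF si(1)] proj_point_nonzero[OF si(1)] by blast
    have "proj_dist P (s i) * height (s i) \<le> (C / real (i + Suc m0)) * (K * real (i + Suc m0))"
      using sd[of i] sh[of i] h0 proj_dist_nonneg[of P "s i"] by (intro mult_mono) linarith+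
    then show ?thesis by simp
  qed
  then have "seq_approx_const P s 1" by (intro seq_approx_const_1[OF P as] always_eventually) blast
  moreover have "range s \<subseteq> points_on L"
  proof (rule image_subsetI)
    fix i
    have "s i \<subseteq> L" unfolding s_def using qL subL by (intro vec.span_minimal) auto
    then show "s i \<in> points_on L" using si(1) by (simp add: points_on_def)
  qed
  ultimately show ?thesis using that as by blast
qed

lemma line_through_point:
  fixes P :: "('k::number_field ^ 'n) set"
  assumes n: "CARD('n) \<ge> 2" and P: "P \<in> proj_points"
  obtains L where "L \<in> proj_lines" "P \<subseteq> L"
proof -
  obtain x where x: "x \<in> P" "x \<noteq> 0" using proj_point_nonzero[OF P] by blast
  have Px: "P = vec.span {x}" by (rule proj_point_eq_span[OF P x])
  have "\<exists>r. r \<notin> vec.span {x}"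
  proof (rule ccontr)
    assume "\<not> ?thesis"
    then have "UNIV \<subseteq> vec.span {x}" by blast
    then have "vec.dim (UNIV :: ('k ^ 'n) set) \<le> card {x}" by (rule vec.dim_le_card) simp
    then show False using n by (simp add: card_cart_basis)
  qed
  then obtain r where r: "r \<notin> vec.span {x}" by blast
  show ?thesis
    by (rule that[OF span_in_proj_lines[OF x(2) r]]) (unfold Px, intro vec.span_mono, simp)
qed

lemma point_approx_const_1:
  fixes P :: "('k::number_field ^ 'n) set"
  assumes n: "CARD('n) \<ge> 2" and P: "P \<in> proj_points"
  shows "point_approx_const P 1"
proof -
  obtain L where L: "L \<in> proj_lines" "P \<subseteq> L" by (rule line_through_point[OF n P])
  obtain s where "approx_seq P s" "seq_approx_const P s 1" "range s \<subseteq> points_on L"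
    by (rule sequence_on_line[OF P L])
  moreover have "1 \<le> \<beta>" if "approx_seq P s" "seq_approx_const P s \<beta>" for s \<beta>
    using approx_exponents_ge_1[OF P that(1)] that(2) by (simp add: seq_approx_const_def)
  ultimately show ?thesis unfolding point_approx_const_def by blast
qed

text \<open>Boundedness holds from some \<open>i0\<close> on, and there Northcott applies to the
  Pluecker vectors scaled to have a coordinate 1. The earlier terms add at most \<open>i0\<close>
  lines.\<close>

lemma finitely_many_lines:
  fixes P :: "('k::number_field ^ 'n) set"
  assumes P: "P \<in> proj_points" and s: "approx_seq P s" and c: "seq_approx_const P s 1"
  shows "\<exists>\<L>. finite \<L> \<and> \<L> \<subseteq> proj_lines \<and> range s \<subseteq> (\<Union>L\<in>\<L>. points_on L)"
proof -
  let ?d = "field_degree TYPE('k)"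
  have si: "s i \<in> proj_points" "s i \<noteq> P" for i using s by (auto simp: approx_seq_def)
  define x where "x = coords P"
  have x: "x \<in> P" "x \<noteq> 0" unfolding x_def by (rule coords_mem[OF P])+
  define y where "y i = coords (s i)" for i
  have y: "y i \<in> s i" "y i \<noteq> 0" for i unfolding y_def by (rule coords_mem[OF si(1)])+
  note w = wedge_nonzero_points[OF P x si(1) y si(2)]
  define L where "L i = vec.span {x, y i}" for i
  have L: "L i \<in> proj_lines" for i unfolding L_def by (rule span_in_proj_lines[OF x(2) w(1)])
  have sL: "s i \<in> points_on (L i)" for i
  proof -
    have "s i = vec.span {y i}" by (rule proj_point_eq_span[OF si(1) y])
    also have "\<dots> \<subseteq> L i" unfolding L_def by (intro vec.span_mono) simp
    finally show ?thesis using si(1) by (simp add: points_on_def)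
  qed
  have "\<exists>M. \<forall>\<^sub>F i in sequentially. proj_dist P (s i) * height (s i) \<le> M"
    using c unfolding seq_approx_const_def one_in_approx_exponents_iff by blast
  then obtain M i0 where M: "\<And>i. i \<ge> i0 \<Longrightarrow> proj_dist P (s i) * height (s i) \<le> M"
    by (auto simp: eventually_sequentially)
  define B where "B = (sqrt 2 * real CARD('n)) ^ ?d * hprod x * M ^ ?d"
  have hB: "hprod (wedge x (y i)) \<le> B" if "i \<ge> i0" for i
  proof -
    have h0: "height (s i) > 0" by (rule height_eq_hprod(2)[OF si(1) y])
    have "hprod (wedge x (y i)) \<le> (sqrt 2 * real CARD('n)) ^ ?d * hprod x * (proj_dist P (s i) * height (s i)) ^ ?d"
      by (rule hprod_wedge_le[OF P x si(1) y w(2)])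
    also have "\<dots> \<le> B" unfolding B_def
      using M[OF that] h0 proj_dist_nonneg[of P "s i"] hprod_pos[OF x(2)]
      by (intro mult_left_mono power_mono) auto
    finally show ?thesis .
  qed
  have "\<exists>a. a \<noteq> 0 \<and> (\<exists>k. (a *s wedge x (y i)) $ k = 1)" for i
  proof -
    obtain k where k: "wedge x (y i) $ k \<noteq> 0" using vec_nonzero_coord[OF w(2)] by blast
    then show ?thesis
      by (intro exI[of _ "inverse (wedge x (y i) $ k)"] conjI exI[of _ k]) simp_all
  qed
  then obtain a where a: "\<And>i. a i \<noteq> 0" "\<And>i. \<exists>k. (a i *s wedge x (y i)) $ k = 1" by metis
  define u where "u i = a i *s wedge x (y i)" for i
  have "u ` {i0..} \<subseteq> {u. (\<exists>k. u $ k = 1) \<and> hprod u \<le> B}"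
  proof (rule image_subsetI)
    fix i assume "i \<in> {i0..}"
    then show "u i \<in> {u. (\<exists>k. u $ k = 1) \<and> hprod u \<le> B}"
      using a(2)[of i] hB[of i] by (simp add: u_def hprod_scale[OF a(1) w(2)])
  qed
  then have "finite (u ` {i0..})" using northcott finite_subset by blast
  \<comment> \<open>Equal scaled vectors mean proportional wedges with the common point
    \<open>x\<close>, so both pairs span the same plane.\<close>
  moreover have Lu: "L j = L i" if "u i = u j" for i j
  proof -
    have "inverse (a j) *s u j = wedge x (y j)" using a(1)[of j] by (simp add: u_def)
    then have "wedge x (y j) = (inverse (a j) * a i) *s wedge x (y i)"
      using that by (simp add: u_def) (metis vec.scale_scale)
    then have "y j \<in> L i" unfolding L_def by (rule mem_span_if_wedge_eq[OF x(2)])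
    moreover have "x \<in> L i" unfolding L_def by (rule vec.span_base) simp
    ultimately show ?thesis
      using line_span[OF L[of i] _ x(2) _ w(1)[of j]] by (simp add: L_def)
  qed
  have "L ` {i0..} \<subseteq> (\<lambda>v. L (SOME i. u i = v)) ` (u ` {i0..})"
  proof (rule image_subsetI)
    fix i assume i: "i \<in> {i0..}"
    have "\<exists>j. u j = u i" by blast
    then have "u (SOME j. u j = u i) = u i" by (rule someI_ex)
    then have "L i = L (SOME j. u j = u i)" by (rule Lu)
    then show "L i \<in> (\<lambda>v. L (SOME i. u i = v)) ` (u ` {i0..})" using i by blast
  qed
  ultimately have "finite (L ` {i0..})" using finite_subset by blast
  moreover have "(UNIV :: nat set) = {..<i0} \<union> {i0..}" by auto
  then have "range L = L ` {..<i0} \<union> L ` {i0..}" by (metis image_Un)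
  ultimately have "finite (range L)" by simp
  moreover have "range L \<subseteq> proj_lines" using L by blast
  moreover have "range s \<subseteq> (\<Union>L\<in>range L. points_on L)" using sL by blast
  ultimately show ?thesis by blast
qed

text \<open>\<open>CARD('n) \<ge> 2\<close> says that the projective dimension is at least 1; a
  projective space with a single point admits no approximating sequence.\<close>

theorem theorem2p6:
  fixes P :: "('k::number_field ^ 'n) set"
  assumes "CARD('n) \<ge> 2"
    and "P \<in> proj_points"
  shows "(\<exists>s. best_approx_seq P s) \<and>
    (\<forall>s. best_approx_seq P s \<longrightarrow>
       (\<exists>\<L>. finite \<L> \<and> \<L> \<subseteq> proj_lines \<and> range s \<subseteq> (\<Union>L\<in>\<L>. points_on L)) \<and>
       seq_approx_const P s 1) \<and>
    (\<forall>L\<in>proj_lines. P \<in> points_on L \<longrightarrow> best_approx_curve P (points_on L))"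
proof (intro conjI allI ballI impI)
  note const = point_approx_const_1[OF assms]
  have on_line: "\<exists>s. best_approx_seq P s \<and> range s \<subseteq> points_on L"
    if LP: "L \<in> proj_lines" "P \<subseteq> L" for L
  proof -
    obtain s where "approx_seq P s" "seq_approx_const P s 1" "range s \<subseteq> points_on L"
      by (rule sequence_on_line[OF assms(2) LP])
    then show ?thesis using const unfolding best_approx_seq_def by blast
  qed
  obtain L where "L \<in> proj_lines" "P \<subseteq> L" by (rule line_through_point[OF assms])
  then show "\<exists>s. best_approx_seq P s" using on_line by blast
  {
    fix s assume "best_approx_seq P s"
    then obtain \<alpha> where s: "approx_seq P s" and \<alpha>: "seq_approx_const P s \<alpha>" "point_approx_const P \<alpha>"
      unfolding best_approx_seq_def by blast
    have "\<alpha> = 1"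
    proof (rule antisym)
      show "\<alpha> \<le> 1" using \<alpha>(2) const unfolding point_approx_const_def by blast
      show "1 \<le> \<alpha>" using \<alpha>(1) const s unfolding point_approx_const_def by blast
    qed
    then show s1: "seq_approx_const P s 1" using \<alpha>(1) by simp
    show "\<exists>\<L>. finite \<L> \<and> \<L> \<subseteq> proj_lines \<and> range s \<subseteq> (\<Union>L\<in>\<L>. points_on L)"
      by (rule finitely_many_lines[OF assms(2) s s1])
  }
  fix L :: "('k ^ 'n) set" assume L: "L \<in> proj_lines" "P \<in> points_on L"
  then have "P \<subseteq> L" by (simp add: points_on_def)
  then show "best_approx_curve P (points_on L)"
    unfolding best_approx_curve_def using curve_line[OF L(1)] L(2) on_line[OF L(1)] by blast
qed

end
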